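(* Let $n\ge2$, let $\Omega\subset\mathbb{R}^n$ be a bounded domain with $C^{1,\varepsilon}$ boundary, let $1<p\le n$ and $m>0$. Then $$\lambda(m,\Omega)=\inf_{\sigma\in\Sigma_m(\partial\Omega)}\ell_1(\sigma,\Omega)=0,$$ and the infimum is not achieved by any $\sigma\in\Sigma_m(\partial\Omega)$.
   Context: $\mathcal H^{n-1}$ is the $(n-1)$-dimensional Hausdorff measure. For $\sigma\in L^1(\partial\Omega)$, $\sigma\ge0$, and $u\in W^{1,p}(\Omega)$, $u\ne0$, set $$\mathcal Q[\sigma,u]=\frac{\int_\Omega|\nabla u|^p\,dx+\int_{\partial\Omega}\sigma|u|^p\,d\mathcal H^{n-1}}{\int_\Omega|u|^p\,dx}$$ if the right-hand side is finite and $\mathcal Q[\sigma,u]=+\infty$ otherwise ($u$ on $\partial\Omega$ being understood as the trace), and $$\ell_1(\sigma,\Omega)=\inf_{u\in W^{1,p}(\Omega),\,u\neq0}\mathcal Q[\sigma,u].$$ For $m>0$, $$\Sigma_m(\partial\Omega)=\Big\{\sigma\in L^1(\partial\Omega):\ \sigma\ge0,\ \int_{\partial\Omega}\sigma\,d\mathcal H^{n-1}=m\Big\}.$$ *)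

theory Defs
  imports "HOL-Analysis.Analysis"
begin

subsection \<open>Hausdorff measure\<close>

text \<open>
  The normalisation is the one for which the \<open>n\<close>-dimensional Hausdorff measure on an
  \<open>n\<close>-dimensional space is Lebesgue measure. The dimension \<open>s\<close> is meant to be positive
  (\<open>0 powr 0 = 0\<close> would be the wrong convention for \<open>s = 0\<close>). Covering sets are required to be
  bounded because \<^const>\<open>diameter\<close> is unspecified on unbounded sets.
\<close>

definition hausdorff_content :: "real \<Rightarrow> real \<Rightarrow> 'a::metric_space set \<Rightarrow> ennreal" where
  "hausdorff_content s \<delta> A =
     (INF C \<in> {C :: nat \<Rightarrow> 'a set.
                 A \<subseteq> (\<Union>k. C k) \<and> (\<forall>k. bounded (C k) \<and> diameter (C k) \<le> \<delta>)}.
        \<Sum>k. ennreal (unit_ball_vol s * (diameter (C k) / 2) powr s))"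

definition hausdorff_outer :: "real \<Rightarrow> 'a::metric_space set \<Rightarrow> ennreal" where
  "hausdorff_outer s A = (SUP \<delta>\<in>{0<..}. hausdorff_content s \<delta> A)"

text \<open>The \<^const>\<open>lambda_system\<close> consists of the Caratheodory measurable sets.\<close>

definition hausdorff_measure :: "real \<Rightarrow> 'a::metric_space measure" where
  "hausdorff_measure s =
     measure_of UNIV (lambda_system UNIV UNIV (hausdorff_outer s)) (hausdorff_outer s)"

definition surface_measure :: "'a::euclidean_space set \<Rightarrow> 'a measure" where
  "surface_measure \<Omega> =
     restrict_space (hausdorff_measure (real DIM('a) - 1)) (frontier \<Omega>)"


subsection \<open>Domains with Hoelder continuously differentiable boundary\<close>

text \<open>
  Near each boundary point, after a rigid motion, \<open>\<Omega>\<close> is the part above the graph of a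
  \<open>C\<^sup>1\<^sup>,\<^sup>\<epsilon>\<close> function of \<open>n - 1\<close> variables. The unit vector \<open>e\<close> is the vertical direction;
  a function on the hyperplane orthogonal to \<open>e\<close> is represented by its extension \<open>\<gamma>\<close> to the
  whole space that is constant along \<open>e\<close>, with gradient \<open>\<Gamma>\<close>.
\<close>

definition C1_Hoelder_boundary :: "real \<Rightarrow> 'a::euclidean_space set \<Rightarrow> bool" where
  "C1_Hoelder_boundary \<epsilon> \<Omega> \<longleftrightarrow>
     (\<forall>x0\<in>frontier \<Omega>. \<exists>r>0. \<exists>e \<gamma> \<Gamma> C.
        norm e = 1 \<and>
        (\<forall>x t. \<gamma> (x + t *\<^sub>R e) = \<gamma> x) \<and>
        (\<forall>x. (\<gamma> has_derivative (\<lambda>h. \<Gamma> x \<bullet> h)) (at x)) \<and>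
        (\<forall>x y. norm (\<Gamma> x - \<Gamma> y) \<le> C * dist x y powr \<epsilon>) \<and>
        \<Omega> \<inter> ball x0 r = {x \<in> ball x0 r. \<gamma> x < x \<bullet> e})"


subsection \<open>Sobolev functions\<close>

definition partial :: "'a::euclidean_space \<Rightarrow> ('a \<Rightarrow> real) \<Rightarrow> 'a \<Rightarrow> real" where
  "partial i f x = frechet_derivative f (at x) i"

definition grad :: "('a::euclidean_space \<Rightarrow> real) \<Rightarrow> 'a \<Rightarrow> 'a" where
  "grad f x = (\<Sum>i\<in>Basis. partial i f x *\<^sub>R i)"

fun Ck :: "nat \<Rightarrow> ('a::euclidean_space \<Rightarrow> real) \<Rightarrow> bool" where
  "Ck 0 f \<longleftrightarrow> continuous_on UNIV f"
| "Ck (Suc k) f \<longleftrightarrow> (\<forall>x. f differentiable (at x)) \<and> (\<forall>i\<in>Basis. Ck k (partial i f))"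

definition test_function :: "'a::euclidean_space set \<Rightarrow> ('a \<Rightarrow> real) \<Rightarrow> bool" where
  "test_function \<Omega> \<phi> \<longleftrightarrow>
     (\<forall>k. Ck k \<phi>) \<and> compact (closure {x. \<phi> x \<noteq> 0}) \<and> closure {x. \<phi> x \<noteq> 0} \<subseteq> \<Omega>"

definition Lp :: "real \<Rightarrow> 'a measure \<Rightarrow> ('a \<Rightarrow> 'b::euclidean_space) set" where
  "Lp p M = {f \<in> borel_measurable M. integrable M (\<lambda>x. norm (f x) powr p)}"

definition locally_integrable ::
    "'a::euclidean_space set \<Rightarrow> ('a \<Rightarrow> 'b::euclidean_space) \<Rightarrow> bool" where
  "locally_integrable \<Omega> f \<longleftrightarrow> (\<forall>K. compact K \<and> K \<subseteq> \<Omega> \<longrightarrow> integrable (lebesgue_on K) f)"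

definition has_weak_gradient ::
    "'a::euclidean_space set \<Rightarrow> ('a \<Rightarrow> real) \<Rightarrow> ('a \<Rightarrow> 'a) \<Rightarrow> bool" where
  "has_weak_gradient \<Omega> u G \<longleftrightarrow>
     locally_integrable \<Omega> u \<and> locally_integrable \<Omega> G \<and>
     (\<forall>\<phi>. test_function \<Omega> \<phi> \<longrightarrow> (\<forall>i\<in>Basis.
        (LINT x|lebesgue_on \<Omega>. u x * partial i \<phi> x) =
        - (LINT x|lebesgue_on \<Omega>. (G x \<bullet> i) * \<phi> x)))"

text \<open>A representative of the weak gradient, which is unique up to null sets.\<close>

definition weak_grad :: "'a::euclidean_space set \<Rightarrow> ('a \<Rightarrow> real) \<Rightarrow> 'a \<Rightarrow> 'a" where
  "weak_grad \<Omega> u = (SOME G. has_weak_gradient \<Omega> u G)"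

definition W1p :: "real \<Rightarrow> 'a::euclidean_space set \<Rightarrow> ('a \<Rightarrow> real) set" where
  "W1p p \<Omega> =
     {u \<in> Lp p (lebesgue_on \<Omega>). \<exists>G \<in> Lp p (lebesgue_on \<Omega>). has_weak_gradient \<Omega> u G}"

text \<open>
  The trace operator is the continuous extension, from \<open>W\<^sup>1\<^sup>,\<^sup>p(\<Omega>)\<close> to \<open>L\<^sup>p(\<partial>\<Omega>)\<close>, of the
  restriction to \<open>\<partial>\<Omega>\<close> of functions that are \<open>C\<^sup>1\<close> up to the boundary (here: restrictions
  of \<open>C\<^sup>1\<close> functions on the whole space). So \<open>g\<close> is the trace of \<open>u\<close> if such functions \<open>U k\<close>
  converge to \<open>u\<close> in \<open>W\<^sup>1\<^sup>,\<^sup>p(\<Omega>)\<close> while their boundary values converge to \<open>g\<close> in \<open>L\<^sup>p(\<partial>\<Omega>)\<close>.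
\<close>

definition has_trace ::
    "real \<Rightarrow> 'a::euclidean_space set \<Rightarrow> ('a \<Rightarrow> real) \<Rightarrow> ('a \<Rightarrow> real) \<Rightarrow> bool" where
  "has_trace p \<Omega> u g \<longleftrightarrow>
     g \<in> Lp p (surface_measure \<Omega>) \<and>
     (\<exists>U :: nat \<Rightarrow> 'a \<Rightarrow> real. (\<forall>k. Ck 1 (U k)) \<and>
        (\<lambda>k. \<integral>\<^sup>+x. ennreal (\<bar>U k x - u x\<bar> powr p) \<partial>lebesgue_on \<Omega>) \<longlonglongrightarrow> 0 \<and>
        (\<lambda>k. \<integral>\<^sup>+x. ennreal (norm (grad (U k) x - weak_grad \<Omega> u x) powr p) \<partial>lebesgue_on \<Omega>) \<longlonglongrightarrow> 0 \<and>
        (\<lambda>k. \<integral>\<^sup>+x. ennreal (\<bar>U k x - g x\<bar> powr p) \<partial>surface_measure \<Omega>) \<longlonglongrightarrow> 0)"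

definition boundary_trace ::
    "real \<Rightarrow> 'a::euclidean_space set \<Rightarrow> ('a \<Rightarrow> real) \<Rightarrow> 'a \<Rightarrow> real" where
  "boundary_trace p \<Omega> u = (SOME g. has_trace p \<Omega> u g)"


subsection \<open>The eigenvalue problem\<close>

text \<open>
  Division in \<^typ>\<open>ennreal\<close> gives the value \<open>\<infinity>\<close> when the boundary integral is infinite and
  \<open>u \<noteq> 0\<close>. A function without trace also gets the value \<open>\<infinity>\<close>; by the trace theorem this does
  not occur for \<open>u \<in> W\<^sup>1\<^sup>,\<^sup>p(\<Omega>)\<close> on bounded \<open>C\<^sup>1\<close> domains.
\<close>

definition rayleigh_quotient ::
    "real \<Rightarrow> 'a::euclidean_space set \<Rightarrow> ('a \<Rightarrow> real) \<Rightarrow> ('a \<Rightarrow> real) \<Rightarrow> ennreal" where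
  "rayleigh_quotient p \<Omega> \<sigma> u =
     (if \<exists>g. has_trace p \<Omega> u g then
        ((\<integral>\<^sup>+x. ennreal (norm (weak_grad \<Omega> u x) powr p) \<partial>lebesgue_on \<Omega>)
         + (\<integral>\<^sup>+x. ennreal (\<sigma> x * \<bar>boundary_trace p \<Omega> u x\<bar> powr p) \<partial>surface_measure \<Omega>))
        / (\<integral>\<^sup>+x. ennreal (\<bar>u x\<bar> powr p) \<partial>lebesgue_on \<Omega>)
      else \<infinity>)"

definition first_eigenvalue ::
    "real \<Rightarrow> ('a::euclidean_space \<Rightarrow> real) \<Rightarrow> 'a set \<Rightarrow> ennreal" where
  "first_eigenvalue p \<sigma> \<Omega> =
     (INF u \<in> {u \<in> W1p p \<Omega>. \<not> (AE x in lebesgue_on \<Omega>. u x = 0)}. rayleigh_quotient p \<Omega> \<sigma> u)"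

definition Sigma_mass :: "real \<Rightarrow> 'a::euclidean_space set \<Rightarrow> ('a \<Rightarrow> real) set" where
  "Sigma_mass m \<Omega> =
     {\<sigma>. integrable (surface_measure \<Omega>) \<sigma> \<and> (AE x in surface_measure \<Omega>. 0 \<le> \<sigma> x) \<and>
         (LINT x|surface_measure \<Omega>. \<sigma> x) = m}"

definition optimal_eigenvalue :: "real \<Rightarrow> real \<Rightarrow> 'a::euclidean_space set \<Rightarrow> ennreal" where
  "optimal_eigenvalue p m \<Omega> = (INF \<sigma> \<in> Sigma_mass m \<Omega>. first_eigenvalue p \<sigma> \<Omega>)"

end

theory Submission
  imports Defs "HOL-Computational_Algebra.Polynomial"
begin

text \<open>
  For \<open>p \<le> n\<close> a boundary point \<open>x0\<close> has zero \<open>p\<close>-capacity: averaging cutoffs over many dyadic scales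
  gives functions that vanish near \<open>x0\<close>, equal 1 away from it and have arbitrarily small Dirichlet
  energy. Putting the whole mass of \<open>\<sigma>\<close> on the part of the boundary where such a function
  vanishes makes the quotient arbitrarily small.

  Conversely, if the quotients \<open>Q[\<sigma>, u j]\<close> tend to 0 for a fixed \<open>\<sigma>\<close>, replace \<open>u j\<close> by smooth
  approximations \<open>U j\<close> and consider \<open>w j = |U j|^p / \<integral>|u j|^p\<close>, whose gradients tend to 0 in \<open>L\<^sup>1\<close>. Since
  translations along segments inside \<open>\<Omega>\<close> change \<open>w j\<close> little in \<open>L\<^sup>1\<close>, connectedness yields positive
  constants \<open>a j\<close>, bounded away from 0, with \<open>w j - a j \<rightarrow> 0\<close> in \<open>L\<^sup>1(\<Omega>)\<close> and, by the trace
  inequality, in \<open>L\<^sup>1(\<partial>\<Omega>)\<close>. Comparing with \<open>\<integral>\<sigma> w j \<rightarrow> 0\<close> gives \<open>\<integral> \<sigma> / (1 + \<sigma>) = 0\<close>, so \<open>\<sigma> = 0\<close>.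

  The trace inequality compares the surface measure with the image of Lebesgue measure under the
  vertical projection onto the graph.
\<close>


subsection \<open>Hausdorff measure: Borel sets and density comparison\<close>

text \<open>Two features of the definitions shape the proof. \<open>weak_grad\<close> and
  \<open>boundary_trace\<close> are unspecified choices, so every estimate must hold for whichever
  gradient or trace is picked. And the surface measure is a Hausdorff measure on its Caratheodory
  sets: Borel measurability, finiteness, positivity and the trace inequality have to come from
  coverings and packings. Constants depending on the chart are harmless there, since only vanishing
  limits, finiteness and positivity are drawn from these estimates. Passing to p-th powers puts
  everything into L^1, where translation, Fubini and the fundamental theorem of calculus yield both
  the Poincare and the trace estimate. The weight \<open>\<sigma> / (1 + \<sigma>)\<close> answers a
  mismatch: the smooth \<open>U j\<close> are close to the trace \<open>g j\<close> only in L^p of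
  the boundary, while \<sigma> is merely integrable. Hence the integral of
  \<open>\<sigma> * \<bar>g j\<bar> powr p\<close> is small, but nothing follows for
  \<open>U j\<close> in place of \<open>g j\<close>. The weight is at most 1, which serves the
  approximation errors, and at most \<sigma>, which serves the boundary integral.\<close>

lemma hausdorff_content_mono:
  "A \<subseteq> B \<Longrightarrow> hausdorff_content s \<delta> A \<le> hausdorff_content s \<delta> B"
  unfolding hausdorff_content_def by (intro INF_superset_mono) auto

lemma hausdorff_content_antimono:
  "\<delta>1 \<le> \<delta>2 \<Longrightarrow> hausdorff_content s \<delta>2 A \<le> hausdorff_content s \<delta>1 A"
  unfolding hausdorff_content_def by (intro INF_superset_mono) (auto intro: order_trans)

lemma hausdorff_content_le:
  assumes "A \<subseteq> (\<Union>k. C k)" "\<And>k. bounded (C k)" "\<And>k. diameter (C k) \<le> \<delta>"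
  shows "hausdorff_content s \<delta> A \<le> (\<Sum>k. ennreal (unit_ball_vol s * (diameter (C k) / 2) powr s))"
  unfolding hausdorff_content_def using assms by (intro INF_lower) auto

lemma hausdorff_content_empty: 
  assumes "0 \<le> \<delta>" shows "hausdorff_content s \<delta> {} = 0"
  using hausdorff_content_le[of "{}" "\<lambda>_. {}" \<delta> s] assms by auto

lemma hausdorff_content_countably_subadditive:
  fixes A :: "nat \<Rightarrow> 'a::metric_space set"
  shows "hausdorff_content s \<delta> (\<Union>i. A i) \<le> (\<Sum>i. hausdorff_content s \<delta> (A i))"
proof (rule ennreal_le_epsilon)
  let ?f = "\<lambda>C::'a set. ennreal (unit_ball_vol s * (diameter C / 2) powr s)"
  fix e :: real assume "0 < e" and fin: "(\<Sum>i. hausdorff_content s \<delta> (A i)) < top"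
  then have *: "hausdorff_content s \<delta> (A n) < hausdorff_content s \<delta> (A n) + e * (1/2)^Suc n" for n
    by (auto simp add: less_top dest!: ennreal_suminf_lessD)
  have "\<exists>C. A n \<subseteq> (\<Union>k. C k) \<and> (\<forall>k. bounded (C k) \<and> diameter (C k) \<le> \<delta>) \<and>
      (\<Sum>k. ?f (C k)) \<le> hausdorff_content s \<delta> (A n) + e * (1/2)^Suc n" for n
    using *[of n] unfolding hausdorff_content_def[of s \<delta> "A n"] INF_less_iff
    by (auto intro: less_imp_le)
  then obtain B where B: "\<And>n. A n \<subseteq> (\<Union>k. B n k)"
    "\<And>n k. bounded (B n k)" "\<And>n k. diameter (B n k) \<le> \<delta>"
    "\<And>n. (\<Sum>k. ?f (B n k)) \<le> hausdorff_content s \<delta> (A n) + e * (1/2)^Suc n"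
    by metis
  define C where "C = case_prod B o prod_decode"
  have A_C: "(\<Union>i. A i) \<subseteq> (\<Union>i. C i)"
    using B(1) by (auto simp add: C_def subset_eq) (metis prod.case prod_encode_inverse)
  have "hausdorff_content s \<delta> (\<Union>i. A i) \<le> (\<Sum>i. ?f (C i))"
    using A_C B by (intro hausdorff_content_le) (auto simp: C_def split: prod.split)
  also have "\<dots> = (\<Sum>n. \<Sum>i. ?f (B n i))"
    unfolding C_def comp_def
    using suminf_ennreal_2dimen[of "\<lambda>n. \<Sum>i. ?f (B n i)" "\<lambda>x. ?f (case_prod B x)"] by simp
  also have "\<dots> \<le> (\<Sum>n. hausdorff_content s \<delta> (A n) + e * (1/2) ^ Suc n)"
    by (intro suminf_le B) auto
  also have "... = (\<Sum>n. hausdorff_content s \<delta> (A n)) + (\<Sum>n. ennreal e * ennreal ((1/2) ^ Suc n))"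
    using \<open>0 < e\<close> by (subst suminf_add[symmetric])
                     (auto simp del: ennreal_suminf_cmult simp add: ennreal_mult[symmetric])
  also have "\<dots> = (\<Sum>n. hausdorff_content s \<delta> (A n)) + e"
    unfolding ennreal_suminf_cmult
    by (subst suminf_ennreal_eq[OF zero_le_power power_half_series]) auto
  finally show "hausdorff_content s \<delta> (\<Union>i. A i) \<le> (\<Sum>n. hausdorff_content s \<delta> (A n)) + e" .
qed

lemma hausdorff_outer_empty: "hausdorff_outer s {} = 0"
  unfolding hausdorff_outer_def by (simp add: hausdorff_content_empty)

lemma hausdorff_outer_mono: "A \<subseteq> B \<Longrightarrow> hausdorff_outer s A \<le> hausdorff_outer s B"
  unfolding hausdorff_outer_def by (intro SUP_mono) (auto intro: hausdorff_content_mono)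

lemma hausdorff_content_le_outer: "0 < \<delta> \<Longrightarrow> hausdorff_content s \<delta> A \<le> hausdorff_outer s A"
  unfolding hausdorff_outer_def by (intro SUP_upper) auto

lemma hausdorff_outer_countably_subadditive:
  "hausdorff_outer s (\<Union>i. A i) \<le> (\<Sum>i. hausdorff_outer s (A i))"
  unfolding hausdorff_outer_def[of s "\<Union>i. A i"]
  by (intro SUP_least order_trans[OF hausdorff_content_countably_subadditive] suminf_le
      hausdorff_content_le_outer) auto

lemma outer_measure_space_hausdorff: "outer_measure_space UNIV (hausdorff_outer s)"
  by (auto simp: outer_measure_space_def positive_def increasing_def countably_subadditive_def
      hausdorff_outer_empty hausdorff_outer_mono hausdorff_outer_countably_subadditive)

lemma hausdorff_outer_Un_le:
  "hausdorff_outer s (A \<union> B) \<le> hausdorff_outer s A + hausdorff_outer s B"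
proof -
  have "hausdorff_outer s (A \<union> B) = hausdorff_outer s (\<Union>i::nat. if i = 0 then A else if i = 1 then B else {})"
    by (intro arg_cong[where f="hausdorff_outer s"]) (auto split: if_splits intro: exI[of _ 0] exI[of _ 1])
  also have "\<dots> \<le> (\<Sum>i. hausdorff_outer s (if i = 0 then A else if i = 1 then B else {}))"
    by (rule hausdorff_outer_countably_subadditive)
  also have "\<dots> = (\<Sum>i\<in>{0,1::nat}. hausdorff_outer s (if i = 0 then A else if i = 1 then B else {}))"
    by (rule suminf_finite) (auto simp: hausdorff_outer_empty)
  finally show ?thesis by simp
qed

text \<open>Below the distance of the two sets, no covering set meets both.\<close>

lemma hausdorff_outer_add_separated:
  assumes "\<And>a b. a \<in> A \<Longrightarrow> b \<in> B \<Longrightarrow> \<eta> \<le> dist a b" and "0 < \<eta>" and "0 \<le> s"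
  shows "hausdorff_outer s A + hausdorff_outer s B \<le> hausdorff_outer s (A \<union> B)"
proof -
  let ?f = "\<lambda>C::'a set. ennreal (unit_ball_vol s * (diameter C / 2) powr s)"
  have *: "hausdorff_content s \<delta> A + hausdorff_content s \<delta> B \<le> hausdorff_content s \<delta> (A \<union> B)"
    if "0 < \<delta>" "\<delta> < \<eta>" for \<delta>
    unfolding hausdorff_content_def[of s \<delta> "A \<union> B"]
  proof (safe intro!: INF_greatest)
    fix C :: "nat \<Rightarrow> 'a set"
    assume C: "A \<union> B \<subseteq> (\<Union>k. C k)" "\<forall>k. bounded (C k) \<and> diameter (C k) \<le> \<delta>"
    have "hausdorff_content s \<delta> A + hausdorff_content s \<delta> B \<le>
        (\<Sum>k. ?f (C k \<inter> A)) + (\<Sum>k. ?f (C k \<inter> B))"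
      using C by (intro add_mono hausdorff_content_le)
        (auto intro: bounded_subset order_trans[OF diameter_subset])
    also have "\<dots> = (\<Sum>k. ?f (C k \<inter> A) + ?f (C k \<inter> B))"
      by (intro suminf_add) auto
    also have "\<dots> \<le> (\<Sum>k. ?f (C k))"
    proof (intro suminf_le)
      fix k
      have "C k \<inter> A = {} \<or> C k \<inter> B = {}"
      proof (rule ccontr)
        assume "\<not> ?thesis"
        then obtain a b where ab: "a \<in> C k" "a \<in> A" "b \<in> C k" "b \<in> B" by auto
        have "\<eta> \<le> dist a b" using assms ab by auto
        also have "\<dots> \<le> diameter (C k)" using ab C by (intro diameter_bounded_bound) auto
        finally show False using C(2)[rule_format, of k] that by simp
      qed
      moreover have "?f (C k \<inter> X) \<le> ?f (C k)" for X
        using C \<open>0 \<le> s\<close> unit_ball_vol_pos[of s]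
        by (intro ennreal_leI mult_left_mono powr_mono2 divide_right_mono)
          (auto intro!: diameter_subset diameter_ge_0 bounded_subset[of "C k" "C k \<inter> X"])
      ultimately show "?f (C k \<inter> A) + ?f (C k \<inter> B) \<le> ?f (C k)" by auto
    qed auto
    finally show "hausdorff_content s \<delta> A + hausdorff_content s \<delta> B \<le> (\<Sum>k. ?f (C k))" .
  qed
  \<comment> \<open>Contents grow as \<delta> shrinks, so the two suprema merge into one over a
    common \<delta>, which may be taken below \<eta>.\<close>
  have "hausdorff_outer s A + hausdorff_outer s B =
      (SUP \<delta>\<in>{0<..}. hausdorff_content s \<delta> A + hausdorff_content s \<delta> B)"
    unfolding hausdorff_outer_def
  proof (rule SUP_add_directed_ennreal[symmetric])
    fix i j :: real assume "i \<in> {0<..}" "j \<in> {0<..}"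
    then show "\<exists>k\<in>{0<..}. hausdorff_content s i A + hausdorff_content s j B
        \<le> hausdorff_content s k A + hausdorff_content s k B"
      by (intro bexI[of _ "min i j"] add_mono hausdorff_content_antimono) auto
  qed
  also have "\<dots> \<le> hausdorff_outer s (A \<union> B)"
  proof (rule SUP_least)
    fix \<delta> :: real assume "\<delta> \<in> {0<..}"
    then have d: "0 < min \<delta> (\<eta>/2)" "min \<delta> (\<eta>/2) < \<eta>" using assms by auto
    have "hausdorff_content s \<delta> A + hausdorff_content s \<delta> B \<le>
       hausdorff_content s (min \<delta> (\<eta>/2)) A + hausdorff_content s (min \<delta> (\<eta>/2)) B"
      by (intro add_mono hausdorff_content_antimono) auto
    also have "\<dots> \<le> hausdorff_outer s (A \<union> B)"
      using *[OF d] hausdorff_content_le_outer[OF d(1), of s "A \<union> B"] by simp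
    finally show "hausdorff_content s \<delta> A + hausdorff_content s \<delta> B \<le> hausdorff_outer s (A \<union> B)" .
  qed
  finally show ?thesis .
qed

lemma ennreal_suminf_tail_tendsto_0:
  fixes f :: "nat \<Rightarrow> ennreal"
  assumes "(\<Sum>i. f i) < \<infinity>"
  shows "(\<lambda>k. \<Sum>i. f (i + k)) \<longlonglongrightarrow> 0"
proof -
  have fin: "(\<Sum>i<k. f i) \<noteq> top" for k
  proof -
    have "(\<Sum>i<k. f i) \<le> (\<Sum>i. f i)" by (intro sum_le_suminf) auto
    then have "(\<Sum>i<k. f i) < \<infinity>" using assms by (rule le_less_trans)
    then show ?thesis by (simp only: infinity_ennreal_def less_top)
  qed
  have "(\<lambda>k. (\<Sum>i. f i) - (\<Sum>i<k. f i)) \<longlonglongrightarrow> (\<Sum>i. f i) - (\<Sum>i. f i)"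
    using assms fin by (intro tendsto_diff_ennreal tendsto_const summable_LIMSEQ) auto
  moreover have "(\<Sum>i. f i) - (\<Sum>i<k. f i) = (\<Sum>i. f (i + k))" for k
    using fin by (subst suminf_offset[of f k]) auto
  moreover have "(\<Sum>i. f i) - (\<Sum>i. f i) = 0" using assms by (simp add: less_top)
  ultimately show ?thesis by simp
qed

text \<open>The layers of points at distance about \<open>1/k\<close> from \<open>F\<close> are separated from each other
  except for neighbours, so both the even and the odd ones have summable measure.\<close>

lemma closed_in_lambda_system_hausdorff:
  fixes F :: "'a::metric_space set"
  assumes "closed F" "0 \<le> s"
  shows "F \<in> lambda_system UNIV UNIV (hausdorff_outer s)"
proof -
  let ?\<mu> = "hausdorff_outer s :: 'a set \<Rightarrow> ennreal"
  have main: "?\<mu> (A \<inter> F) + ?\<mu> (A - F) \<le> ?\<mu> A" if fin: "?\<mu> A < \<infinity>" and "F \<noteq> {}" for A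
  proof -
    define d where "d x = infdist x F" for x
    have d_dist: "d x - d y \<le> dist x y" for x y
      using infdist_triangle[of x F y] unfolding d_def by simp
    define B where "B k = {x\<in>A. 1 / real (k + 1) \<le> d x}" for k
    define R where "R k = {x\<in>A. 1 / real (k + 2) \<le> d x \<and> d x < 1 / real (k + 1)}" for k
    have layers: "(\<Sum>i<n. ?\<mu> (R (2 * i + c))) \<le> ?\<mu> (\<Union>i<n. R (2 * i + c))" for n c
    proof (induction n)
      case (Suc n)
      have "(\<Sum>i<Suc n. ?\<mu> (R (2 * i + c))) \<le> ?\<mu> (\<Union>i<n. R (2 * i + c)) + ?\<mu> (R (2 * n + c))"
        using Suc by (simp add: add_right_mono)
      also have "\<dots> \<le> ?\<mu> ((\<Union>i<n. R (2 * i + c)) \<union> R (2 * n + c))"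
      proof (cases "n = 0")
        case True then show ?thesis by (simp add: hausdorff_outer_empty)
      next
        case False
        show ?thesis
        proof (rule hausdorff_outer_add_separated)
          \<comment> \<open>Points of the earlier layers have distance at least
            \<open>1 / real (2 * n + c)\<close> from \<open>F\<close>, those of the new layer less
            than \<open>1 / real (2 * n + c + 1)\<close>. The case \<open>n = 0\<close> is apart
            because \<open>c = 0\<close>, the even layers, would then divide by zero.\<close>
          show "1 / real (2 * n + c) - 1 / real (2 * n + c + 1) > 0"
            using False by (simp add: divide_strict_left_mono)
          fix a b assume "a \<in> (\<Union>i<n. R (2 * i + c))" "b \<in> R (2 * n + c)"
          then obtain i where i: "i < n" "1 / real (2 * i + c + 2) \<le> d a"
            and b: "d b < 1 / real (2 * n + c + 1)" by (auto simp: R_def)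
          have "1 / real (2 * n + c) \<le> 1 / real (2 * i + c + 2)"
            using i by (intro divide_left_mono) auto
          with i b d_dist[of a b] show "1 / real (2 * n + c) - 1 / real (2 * n + c + 1) \<le> dist a b"
            by linarith
        qed fact
      qed
      also have "\<dots> = ?\<mu> (\<Union>i<Suc n. R (2 * i + c))"
        by (intro arg_cong[where f="?\<mu>"]) (auto simp: lessThan_Suc)
      finally show ?case .
    qed (simp add: hausdorff_outer_empty)
    have "(\<Sum>i. ?\<mu> (R i)) \<le> 2 * ?\<mu> A"
    proof (rule suminf_le_const)
      fix n
      have "(\<Sum>i<n. ?\<mu> (R i)) \<le> (\<Sum>i<2 * n. ?\<mu> (R i))"
        by (intro sum_mono2) auto
      also have "\<dots> = (\<Sum>i<n. ?\<mu> (R (2 * i + 0))) + (\<Sum>i<n. ?\<mu> (R (2 * i + 1)))"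
        by (induction n) (auto simp: algebra_simps)
      also have "\<dots> \<le> ?\<mu> A + ?\<mu> A"
        by (intro add_mono order_trans[OF layers] hausdorff_outer_mono) (auto simp: R_def)
      finally show "(\<Sum>i<n. ?\<mu> (R i)) \<le> 2 * ?\<mu> A" by (simp add: mult_2)
    qed auto
    also have "\<dots> < \<infinity>" using fin by (simp add: ennreal_mult_less_top)
    finally have tail: "(\<lambda>k. \<Sum>i. ?\<mu> (R (i + k))) \<longlonglongrightarrow> 0"
      by (rule ennreal_suminf_tail_tendsto_0)
    \<comment> \<open>\<open>A - F\<close> is covered by \<open>B k\<close>, which has positive
      distance from \<open>F\<close>, and the layers from \<open>k\<close> on, whose measures form
      the tail of a convergent series.\<close>
    have "?\<mu> (A \<inter> F) + ?\<mu> (A - F) \<le> ?\<mu> A + (\<Sum>i. ?\<mu> (R (i + k)))" for k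
    proof -
      have "A - F \<subseteq> B k \<union> (\<Union>i. R (i + k))"
      proof
        fix x assume x: "x \<in> A - F"
        then have "d x > 0"
          using assms \<open>F \<noteq> {}\<close> unfolding d_def by (simp add: infdist_pos_not_in_closed)
        then obtain m where m: "inverse (real (Suc m)) < d x" using reals_Archimedean by blast
        define j where "j = (LEAST j. 1 / real (j + 1) \<le> d x)"
        have "1 / real (m + 1) \<le> d x" using m by (simp add: inverse_eq_divide)
        then have j: "1 / real (j + 1) \<le> d x" unfolding j_def by (rule LeastI)
        show "x \<in> B k \<union> (\<Union>i. R (i + k))"
        proof (cases "j \<le> k")
          case True
          then have "1 / real (k + 1) \<le> 1 / real (j + 1)" by (intro divide_left_mono) auto
          with j x show ?thesis by (auto simp: B_def)
        next
          case False
          then have "\<not> 1 / real ((j - 1) + 1) \<le> d x"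
            unfolding j_def by (intro not_less_Least) auto
          \<comment> \<open>Minimality of \<open>j\<close> places \<open>x\<close> in layer
            \<open>j - 1\<close>, and \<open>k < j\<close> makes both natural subtractions
            exact.\<close>
          with j False x have "x \<in> R ((j - 1 - k) + k)" by (auto simp: R_def)
          then show ?thesis by blast
        qed
      qed
      then have "?\<mu> (A - F) \<le> ?\<mu> (B k) + ?\<mu> (\<Union>i. R (i + k))"
        by (rule order_trans[OF hausdorff_outer_mono hausdorff_outer_Un_le])
      also have "\<dots> \<le> ?\<mu> (B k) + (\<Sum>i. ?\<mu> (R (i + k)))"
        by (intro add_left_mono hausdorff_outer_countably_subadditive)
      finally have "?\<mu> (A \<inter> F) + ?\<mu> (A - F) \<le> (?\<mu> (A \<inter> F) + ?\<mu> (B k)) + (\<Sum>i. ?\<mu> (R (i + k)))"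
        by (simp add: add.assoc add_left_mono)
      also have "?\<mu> (A \<inter> F) + ?\<mu> (B k) \<le> ?\<mu> ((A \<inter> F) \<union> B k)"
      proof (rule hausdorff_outer_add_separated[where \<eta>="1 / real (k + 1)"])
        fix a b assume "a \<in> A \<inter> F" "b \<in> B k"
        then show "1 / real (k + 1) \<le> dist a b"
          using infdist_le[of a F b] by (auto simp: B_def d_def dist_commute)
      qed (use \<open>0 \<le> s\<close> in auto)
      also have "\<dots> \<le> ?\<mu> A" by (intro hausdorff_outer_mono) (auto simp: B_def)
      finally show ?thesis by (simp add: add_right_mono)
    qed
    moreover have "(\<lambda>k. ?\<mu> A + (\<Sum>i. ?\<mu> (R (i + k)))) \<longlonglongrightarrow> ?\<mu> A + 0"
      by (intro tendsto_add tendsto_const tail)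
    ultimately show ?thesis
      by (intro LIMSEQ_le_const[of _ "?\<mu> A"]) auto
  qed
  \<comment> \<open>The empty \<open>F\<close> is apart because \<open>infdist\<close> to it is 0 by
    convention.\<close>
  have le: "?\<mu> (A \<inter> F) + ?\<mu> (A - F) \<le> ?\<mu> A" for A
    using main[of A] by (cases "?\<mu> A < \<infinity>"; cases "F = {}")
      (auto simp: hausdorff_outer_empty not_less top_unique)
  have ge: "?\<mu> A \<le> ?\<mu> (A \<inter> F) + ?\<mu> (A - F)" for A
    using hausdorff_outer_Un_le[of s "A \<inter> F" "A - F"] by (simp add: Int_Diff_Un)
  interpret algebra "UNIV :: 'a set" UNIV by (rule algebra_Pow[of UNIV, simplified])
  show ?thesis
    unfolding lambda_system_eq using le ge by (auto intro: antisym)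
qed

section \<open>Borel sets are Hausdorff measurable\<close>

lemma sigma_algebra_UNIV: "sigma_algebra UNIV UNIV"
  using sigma_algebra_Pow[of UNIV] by simp

lemma measure_space_hausdorff:
  "measure_space UNIV (lambda_system UNIV UNIV (hausdorff_outer s)) (hausdorff_outer s)"
  by (rule sigma_algebra.caratheodory_lemma[OF sigma_algebra_UNIV outer_measure_space_hausdorff])

lemma sets_hausdorff_measure:
  "sets (hausdorff_measure s) = lambda_system UNIV UNIV (hausdorff_outer s)"
  unfolding hausdorff_measure_def
  by (intro sigma_algebra.sets_measure_of_eq conjunct1[OF measure_space_hausdorff[unfolded measure_space_def]])

lemma space_hausdorff_measure [simp]: "space (hausdorff_measure s) = UNIV"
  unfolding hausdorff_measure_def by (simp add: space_measure_of_conv)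

lemma emeasure_hausdorff_measure:
  assumes "A \<in> sets (hausdorff_measure s)"
  shows "emeasure (hausdorff_measure s) A = hausdorff_outer s A"
  using measure_space_hausdorff[of s] assms unfolding hausdorff_measure_def[of s]
  by (intro emeasure_measure_of_sigma)
    (auto simp: measure_space_def sets_hausdorff_measure[unfolded hausdorff_measure_def])

lemma borel_subset_sets_hausdorff_measure:
  fixes A :: "'a::metric_space set"
  assumes "0 \<le> s" "A \<in> sets borel"
  shows "A \<in> sets (hausdorff_measure s)"
proof -
  have sa: "sigma_algebra UNIV (sets (hausdorff_measure s :: 'a measure))"
    by (metis sets.sigma_algebra_axioms space_hausdorff_measure)
  have "sigma_sets UNIV (Collect closed) \<subseteq> sets (hausdorff_measure s :: 'a measure)"
  proof (rule sigma_algebra.sigma_sets_subset[OF sa], rule subsetI)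
    fix F :: "'a set" assume "F \<in> Collect closed"
    then have "closed F" by simp
    from closed_in_lambda_system_hausdorff[OF this assms(1)]
    show "F \<in> sets (hausdorff_measure s)" unfolding sets_hausdorff_measure .
  qed
  then have "sets (borel :: 'a measure) \<subseteq> sets (hausdorff_measure s)"
    unfolding borel_eq_closed by (simp add: sets_measure_of_conv)
  with assms show ?thesis by blast
qed

text \<open>A maximal set of points of \<open>K\<close> with mutual distances above
  \<open>2 * \<rho>\<close> serves twice: the balls of radius \<rho> around it are disjoint, so
  their \<nu>-mass bounds their number, and the balls of radius \<open>2 * \<rho>\<close> cover
  \<open>K\<close>. Doubling the radius costs the factor \<open>2 powr s\<close>. Outer regularity
  of \<nu> finally replaces a neighbourhood \<open>U\<close> by \<open>K\<close>.\<close>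

lemma hausdorff_outer_le_of_density:
  fixes K :: "'a::euclidean_space set"
  assumes "sets \<nu> = sets borel" "emeasure \<nu> UNIV < \<infinity>" "compact K" "0 < c" "0 < \<rho>0" "0 \<le> s"
    and density: "\<And>z \<rho>. z \<in> K \<Longrightarrow> 0 < \<rho> \<Longrightarrow> \<rho> < \<rho>0 \<Longrightarrow> ennreal (c * \<rho> powr s) \<le> emeasure \<nu> (cball z \<rho>)"
  shows "hausdorff_outer s K \<le> ennreal (unit_ball_vol s * 2 powr s / c) * emeasure \<nu> K"
proof -
  have sp: "space \<nu> = UNIV" using sets_eq_imp_space_eq[OF assms(1)] by simp
  have om: "unit_ball_vol s > 0" using assms by simp
  let ?C = "unit_ball_vol s * 2 powr s / c"
  have "0 < ?C" using om assms by simp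
  have open_bound: "hausdorff_outer s K \<le> ennreal ?C * emeasure \<nu> U" if U: "open U" "K \<subseteq> U" for U
    unfolding hausdorff_outer_def
  proof (rule SUP_least)
    fix \<delta> :: real assume "\<delta> \<in> {0<..}"
    then have "0 < \<delta>" by simp
    obtain e where e: "0 < e" "(\<Union>z\<in>K. ball z e) \<subseteq> U"
      by (rule compact_subset_open_imp_ball_epsilon_subset[OF \<open>compact K\<close> U])
    \<comment> \<open>Small enough for the density bound, for balls of radius \<rho> around points
      of \<open>K\<close> to stay in \<open>U\<close>, and for the covering balls, of diameter
      \<open>4 * \<rho>\<close>, to be admissible for \<delta>.\<close>
    define \<rho> where "\<rho> = min (\<rho>0 / 2) (min (e / 2) (\<delta> / 4))"
    have \<rho>: "0 < \<rho>" "\<rho> < \<rho>0" "\<rho> < e" "4 * \<rho> \<le> \<delta>"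
      using \<open>0 < e\<close> \<open>0 < \<delta>\<close> \<open>0 < \<rho>0\<close> by (auto simp: \<rho>_def min_def)
    define sep where "sep P \<longleftrightarrow> finite P \<and> P \<subseteq> K \<and> (\<forall>x\<in>P. \<forall>y\<in>P. x \<noteq> y \<longrightarrow> 2 * \<rho> < dist x y)" for P
    have card_le: "ennreal (real (card P) * (c * \<rho> powr s)) \<le> emeasure \<nu> U" if "sep P" for P
    proof -
      have P: "finite P" "P \<subseteq> K" using that by (auto simp: sep_def)
      have "ennreal (real (card P) * (c * \<rho> powr s)) = (\<Sum>z\<in>P. ennreal (c * \<rho> powr s))"
        using \<open>0 < c\<close> by (simp add: ennreal_mult ennreal_of_nat_eq_real_of_nat)
      also have "\<dots> \<le> (\<Sum>z\<in>P. emeasure \<nu> (cball z \<rho>))"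
        using P \<rho> by (intro sum_mono density) auto
      also have "\<dots> = emeasure \<nu> (\<Union>z\<in>P. cball z \<rho>)"
      proof (rule sum_emeasure)
        show "disjoint_family_on (\<lambda>z. cball z \<rho>) P"
        proof (clarsimp simp: disjoint_family_on_def)
          fix x y assume "x \<in> P" "y \<in> P" "x \<noteq> y"
          then have "2 * \<rho> < dist x y" using that by (auto simp: sep_def)
          then show "cball x \<rho> \<inter> cball y \<rho> = {}"
            by (simp add: disjoint_cballI)
        qed
      qed (use P assms(1) in auto)
      also have "\<dots> \<le> emeasure \<nu> U"
      proof (rule emeasure_mono)
        show "(\<Union>z\<in>P. cball z \<rho>) \<subseteq> U"
          using P(2) \<rho> by (intro order_trans[OF _ e(2)] UN_mono) auto
      qed (use U assms(1) in auto)
      finally show ?thesis .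
    qed
    obtain b where b: "emeasure \<nu> UNIV = ennreal b" "0 \<le> b"
      using assms(2) by (cases "emeasure \<nu> UNIV") auto
    \<comment> \<open>The finite total mass bounds the size of all separated sets at once, so one of
      maximal cardinality exists.\<close>
    have "card P < Suc (nat \<lceil>b / (c * \<rho> powr s)\<rceil>)" if "sep P" for P
    proof -
      have "ennreal (real (card P) * (c * \<rho> powr s)) \<le> ennreal b"
        unfolding b(1)[symmetric]
        by (rule order_trans[OF card_le[OF that] emeasure_mono]) (simp_all add: assms(1))
      then have "real (card P) * (c * \<rho> powr s) \<le> b"
        unfolding ennreal_le_iff[OF b(2)] .
      then have "real (card P) \<le> b / (c * \<rho> powr s)"
        using \<open>0 < c\<close> \<rho> by (simp add: pos_le_divide_eq)
      then show ?thesis by linarith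
    qed
    moreover have "sep {}" by (simp add: sep_def)
    ultimately obtain P where P: "sep P" "\<And>Q. sep Q \<Longrightarrow> card Q \<le> card P"
      using ex_has_greatest_nat[of sep "{}" card] by blast
    have fP: "finite P" using P by (simp add: sep_def)
    have cover: "K \<subseteq> (\<Union>z\<in>P. cball z (2 * \<rho>))"
    proof
      fix x assume "x \<in> K"
      show "x \<in> (\<Union>z\<in>P. cball z (2 * \<rho>))"
      proof (rule ccontr)
        assume *: "x \<notin> (\<Union>z\<in>P. cball z (2 * \<rho>))"
        then have "sep (insert x P)"
          using P(1) \<open>x \<in> K\<close> by (auto simp: sep_def dist_commute not_le)
        moreover have "x \<notin> P" using * \<rho> by auto
        ultimately show False using P(2)[of "insert x P"] fP by simp
      qed
    qed
    obtain h where h: "bij_betw h {0..<card P} P" using ex_bij_betw_nat_finite[OF fP] by blast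
    define C where "C k = (if k < card P then cball (h k) (2 * \<rho>) else {})" for k
    have "hausdorff_content s \<delta> K \<le> (\<Sum>k. ennreal (unit_ball_vol s * (diameter (C k) / 2) powr s))"
    proof (rule hausdorff_content_le)
      show "K \<subseteq> (\<Union>k. C k)"
      proof
        fix x assume "x \<in> K"
        then obtain z where z: "z \<in> P" "x \<in> cball z (2 * \<rho>)" using cover by auto
        then obtain k where "k < card P" "z = h k" using h by (fastforce simp: bij_betw_def)
        with z show "x \<in> (\<Union>k. C k)" by (auto simp: C_def)
      qed
    qed (use \<rho> \<open>0 < \<delta>\<close> in \<open>auto simp: C_def\<close>)
    also have "\<dots> = (\<Sum>k\<in>{..<card P}. ennreal (unit_ball_vol s * (diameter (C k) / 2) powr s))"
      by (intro suminf_finite) (auto simp: C_def)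
    also have "\<dots> = (\<Sum>k\<in>{..<card P}. ennreal (unit_ball_vol s * (2 * \<rho>) powr s))"
      using \<rho> by (intro sum.cong) (auto simp: C_def)
    also have "\<dots> = ennreal (real (card P) * (unit_ball_vol s * (2 * \<rho>) powr s))"
      using om by (simp add: ennreal_mult ennreal_of_nat_eq_real_of_nat)
    also have "real (card P) * (unit_ball_vol s * (2 * \<rho>) powr s) = ?C * (real (card P) * (c * \<rho> powr s))"
      using \<open>0 < c\<close> \<rho> by (simp add: powr_mult)
    also have "ennreal \<dots> = ennreal ?C * ennreal (real (card P) * (c * \<rho> powr s))"
      using \<open>0 < ?C\<close> \<open>0 < c\<close> by (intro ennreal_mult) auto
    also have "\<dots> \<le> ennreal ?C * emeasure \<nu> U"
      by (intro mult_left_mono card_le P) auto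
    finally show "hausdorff_content s \<delta> K \<le> ennreal ?C * emeasure \<nu> U" .
  qed
  show ?thesis
  proof (rule ennreal_le_epsilon)
    fix e :: real assume "0 < e"
    have "emeasure \<nu> K = (INF U \<in> {U. K \<subseteq> U \<and> open U}. emeasure \<nu> U)"
      using assms sp by (intro outer_regular) (auto simp: compact_imp_closed)
    moreover have "emeasure \<nu> K \<noteq> \<infinity>"
      using assms(2) emeasure_mono[of K UNIV \<nu>] assms(1) by (auto simp: top_unique)
    then have "emeasure \<nu> K < emeasure \<nu> K + ennreal (e / ?C)"
      using om \<open>0 < c\<close> \<open>0 < e\<close> by (cases "emeasure \<nu> K") (auto simp: ennreal_plus[symmetric] ennreal_less_iff simp del: ennreal_plus)
    ultimately obtain U where U: "K \<subseteq> U" "open U" "emeasure \<nu> U < emeasure \<nu> K + ennreal (e / ?C)"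
      by (auto simp: INF_less_iff)
    have "hausdorff_outer s K \<le> ennreal ?C * emeasure \<nu> U" using open_bound U by blast
    also have "\<dots> \<le> ennreal ?C * (emeasure \<nu> K + ennreal (e / ?C))"
      using U by (intro mult_left_mono) auto
    also have "\<dots> = ennreal ?C * emeasure \<nu> K + ennreal (?C * (e / ?C))"
      using om \<open>0 < c\<close> \<open>0 < e\<close>
      by (subst ennreal_mult[of ?C "e / ?C"]) (auto simp: distrib_left simp del: times_divide_eq_left times_divide_eq_right)
    also have "?C * (e / ?C) = e" using \<open>0 < ?C\<close> by (metis less_irrefl nonzero_mult_div_cancel_left times_divide_eq_right)
    finally show "hausdorff_outer s K \<le> ennreal ?C * emeasure \<nu> K + ennreal e" .
  qed
qed

text \<open>A covering set lies in the closed ball around any of its points whose radius is its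
  diameter, so every covering sum dominates a multiple of the \<nu>-mass of \<open>A\<close>. The
  factor \<open>2 powr s\<close> appears because the content is built from half the
  diameter.\<close>

lemma mass_distribution_principle:
  fixes A :: "'a::metric_space set"
  assumes "sets \<nu> = sets borel" "A \<in> sets borel" "0 < s" "0 < C"
    and density: "\<And>z \<rho>. 0 < \<rho> \<Longrightarrow> \<rho> \<le> 1 \<Longrightarrow> emeasure \<nu> (cball z \<rho>) \<le> ennreal (C * \<rho> powr s)"
  shows "ennreal (unit_ball_vol s / (C * 2 powr s)) * emeasure \<nu> A \<le> hausdorff_outer s A"
proof -
  have om: "unit_ball_vol s > 0" using assms by simp
  let ?k = "C * 2 powr s / unit_ball_vol s"
  have k: "0 < ?k" "unit_ball_vol s / (C * 2 powr s) = 1 / ?k" using om \<open>0 < C\<close> by auto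
  \<comment> \<open>Covering sets may have diameter 0, so the bound is extended to radius 0 by a
    limit; there it says that points carry no mass.\<close>
  have density0: "emeasure \<nu> (cball z \<rho>) \<le> ennreal (C * \<rho> powr s)" if "0 \<le> \<rho>" "\<rho> \<le> 1" for z \<rho>
  proof (cases "\<rho> = 0")
    case True
    have "((\<lambda>r. ennreal (C * r powr s)) \<longlongrightarrow> ennreal (C * 0 powr s)) (at_right 0)"
      using \<open>0 < s\<close> by (intro tendsto_ennrealI tendsto_mult tendsto_const tendsto_powr' tendsto_ident_at)
        (auto simp: eventually_at_filter)
    moreover have "\<forall>\<^sub>F r in at_right 0. emeasure \<nu> (cball z 0) \<le> ennreal (C * r powr s)"
    proof (rule eventually_at_right_less[THEN eventually_mono, THEN eventually_mp])
      show "\<forall>\<^sub>F r in at_right 0. 0 < r \<longrightarrow> emeasure \<nu> (cball z 0) \<le> ennreal (C * r powr s)"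
        unfolding eventually_at_right[OF zero_less_one]
      proof (intro exI[of _ 1] conjI allI impI)
        fix y :: real assume "0 < y" "y < 1"
        have "emeasure \<nu> (cball z 0) \<le> emeasure \<nu> (cball z y)"
          using \<open>0 < y\<close> by (intro emeasure_mono) (auto simp: assms(1))
        also have "\<dots> \<le> ennreal (C * y powr s)"
          using \<open>0 < y\<close> \<open>y < 1\<close> by (intro density) auto
        finally show "emeasure \<nu> (cball z 0) \<le> ennreal (C * y powr s)" .
      qed simp
    qed auto
    ultimately have "emeasure \<nu> (cball z 0) \<le> ennreal (C * 0 powr s)"
      by (intro tendsto_lowerbound) auto
    then show ?thesis by (simp add: True)
  qed (use density that in auto)
  have "ennreal (1 / ?k) * emeasure \<nu> A \<le> hausdorff_content s 1 A"
    unfolding hausdorff_content_def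
  proof (rule INF_greatest, clarify)
    fix B :: "nat \<Rightarrow> 'a set"
    assume B: "A \<subseteq> (\<Union>k. B k)" "\<forall>k. bounded (B k) \<and> diameter (B k) \<le> 1"
    define z where "z i = (SOME x. x \<in> B i)" for i
    have "x \<in> B i \<Longrightarrow> z i \<in> B i" for x i
      unfolding z_def by (rule someI)
    then have "B i \<subseteq> cball (z i) (diameter (B i))" for i
      using B(2) by (auto intro!: diameter_bounded_bound)
    with B(1) have "A \<subseteq> (\<Union>i. cball (z i) (diameter (B i)))" by blast
    then have "emeasure \<nu> A \<le> emeasure \<nu> (\<Union>i. cball (z i) (diameter (B i)))"
      by (intro emeasure_mono) (auto simp: assms(1))
    also have "\<dots> \<le> (\<Sum>i. emeasure \<nu> (cball (z i) (diameter (B i))))"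
      by (intro emeasure_subadditive_countably) (auto simp: assms(1))
    also have "\<dots> \<le> (\<Sum>i. ennreal (C * diameter (B i) powr s))"
      using B by (intro suminf_le density0) (auto intro: diameter_ge_0)
    also have "\<dots> = (\<Sum>i. ennreal ?k * ennreal (unit_ball_vol s * (diameter (B i) / 2) powr s))"
      using om B \<open>0 < C\<close> diameter_ge_0
      by (intro suminf_cong) (auto simp: ennreal_mult[symmetric] powr_divide)
    finally have "emeasure \<nu> A \<le> ennreal ?k * (\<Sum>i. ennreal (unit_ball_vol s * (diameter (B i) / 2) powr s))"
      by simp
    then have "ennreal (1 / ?k) * emeasure \<nu> A \<le>
      ennreal (1 / ?k) * (ennreal ?k * (\<Sum>i. ennreal (unit_ball_vol s * (diameter (B i) / 2) powr s)))"
      by (rule mult_left_mono) auto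
    also have "\<dots> = (\<Sum>i. ennreal (unit_ball_vol s * (diameter (B i) / 2) powr s))"
      unfolding mult.assoc[symmetric] using om \<open>0 < C\<close> by (subst ennreal_mult[symmetric]) auto
    finally show "ennreal (1 / ?k) * emeasure \<nu> A \<le> (\<Sum>i. ennreal (unit_ball_vol s * (diameter (B i) / 2) powr s))" .
  qed
  also have "\<dots> \<le> hausdorff_outer s A"
    by (intro hausdorff_content_le_outer) auto
  finally show ?thesis unfolding k(2) .
qed


subsection \<open>Continuously differentiable functions and Poincare estimates\<close>

text \<open>Carries the gradient as an explicit function, so that powers, products and multiples
  come with formulas. By \<open>Ck_imp_C1_gradient\<close> and \<open>C1_gradient_imp_Ck\<close> the
  functions concerned are those with \<open>Ck 1\<close>.\<close>

definition C1_gradient :: "('a::euclidean_space \<Rightarrow> real) \<Rightarrow> ('a \<Rightarrow> 'a) \<Rightarrow> bool" where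
  "C1_gradient w G \<longleftrightarrow> (\<forall>x. (w has_derivative (\<lambda>h. G x \<bullet> h)) (at x)) \<and> continuous_on UNIV G"

lemma C1_gradientD:
  assumes "C1_gradient w G"
  shows "(w has_derivative (\<lambda>h. G x \<bullet> h)) (at x)" "continuous_on UNIV G" "continuous_on UNIV w"
    "w \<in> borel_measurable borel" "G \<in> borel_measurable borel"
proof -
  show *: "(w has_derivative (\<lambda>h. G x \<bullet> h)) (at x)" "continuous_on UNIV G" for x
    using assms by (auto simp: C1_gradient_def)
  show "continuous_on UNIV w"
    by (intro continuous_at_imp_continuous_on ballI has_derivative_continuous[OF *(1)])
  then show "w \<in> borel_measurable borel" by (rule borel_measurable_continuous_onI)
  show "G \<in> borel_measurable borel" using *(2) by (rule borel_measurable_continuous_onI)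
qed

lemma C1_gradient_eq_0:
  assumes "C1_gradient w G" "open U" "x \<in> U" and zero: "\<And>y. y \<in> U \<Longrightarrow> w y = 0"
  shows "G x = 0"
proof -
  have "\<forall>\<^sub>F y in nhds x. 0 = w y"
    by (rule eventually_mono[OF eventually_nhds_in_open[OF assms(2,3)]]) (simp add: zero)
  then have "\<forall>\<^sub>F y in at x. 0 = w y" by (simp add: eventually_nhds_conv_at)
  then have "(w has_derivative (\<lambda>h. 0)) (at x)"
    by (rule has_derivative_transform_eventually[OF has_derivative_const]) (simp_all add: zero[OF assms(3)])
  from has_derivative_unique[OF this C1_gradientD(1)[OF assms(1)]] have "G x \<bullet> G x = 0" by metis
  then show ?thesis by simp
qed

lemma C1_gradient_diff_const: "C1_gradient w G \<Longrightarrow> C1_gradient (\<lambda>x. w x - a) G"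
  unfolding C1_gradient_def using has_derivative_diff[OF _ has_derivative_const] by fastforce

lemma C1_gradient_cmult:
  assumes "C1_gradient w G" shows "C1_gradient (\<lambda>x. c * w x) (\<lambda>x. c *\<^sub>R G x)"
  unfolding C1_gradient_def
proof (intro conjI allI)
  fix x
  show "((\<lambda>x. c * w x) has_derivative (\<lambda>h. c *\<^sub>R G x \<bullet> h)) (at x)"
    using has_derivative_mult_right[OF C1_gradientD(1)[OF assms], of c x] by simp
qed (intro continuous_intros C1_gradientD(2)[OF assms])

lemma C1_gradient_partial:
  assumes "C1_gradient w G" shows "partial i w = (\<lambda>x. G x \<bullet> i)"
  unfolding partial_def fun_eq_iff frechet_derivative_at[OF C1_gradientD(1)[OF assms], symmetric] by simp

lemma C1_gradient_grad: "C1_gradient w G \<Longrightarrow> grad w x = G x"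
  unfolding grad_def by (simp add: C1_gradient_partial euclidean_representation)

lemma C1_gradient_imp_Ck: "C1_gradient w G \<Longrightarrow> Ck 1 w"
  unfolding One_nat_def Ck.simps
  by (auto simp: C1_gradient_partial differentiable_def intro!: continuous_on_inner continuous_on_const
      intro: C1_gradientD)

lemma Ck_imp_C1_gradient:
  assumes "Ck 1 w" shows "C1_gradient w (grad w)"
  unfolding C1_gradient_def
proof (intro conjI allI)
  fix x
  have d: "(w has_derivative frechet_derivative w (at x)) (at x)"
    using assms by (simp add: frechet_derivative_works)
  then interpret linear "frechet_derivative w (at x)" by (rule has_derivative_linear)
  have "grad w x \<bullet> h = frechet_derivative w (at x) h" for h
  proof -
    have "frechet_derivative w (at x) h = frechet_derivative w (at x) (\<Sum>i\<in>Basis. (h \<bullet> i) *\<^sub>R i)"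
      by (simp add: euclidean_representation)
    also have "\<dots> = (\<Sum>i\<in>Basis. (h \<bullet> i) * partial i w x)"
      by (simp add: sum scaleR partial_def)
    also have "\<dots> = grad w x \<bullet> h"
      unfolding grad_def by (simp add: inner_commute[of _ h] inner_sum_right mult.commute)
    finally show ?thesis by simp
  qed
  with d show "(w has_derivative (\<lambda>h. grad w x \<bullet> h)) (at x)" by simp
next
  show "continuous_on UNIV (grad w)"
    unfolding grad_def[abs_def] using assms by (intro continuous_intros) auto
qed

section \<open>Powers of the modulus\<close>

lemma has_field_derivative_abs_powr:
  fixes t p :: real
  assumes "1 < p"
  shows "((\<lambda>t. \<bar>t\<bar> powr p) has_field_derivative p * \<bar>t\<bar> powr (p - 1) * sgn t) (at t)"
proof -
  consider "t > 0" | "t < 0" | "t = 0" by linarith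
  then show ?thesis
  proof cases
    case 1
    have d: "((\<lambda>t. t powr p) has_field_derivative p * \<bar>t\<bar> powr (p - 1) * sgn t) (at t)"
      using 1 has_real_derivative_powr[of t p] by simp
    have ev: "\<forall>\<^sub>F s in nhds t. s powr p = \<bar>s\<bar> powr p"
      using eventually_nhds_in_open[of "{0<..}" t] 1 by (auto elim!: eventually_mono)
    show ?thesis using DERIV_cong_ev[OF refl ev refl] d by (rule iffD1)
  next
    case 2
    have d: "((\<lambda>t. (- t) powr p) has_field_derivative p * \<bar>t\<bar> powr (p - 1) * sgn t) (at t)"
      using 2 DERIV_fun_powr[of uminus "-1" t p] DERIV_minus[OF DERIV_ident, of t UNIV] by simp
    have ev: "\<forall>\<^sub>F s in nhds t. (- s) powr p = \<bar>s\<bar> powr p"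
      using eventually_nhds_in_open[of "{..<0}" t] 2 by (auto elim!: eventually_mono)
    show ?thesis using DERIV_cong_ev[OF refl ev refl] d by (rule iffD1)
  next
    \<comment> \<open>At 0 the difference quotient \<open>\<bar>h\<bar> powr p / h\<close> has
      modulus \<open>\<bar>h\<bar> powr (p - 1)\<close>, which tends to 0 because p exceeds
      1.\<close>
    case 3
    have "((\<lambda>h. \<bar>h\<bar> powr (p - 1)) \<longlongrightarrow> \<bar>0\<bar> powr (p - 1)) (at (0::real))"
      using assms by (intro tendsto_powr' tendsto_rabs tendsto_ident_at tendsto_const) auto
    moreover have "\<forall>\<^sub>F h in at (0::real). \<bar>h\<bar> powr (p - 1) = \<bar>\<bar>h\<bar> powr p / h\<bar>"
      by (auto simp: eventually_at_filter powr_diff)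
    ultimately have "((\<lambda>h. \<bar>\<bar>h\<bar> powr p / h\<bar>) \<longlongrightarrow> \<bar>0\<bar> powr (p - 1)) (at (0::real))"
      by (rule Lim_transform_eventually)
    then have "((\<lambda>h. \<bar>h\<bar> powr p / h) \<longlongrightarrow> 0) (at (0::real))"
      by (rule tendsto_rabs_zero_cancel[OF tendsto_eq_rhs]) simp
    then show ?thesis using 3 assms by (simp add: DERIV_def)
  qed
qed

lemma continuous_abs_powr_sgn:
  fixes p :: real
  assumes "1 < p"
  shows "continuous_on UNIV (\<lambda>t::real. \<bar>t\<bar> powr (p - 1) * sgn t)"
proof (intro continuous_at_imp_continuous_on ballI)
  fix t :: real
  show "isCont (\<lambda>t::real. \<bar>t\<bar> powr (p - 1) * sgn t) t"
  proof (cases "t = 0")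
    case True
    have "((\<lambda>h. \<bar>h\<bar> powr (p - 1)) \<longlongrightarrow> \<bar>0\<bar> powr (p - 1)) (at (0::real))"
      using assms by (intro tendsto_powr' tendsto_rabs tendsto_ident_at tendsto_const) auto
    moreover have "\<forall>\<^sub>F h in at (0::real). \<bar>h\<bar> powr (p - 1) = \<bar>\<bar>h\<bar> powr (p - 1) * sgn h\<bar>"
      by (auto simp: eventually_at_filter abs_mult abs_sgn_eq)
    ultimately have "((\<lambda>h. \<bar>\<bar>h\<bar> powr (p - 1) * sgn h\<bar>) \<longlongrightarrow> \<bar>0\<bar> powr (p - 1)) (at (0::real))"
      by (rule Lim_transform_eventually)
    then have "((\<lambda>h. \<bar>h\<bar> powr (p - 1) * sgn h) \<longlongrightarrow> 0) (at (0::real))"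
      by (rule tendsto_rabs_zero_cancel[OF tendsto_eq_rhs]) simp
    then show ?thesis using True by (simp add: isCont_def)
  next
    case False
    then show ?thesis by (intro continuous_intros isCont_sgn) auto
  qed
qed

text \<open>Turns an L^p question about \<open>u\<close> into an L^1 question about another
  continuously differentiable function, to which the L^1 Poincare and trace estimates apply.\<close>

lemma C1_gradient_abs_powr:
  assumes "C1_gradient u G" "1 < p"
  shows "C1_gradient (\<lambda>x. \<bar>u x\<bar> powr p) (\<lambda>x. (p * (\<bar>u x\<bar> powr (p - 1) * sgn (u x))) *\<^sub>R G x)"
  unfolding C1_gradient_def
proof (intro conjI allI)
  fix x
  show "((\<lambda>x. \<bar>u x\<bar> powr p) has_derivative (\<lambda>h. (p * (\<bar>u x\<bar> powr (p - 1) * sgn (u x))) *\<^sub>R G x \<bullet> h)) (at x)"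
    using has_derivative_compose[OF C1_gradientD(1)[OF assms(1)]
        has_field_derivative_abs_powr[OF assms(2), of "u x", THEN has_field_derivative_imp_has_derivative]]
    by (simp add: mult.assoc)
next
  have "continuous_on UNIV (\<lambda>x. \<bar>u x\<bar> powr (p - 1) * sgn (u x))"
    using continuous_on_compose2[OF continuous_abs_powr_sgn[OF assms(2)] C1_gradientD(3)[OF assms(1)]] by simp
  then show "continuous_on UNIV (\<lambda>x. (p * (\<bar>u x\<bar> powr (p - 1) * sgn (u x))) *\<^sub>R G x)"
    by (intro continuous_on_scaleR continuous_on_mult_left C1_gradientD(2)[OF assms(1)])
qed

section \<open>Line integrals and translations in L^1\<close>

lemma abs_diff_le_line_integral:
  assumes "C1_gradient w G" "norm e = 1" "0 \<le> T"
  shows "ennreal \<bar>w (x + T *\<^sub>R e) - w x\<bar> \<le> (\<integral>\<^sup>+t\<in>{0<..<T}. ennreal (norm (G (x + t *\<^sub>R e))) \<partial>lborel)"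
proof -
  have cG: "continuous_on A (\<lambda>t. G (x + t *\<^sub>R e))" for A
    by (intro continuous_on_compose2[OF C1_gradientD(2)[OF assms(1)]] continuous_intros) auto
  have "((\<lambda>t. G (x + t *\<^sub>R e) \<bullet> e) has_integral w (x + T *\<^sub>R e) - w (x + 0 *\<^sub>R e)) {0..T}"
  proof (rule fundamental_theorem_of_calculus[OF assms(3)])
    fix t assume "t \<in> {0..T}"
    have "((\<lambda>t. x + t *\<^sub>R e) has_derivative (\<lambda>h. h *\<^sub>R e)) (at t within {0..T})"
      by (auto intro!: derivative_eq_intros)
    from has_derivative_compose[OF this C1_gradientD(1)[OF assms(1)]]
    show "((\<lambda>t. w (x + t *\<^sub>R e)) has_vector_derivative G (x + t *\<^sub>R e) \<bullet> e) (at t within {0..T})"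
      by (simp add: has_vector_derivative_def)
  qed
  then have 1: "((\<lambda>t. G (x + t *\<^sub>R e) \<bullet> e) has_integral w (x + T *\<^sub>R e) - w x) {0..T}" by simp
  have "(\<lambda>t. norm (G (x + t *\<^sub>R e))) integrable_on {0..T}"
    by (intro integrable_continuous_interval continuous_on_norm cG)
  then obtain I where I: "((\<lambda>t. norm (G (x + t *\<^sub>R e))) has_integral I) {0..T}" by blast
  have "\<bar>G (x + t *\<^sub>R e) \<bullet> e\<bar> \<le> norm (G (x + t *\<^sub>R e))" for t
    using Cauchy_Schwarz_ineq2[of "G (x + t *\<^sub>R e)" e] assms(2) by simp
  then have "norm (w (x + T *\<^sub>R e) - w x) \<le> I"
    using integral_norm_bound_integral[of "\<lambda>t. G (x + t *\<^sub>R e) \<bullet> e" "{0..T}" "\<lambda>t. norm (G (x + t *\<^sub>R e))"]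
      1 I by (auto simp: integral_unique has_integral_integrable)
  then have "ennreal \<bar>w (x + T *\<^sub>R e) - w x\<bar> \<le> ennreal I" by (simp add: ennreal_leI)
  also have "\<dots> = (\<integral>\<^sup>+t\<in>{0<..<T}. ennreal (norm (G (x + t *\<^sub>R e))) \<partial>lborel)"
    using I by (intro nn_integral_has_integral_lebesgue'[symmetric]) (auto simp: has_integral_Icc_iff_Ioo)
  finally show ?thesis .
qed

lemma nn_integral_lborel_translate:
  fixes c :: "'a::euclidean_space"
  assumes "f \<in> borel_measurable borel"
  shows "(\<integral>\<^sup>+x. f (c + x) \<partial>lborel) = (\<integral>\<^sup>+x. f x \<partial>lborel)"
  using nn_integral_distr[of "(+) c" lborel borel f] assms by (simp add: lborel_distr_plus)

lemma nn_integral_le_line_integrals: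
  fixes G :: "'a::euclidean_space \<Rightarrow> 'a"
  assumes [measurable]: "G \<in> borel_measurable borel" "\<Omega> \<in> sets borel"
    and "0 \<le> T"
    and le: "\<And>x. f x \<le> (\<integral>\<^sup>+t. ennreal (norm (G (x + t *\<^sub>R e))) * indicator \<Omega> (x + t *\<^sub>R e) * indicator {0<..<T} t \<partial>lborel)"
  shows "(\<integral>\<^sup>+x. f x \<partial>lborel) \<le> ennreal T * (\<integral>\<^sup>+x\<in>\<Omega>. ennreal (norm (G x)) \<partial>lborel)"
proof -
  have "(\<integral>\<^sup>+x. f x \<partial>lborel) \<le> (\<integral>\<^sup>+x. \<integral>\<^sup>+t. ennreal (norm (G (x + t *\<^sub>R e))) * indicator \<Omega> (x + t *\<^sub>R e) * indicator {0<..<T} t \<partial>lborel \<partial>lborel)"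
    by (intro nn_integral_mono le)
  also have "\<dots> = (\<integral>\<^sup>+t. \<integral>\<^sup>+x. ennreal (norm (G (x + t *\<^sub>R e))) * indicator \<Omega> (x + t *\<^sub>R e) * indicator {0<..<T} t \<partial>lborel \<partial>lborel)"
    by (rule lborel_pair.Fubini') measurable
  also have "\<dots> = (\<integral>\<^sup>+t. (\<integral>\<^sup>+x. ennreal (norm (G x)) * indicator \<Omega> x \<partial>lborel) * indicator {0<..<T} t \<partial>lborel)"
  proof (rule nn_integral_cong)
    fix t
    have "(\<integral>\<^sup>+x. ennreal (norm (G (x + t *\<^sub>R e))) * indicator \<Omega> (x + t *\<^sub>R e) * indicator {0<..<T} t \<partial>lborel)
       = (\<integral>\<^sup>+x. ennreal (norm (G (t *\<^sub>R e + x))) * indicator \<Omega> (t *\<^sub>R e + x) \<partial>lborel) * indicator {0<..<T} t"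
      by (subst nn_integral_multc) (simp_all add: add.commute)
    also have "(\<integral>\<^sup>+x. ennreal (norm (G (t *\<^sub>R e + x))) * indicator \<Omega> (t *\<^sub>R e + x) \<partial>lborel) =
       (\<integral>\<^sup>+x. ennreal (norm (G x)) * indicator \<Omega> x \<partial>lborel)"
      by (rule nn_integral_lborel_translate[where f="\<lambda>x. ennreal (norm (G x)) * indicator \<Omega> x"]) measurable
    finally show "(\<integral>\<^sup>+x. ennreal (norm (G (x + t *\<^sub>R e))) * indicator \<Omega> (x + t *\<^sub>R e) * indicator {0<..<T} t \<partial>lborel)
       = (\<integral>\<^sup>+x. ennreal (norm (G x)) * indicator \<Omega> x \<partial>lborel) * indicator {0<..<T} t" .
  qed
  also have "\<dots> = ennreal T * (\<integral>\<^sup>+x\<in>\<Omega>. ennreal (norm (G x)) \<partial>lborel)"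
    using assms(3) by (subst nn_integral_cmult_indicator) (simp_all add: mult.commute)
  finally show ?thesis .
qed

lemma nn_integral_shift_diff_le:
  fixes w :: "'a::euclidean_space \<Rightarrow> real"
  assumes w: "C1_gradient w G" and \<Omega>: "\<Omega> \<in> sets borel" and "norm e = 1" "0 \<le> T"
    and seg: "\<And>x t. x \<in> S \<Longrightarrow> 0 < t \<Longrightarrow> t < T \<Longrightarrow> x + t *\<^sub>R e \<in> \<Omega>"
  shows "(\<integral>\<^sup>+x\<in>S. ennreal \<bar>w (x + T *\<^sub>R e) - w x\<bar> \<partial>lborel) \<le>
    ennreal T * (\<integral>\<^sup>+x\<in>\<Omega>. ennreal (norm (G x)) \<partial>lborel)"
proof (rule nn_integral_le_line_integrals[where e=e])
  fix x
  show "ennreal \<bar>w (x + T *\<^sub>R e) - w x\<bar> * indicator S x \<le>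
     (\<integral>\<^sup>+t. ennreal (norm (G (x + t *\<^sub>R e))) * indicator \<Omega> (x + t *\<^sub>R e) * indicator {0<..<T} t \<partial>lborel)"
  proof (cases "x \<in> S")
    case True
    have "ennreal \<bar>w (x + T *\<^sub>R e) - w x\<bar> \<le> (\<integral>\<^sup>+t\<in>{0<..<T}. ennreal (norm (G (x + t *\<^sub>R e))) \<partial>lborel)"
      by (rule abs_diff_le_line_integral[OF w assms(3,4)])
    also have "\<dots> = (\<integral>\<^sup>+t. ennreal (norm (G (x + t *\<^sub>R e))) * indicator \<Omega> (x + t *\<^sub>R e) * indicator {0<..<T} t \<partial>lborel)"
      using seg[OF True] by (intro nn_integral_cong) (auto simp: indicator_def)
    finally show ?thesis using True by simp
  qed simp
qed (use assms C1_gradientD(5)[OF w] in auto)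

lemma nn_integral_shift_diff_le':
  fixes w :: "'a::euclidean_space \<Rightarrow> real"
  assumes w: "C1_gradient w G" and \<Omega>: "\<Omega> \<in> sets borel"
    and seg: "\<And>x t. x \<in> S \<Longrightarrow> 0 < t \<Longrightarrow> t < 1 \<Longrightarrow> x + t *\<^sub>R h \<in> \<Omega>"
  shows "(\<integral>\<^sup>+x\<in>S. ennreal \<bar>w (x + h) - w x\<bar> \<partial>lborel) \<le>
    ennreal (norm h) * (\<integral>\<^sup>+x\<in>\<Omega>. ennreal (norm (G x)) \<partial>lborel)"
proof (cases "h = 0")
  case False
  define e where "e = h /\<^sub>R norm h"
  have h: "h = norm h *\<^sub>R e" "norm e = 1" using False by (auto simp: e_def)
  have "x + t *\<^sub>R e \<in> \<Omega>" if "x \<in> S" "0 < t" "t < norm h" for x t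
  proof -
    have "t / norm h < 1" using that False by (simp add: divide_less_eq)
    then show ?thesis using seg[of x "t / norm h"] that False by (simp add: e_def divide_inverse)
  qed
  from nn_integral_shift_diff_le[OF w \<Omega> h(2) _ this, of "norm h"] show ?thesis
    using h(1) by simp
qed simp

text \<open>After the substitution \<open>x = y + h\<close> and Fubini, the shift estimate applies
  for each fixed \<open>h\<close>, because the ball is convex; only \<open>h\<close> of norm below
  \<open>2 * \<rho>\<close> contribute.\<close>

lemma local_poincare:
  fixes w :: "'a::euclidean_space \<Rightarrow> real"
  assumes w: "C1_gradient w G" and \<Omega>: "\<Omega> \<in> sets borel" and "0 < \<rho>" "ball x0 \<rho> \<subseteq> \<Omega>"
  shows "(\<integral>\<^sup>+y\<in>ball x0 \<rho>. (\<integral>\<^sup>+x\<in>ball x0 \<rho>. ennreal \<bar>w x - w y\<bar> \<partial>lborel) \<partial>lborel) \<le>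
    ennreal (2 * \<rho>) * (\<integral>\<^sup>+x\<in>\<Omega>. ennreal (norm (G x)) \<partial>lborel) * emeasure lborel (ball (0::'a) (2 * \<rho>))"
proof -
  let ?B = "ball x0 \<rho>" and ?I = "\<integral>\<^sup>+x\<in>\<Omega>. ennreal (norm (G x)) \<partial>lborel"
  note [measurable] = C1_gradientD(4)[OF w]
  have [measurable]: "?B \<in> sets borel" by simp
  have "(\<integral>\<^sup>+y\<in>?B. (\<integral>\<^sup>+x\<in>?B. ennreal \<bar>w x - w y\<bar> \<partial>lborel) \<partial>lborel)
    = (\<integral>\<^sup>+y. (\<integral>\<^sup>+x. ennreal \<bar>w x - w y\<bar> * indicator ?B x * indicator ?B y \<partial>lborel) \<partial>lborel)"
    by (intro nn_integral_cong nn_integral_multc[symmetric]) measurable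
  also have "\<dots> = (\<integral>\<^sup>+y. (\<integral>\<^sup>+h. ennreal \<bar>w (y + h) - w y\<bar> * indicator ?B (y + h) * indicator ?B y \<partial>lborel) \<partial>lborel)"
  proof (rule nn_integral_cong)
    fix y
    show "(\<integral>\<^sup>+x. ennreal \<bar>w x - w y\<bar> * indicator ?B x * indicator ?B y \<partial>lborel) =
      (\<integral>\<^sup>+h. ennreal \<bar>w (y + h) - w y\<bar> * indicator ?B (y + h) * indicator ?B y \<partial>lborel)"
      by (rule nn_integral_lborel_translate[symmetric, where f="\<lambda>x. ennreal \<bar>w x - w y\<bar> * indicator ?B x * indicator ?B y"]) measurable
  qed
  also have "\<dots> = (\<integral>\<^sup>+h. (\<integral>\<^sup>+y. ennreal \<bar>w (y + h) - w y\<bar> * indicator ?B (y + h) * indicator ?B y \<partial>lborel) \<partial>lborel)"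
    by (rule lborel_pair.Fubini') measurable
  also have "\<dots> \<le> (\<integral>\<^sup>+h. ennreal (2 * \<rho>) * ?I * indicator (ball (0::'a) (2 * \<rho>)) h \<partial>lborel)"
  proof (rule nn_integral_mono)
    fix h :: 'a
    let ?S = "{y\<in>?B. y + h \<in> ?B}"
    have "(\<integral>\<^sup>+y. ennreal \<bar>w (y + h) - w y\<bar> * indicator ?B (y + h) * indicator ?B y \<partial>lborel)
      = (\<integral>\<^sup>+y\<in>?S. ennreal \<bar>w (y + h) - w y\<bar> \<partial>lborel)"
      by (intro nn_integral_cong) (auto simp: indicator_def)
    also have "\<dots> \<le> ennreal (2 * \<rho>) * ?I * indicator (ball 0 (2 * \<rho>)) h"
    proof (cases "norm h < 2 * \<rho>")
      case True
      have "(\<integral>\<^sup>+y\<in>?S. ennreal \<bar>w (y + h) - w y\<bar> \<partial>lborel) \<le> ennreal (norm h) * ?I"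
      proof (rule nn_integral_shift_diff_le'[OF w \<Omega>])
        fix x t :: "_" assume "x \<in> ?S" "0 < t" "t < (1::real)"
        then have "(1 - t) *\<^sub>R x + t *\<^sub>R (x + h) \<in> ?B"
          using convex_ball[of x0 \<rho>] by (intro convexD) auto
        then have "x + t *\<^sub>R h \<in> ?B" by (simp add: algebra_simps)
        then show "x + t *\<^sub>R h \<in> \<Omega>" using assms by auto
      qed
      also have "\<dots> \<le> ennreal (2 * \<rho>) * ?I" using True by (intro mult_right_mono ennreal_leI) auto
      finally show ?thesis using True by simp
    next
      case False
      have "?S = {}"
      proof safe
        fix y assume "y \<in> ?B" "y + h \<in> ?B"
        then have "dist y (y + h) < 2 * \<rho>"
          using dist_triangle2[of y "y + h" x0] by (simp add: dist_commute)
        then show "y \<in> {}" using False by (simp add: dist_norm)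
      qed
      then show ?thesis by simp
    qed
    finally show "(\<integral>\<^sup>+y. ennreal \<bar>w (y + h) - w y\<bar> * indicator ?B (y + h) * indicator ?B y \<partial>lborel)
      \<le> ennreal (2 * \<rho>) * ?I * indicator (ball 0 (2 * \<rho>)) h" .
  qed
  also have "\<dots> = ennreal (2 * \<rho>) * ?I * emeasure lborel (ball (0::'a) (2 * \<rho>))"
    by (subst nn_integral_cmult_indicator) auto
  finally show ?thesis .
qed

section \<open>Approximation by constants in L^1\<close>

lemma ennreal_tendsto_0_squeeze:
  fixes f g :: "'b \<Rightarrow> ennreal"
  assumes "(g \<longlongrightarrow> 0) F" "\<And>x. f x \<le> g x" shows "(f \<longlongrightarrow> 0) F"
  by (rule tendsto_sandwich[OF _ _ tendsto_const assms(1)]) (use assms(2) in auto)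

lemma ennreal_tendsto_0_cmult:
  fixes f :: "'b \<Rightarrow> ennreal"
  assumes "(f \<longlongrightarrow> 0) F" shows "((\<lambda>x. ennreal K * f x) \<longlongrightarrow> 0) F"
  using ennreal_tendsto_cmult[OF _ assms, of "ennreal K"] by simp

lemma ennreal_tendsto_0_add:
  fixes f g :: "'b \<Rightarrow> ennreal"
  assumes "(f \<longlongrightarrow> 0) F" "(g \<longlongrightarrow> 0) F" shows "((\<lambda>x. f x + g x) \<longlongrightarrow> 0) F"
  using tendsto_add[OF assms] by simp

lemma ennreal_inverse_Suc_tendsto_0: "(\<lambda>j. ennreal (inverse (real (Suc j)))) \<longlonglongrightarrow> 0"
  using tendsto_ennrealI[OF LIMSEQ_inverse_real_of_nat] by simp

lemma ball_measure_pos: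
  fixes x :: "'a::euclidean_space"
  assumes "0 < r"
  obtains V where "0 < V" "emeasure lborel (ball x r) = ennreal V"
  by (rule that[of "unit_ball_vol DIM('a) * r ^ DIM('a)"]) (use assms in \<open>auto simp: emeasure_ball\<close>)

text \<open>The constant \<open>a\<close> is a value of \<open>w\<close>: if all values
  \<open>w y\<close> failed, integrating over \<open>y\<close> would violate the bound on the double
  integral. The margin \<epsilon> makes this contradiction strict.\<close>

lemma local_poincare_value:
  fixes \<Omega> :: "'a::euclidean_space set"
  assumes \<Omega>: "\<Omega> \<in> sets borel" and "0 < \<rho>" "ball x0 \<rho> \<subseteq> \<Omega>"
  obtains K where "\<And>w G \<epsilon>. C1_gradient w G \<Longrightarrow> 0 < \<epsilon> \<Longrightarrow>
    \<exists>a. (\<integral>\<^sup>+x\<in>ball x0 \<rho>. ennreal \<bar>w x - a\<bar> \<partial>lborel) \<le>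
      ennreal K * (\<integral>\<^sup>+x\<in>\<Omega>. ennreal (norm (G x)) \<partial>lborel) + ennreal \<epsilon>"
proof -
  obtain V where V: "0 < V" "emeasure lborel (ball x0 \<rho>) = ennreal V"
    using ball_measure_pos[OF \<open>0 < \<rho>\<close>] by blast
  obtain V2 where V2: "0 < V2" "emeasure lborel (ball (0::'a) (2 * \<rho>)) = ennreal V2"
    using ball_measure_pos[of "2 * \<rho>"] \<open>0 < \<rho>\<close> by (metis mult_pos_pos zero_less_numeral)
  define K where "K = 2 * \<rho> * V2 / V"
  have "0 < K" using \<open>0 < \<rho>\<close> V V2 by (simp add: K_def)
  show thesis
  proof (rule that[of K])
    fix w :: "'a \<Rightarrow> real" and G and \<epsilon> :: real
    assume w: "C1_gradient w G" and "0 < \<epsilon>"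
    let ?B = "ball x0 \<rho>" and ?I = "\<integral>\<^sup>+x\<in>\<Omega>. ennreal (norm (G x)) \<partial>lborel"
    let ?J = "\<lambda>y. \<integral>\<^sup>+x\<in>?B. ennreal \<bar>w x - w y\<bar> \<partial>lborel"
    show "\<exists>a. (\<integral>\<^sup>+x\<in>?B. ennreal \<bar>w x - a\<bar> \<partial>lborel) \<le> ennreal K * ?I + ennreal \<epsilon>"
    proof (cases "?I = \<infinity>")
      case True
      then show ?thesis using \<open>0 < K\<close> by (simp add: ennreal_mult_top)
    next
      case False
      show ?thesis
      proof (rule ccontr)
        assume *: "\<not> ?thesis"
        have "(ennreal K * ?I + ennreal \<epsilon>) * ennreal V = (\<integral>\<^sup>+y\<in>?B. (ennreal K * ?I + ennreal \<epsilon>) \<partial>lborel)"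
          using V(2) by (subst nn_integral_cmult_indicator) auto
        also have "\<dots> \<le> (\<integral>\<^sup>+y\<in>?B. ?J y \<partial>lborel)"
          using * by (intro nn_integral_mono mult_right_mono) (auto simp: not_le intro: less_imp_le)
        also have "\<dots> \<le> ennreal (2 * \<rho>) * ?I * ennreal V2"
          using local_poincare[OF w \<Omega> \<open>0 < \<rho>\<close> assms(3)] V2(2) by simp
        also have "\<dots> = ennreal K * ?I * ennreal V"
          using V V2 \<open>0 < \<rho>\<close> by (cases "?I") (auto simp: K_def ennreal_mult[symmetric] False)
        finally have le: "(ennreal K * ?I + ennreal \<epsilon>) * ennreal V \<le> ennreal K * ?I * ennreal V" .
        obtain r where r: "?I = ennreal r" "0 \<le> r" using False by (cases ?I) auto
        have "(K * r + \<epsilon>) * V \<le> K * r * V"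
          using le V(1) \<open>0 < K\<close> \<open>0 < \<epsilon>\<close> r(2) unfolding r(1)
          by (simp add: ennreal_mult[symmetric] ennreal_plus[symmetric] ennreal_le_iff del: ennreal_plus)
        then show False using mult_pos_pos[OF \<open>0 < \<epsilon>\<close> V(1)] by (simp add: distrib_right)
      qed
    qed
  qed
qed

lemma local_poincare_sequence:
  fixes \<Omega> :: "'a::euclidean_space set"
  assumes "\<Omega> \<in> sets borel" "0 < \<rho>" "ball x0 \<rho> \<subseteq> \<Omega>"
    and w: "\<And>j. C1_gradient (w j) (G j)"
    and lim: "(\<lambda>j. \<integral>\<^sup>+x\<in>\<Omega>. ennreal (norm (G j x)) \<partial>lborel) \<longlonglongrightarrow> 0"
  obtains a where "(\<lambda>j. \<integral>\<^sup>+x\<in>ball x0 \<rho>. ennreal \<bar>w j x - a j\<bar> \<partial>lborel) \<longlonglongrightarrow> 0"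
proof -
  obtain K where K: "\<And>w G \<epsilon>. C1_gradient w G \<Longrightarrow> 0 < \<epsilon> \<Longrightarrow>
    \<exists>a. (\<integral>\<^sup>+x\<in>ball x0 \<rho>. ennreal \<bar>w x - a\<bar> \<partial>lborel) \<le>
      ennreal K * (\<integral>\<^sup>+x\<in>\<Omega>. ennreal (norm (G x)) \<partial>lborel) + ennreal \<epsilon>"
    using local_poincare_value[OF assms(1-3)] by blast
  have "\<forall>j. \<exists>a. (\<integral>\<^sup>+x\<in>ball x0 \<rho>. ennreal \<bar>w j x - a\<bar> \<partial>lborel) \<le>
      ennreal K * (\<integral>\<^sup>+x\<in>\<Omega>. ennreal (norm (G j x)) \<partial>lborel) + ennreal (inverse (real (Suc j)))"
    by (intro allI K w) simp
  then obtain a where a: "\<And>j. (\<integral>\<^sup>+x\<in>ball x0 \<rho>. ennreal \<bar>w j x - a j\<bar> \<partial>lborel) \<le>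
      ennreal K * (\<integral>\<^sup>+x\<in>\<Omega>. ennreal (norm (G j x)) \<partial>lborel) + ennreal (inverse (real (Suc j)))"
    by metis
  show thesis
    by (rule that, rule ennreal_tendsto_0_squeeze[OF _ a])
      (intro ennreal_tendsto_0_add ennreal_tendsto_0_cmult lim ennreal_inverse_Suc_tendsto_0)
qed

lemma set_nn_integral_abs_triangle:
  fixes f g h :: "'a \<Rightarrow> real"
  assumes [measurable]: "f \<in> borel_measurable M" "g \<in> borel_measurable M" "h \<in> borel_measurable M" "A \<in> sets M"
  shows "(\<integral>\<^sup>+x\<in>A. ennreal \<bar>f x - h x\<bar> \<partial>M) \<le>
    (\<integral>\<^sup>+x\<in>A. ennreal \<bar>f x - g x\<bar> \<partial>M) + (\<integral>\<^sup>+x\<in>A. ennreal \<bar>g x - h x\<bar> \<partial>M)"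
proof -
  have "(\<integral>\<^sup>+x\<in>A. ennreal \<bar>f x - h x\<bar> \<partial>M) \<le>
    (\<integral>\<^sup>+x. ennreal \<bar>f x - g x\<bar> * indicator A x + ennreal \<bar>g x - h x\<bar> * indicator A x \<partial>M)"
    by (intro nn_integral_mono)
      (auto simp: indicator_def ennreal_plus[symmetric] simp del: ennreal_plus intro!: ennreal_leI)
  then show ?thesis by (simp add: nn_integral_add)
qed

lemma set_nn_integral_mono_set:
  assumes "A \<subseteq> B"
  shows "(\<integral>\<^sup>+x\<in>A. f x \<partial>M) \<le> (\<integral>\<^sup>+x\<in>B. f x \<partial>M)"
  using assms by (intro nn_integral_mono mult_left_mono) (auto simp: indicator_def)

text \<open>On the common ball both \<open>a j\<close> and \<open>b j\<close> approximate
  \<open>w j\<close>, so they approach each other; the factor \<open>v / V\<close> converts from the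
  volume of that ball to the volume of \<open>Y\<close>.\<close>

lemma L1_limit_transfer:
  fixes w :: "nat \<Rightarrow> 'a::euclidean_space \<Rightarrow> real"
  assumes [measurable]: "X \<in> sets borel" "Y \<in> sets borel" "\<And>j. w j \<in> borel_measurable borel"
    and Z: "0 < r" "ball z r \<subseteq> X" "ball z r \<subseteq> Y" and Y: "emeasure lborel Y < \<infinity>"
    and X_lim: "(\<lambda>j. \<integral>\<^sup>+x\<in>X. ennreal \<bar>w j x - a j\<bar> \<partial>lborel) \<longlonglongrightarrow> 0"
    and Y_lim: "(\<lambda>j. \<integral>\<^sup>+x\<in>Y. ennreal \<bar>w j x - b j\<bar> \<partial>lborel) \<longlonglongrightarrow> 0"
  shows "(\<lambda>j. \<integral>\<^sup>+x\<in>Y. ennreal \<bar>w j x - a j\<bar> \<partial>lborel) \<longlonglongrightarrow> 0"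
proof -
  let ?F = "\<lambda>j. \<integral>\<^sup>+x\<in>X. ennreal \<bar>w j x - a j\<bar> \<partial>lborel" and ?H = "\<lambda>j. \<integral>\<^sup>+x\<in>Y. ennreal \<bar>w j x - b j\<bar> \<partial>lborel"
  obtain V where V: "0 < V" "emeasure lborel (ball z r) = ennreal V"
    using ball_measure_pos[OF Z(1)] by blast
  obtain v where v: "emeasure lborel Y = ennreal v" "0 \<le> v" using Y by (cases "emeasure lborel Y") auto
  have le: "(\<integral>\<^sup>+x\<in>Y. ennreal \<bar>w j x - a j\<bar> \<partial>lborel) \<le> ?H j + ennreal (v / V) * (?H j + ?F j)" for j
  proof -
    have "ennreal \<bar>b j - a j\<bar> * ennreal V = (\<integral>\<^sup>+x\<in>ball z r. ennreal \<bar>b j - a j\<bar> \<partial>lborel)"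
      using V(2) by (subst nn_integral_cmult_indicator) auto
    also have "\<dots> \<le> (\<integral>\<^sup>+x\<in>ball z r. ennreal \<bar>b j - w j x\<bar> \<partial>lborel) + (\<integral>\<^sup>+x\<in>ball z r. ennreal \<bar>w j x - a j\<bar> \<partial>lborel)"
      by (rule set_nn_integral_abs_triangle) auto
    also have "\<dots> \<le> ?H j + ?F j"
      unfolding abs_minus_commute[of "b j"] by (intro add_mono set_nn_integral_mono_set Z)
    finally have bV: "ennreal \<bar>b j - a j\<bar> * ennreal V \<le> ?H j + ?F j" .
    have "(\<integral>\<^sup>+x\<in>Y. ennreal \<bar>w j x - a j\<bar> \<partial>lborel) \<le> ?H j + (\<integral>\<^sup>+x\<in>Y. ennreal \<bar>b j - a j\<bar> \<partial>lborel)"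
      by (rule set_nn_integral_abs_triangle) auto
    also have "(\<integral>\<^sup>+x\<in>Y. ennreal \<bar>b j - a j\<bar> \<partial>lborel) = ennreal \<bar>b j - a j\<bar> * ennreal v"
      using v by (subst nn_integral_cmult_indicator) auto
    also have "\<dots> = ennreal (v / V) * (ennreal \<bar>b j - a j\<bar> * ennreal V)"
      using v V by (simp add: ennreal_mult[symmetric])
    also have "\<dots> \<le> ennreal (v / V) * (?H j + ?F j)"
      by (intro mult_left_mono bV) auto
    finally show ?thesis by (simp add: add_left_mono)
  qed
  show ?thesis
    by (rule ennreal_tendsto_0_squeeze[OF _ le])
      (intro ennreal_tendsto_0_add ennreal_tendsto_0_cmult X_lim Y_lim)
qed

text \<open>At such a boundary point, a translation carries \<open>L\<^sup>1\<close> estimates from the interior to the boundary.\<close>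

definition segment_condition :: "'a::euclidean_space set \<Rightarrow> 'a \<Rightarrow> bool" where
  "segment_condition \<Omega> x0 \<longleftrightarrow> (\<exists>s>0. \<exists>\<rho>>0. \<exists>e. norm e = 1 \<and> x0 + s *\<^sub>R e \<in> \<Omega> \<and>
     (\<forall>x\<in>\<Omega> \<inter> ball x0 \<rho>. \<forall>t. 0 \<le> t \<and> t \<le> s \<longrightarrow> x + t *\<^sub>R e \<in> \<Omega>))"

text \<open>The constants are fixed on one ball, and a point is \<open>good\<close> if the same
  constants still work near it. Goodness spreads through \<Omega> over balls by connectedness and
  reaches the boundary by the segment condition. Boundary points are included because the finite
  cover at the end is one of the compact closure.\<close>

proposition poincare_sequence:
  fixes \<Omega> :: "'a::euclidean_space set" and w :: "nat \<Rightarrow> 'a \<Rightarrow> real"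
  assumes "open \<Omega>" "connected \<Omega>" "\<Omega> \<noteq> {}" "bounded \<Omega>"
    and seg: "\<And>x. x \<in> frontier \<Omega> \<Longrightarrow> segment_condition \<Omega> x"
    and w: "\<And>j. C1_gradient (w j) (G j)"
    and lim: "(\<lambda>j. \<integral>\<^sup>+x\<in>\<Omega>. ennreal (norm (G j x)) \<partial>lborel) \<longlonglongrightarrow> 0"
  obtains a where "(\<lambda>j. \<integral>\<^sup>+x\<in>\<Omega>. ennreal \<bar>w j x - a j\<bar> \<partial>lborel) \<longlonglongrightarrow> 0"
proof -
  have \<Omega>[measurable]: "\<Omega> \<in> sets borel" using \<open>open \<Omega>\<close> by simp
  have wm[measurable]: "w j \<in> borel_measurable borel" for j using C1_gradientD(4)[OF w] .
  obtain x1 where "x1 \<in> \<Omega>" using \<open>\<Omega> \<noteq> {}\<close> by blast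
  then obtain \<rho>1 where \<rho>1: "0 < \<rho>1" "ball x1 \<rho>1 \<subseteq> \<Omega>" using \<open>open \<Omega>\<close> by (meson openE)
  obtain a where a: "(\<lambda>j. \<integral>\<^sup>+x\<in>ball x1 \<rho>1. ennreal \<bar>w j x - a j\<bar> \<partial>lborel) \<longlonglongrightarrow> 0"
    using local_poincare_sequence[OF \<Omega> \<rho>1 w lim] by blast
  define good where "good x \<longleftrightarrow> (\<exists>\<rho>>0.
    (\<lambda>j. \<integral>\<^sup>+y\<in>\<Omega> \<inter> ball x \<rho>. ennreal \<bar>w j y - a j\<bar> \<partial>lborel) \<longlonglongrightarrow> 0)" for x
  have goodI: "good y" if "(\<lambda>j. \<integral>\<^sup>+y\<in>ball x \<rho>. ennreal \<bar>w j y - a j\<bar> \<partial>lborel) \<longlonglongrightarrow> 0" "y \<in> ball x \<rho>" for x y \<rho>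
  proof -
    obtain r where r: "0 < r" "ball y r \<subseteq> ball x \<rho>" using \<open>y \<in> ball x \<rho>\<close> by (meson open_ball openE)
    have "(\<lambda>j. \<integral>\<^sup>+y\<in>\<Omega> \<inter> ball y r. ennreal \<bar>w j y - a j\<bar> \<partial>lborel) \<longlonglongrightarrow> 0"
      using r(2) by (intro ennreal_tendsto_0_squeeze[OF that(1)] set_nn_integral_mono_set) auto
    then show ?thesis using r unfolding good_def by blast
  qed
  have inside: "good x" if "x \<in> \<Omega>" for x
  proof (rule connected_induction_simple[OF \<open>connected \<Omega>\<close> \<open>x1 \<in> \<Omega>\<close> that, of good])
    show "good x1" using goodI[OF a] \<rho>1(1) by simp
    fix y assume "y \<in> \<Omega>"
    then obtain \<rho> where \<rho>: "0 < \<rho>" "ball y \<rho> \<subseteq> \<Omega>" using \<open>open \<Omega>\<close> by (meson openE)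
    obtain b where b: "(\<lambda>j. \<integral>\<^sup>+x\<in>ball y \<rho>. ennreal \<bar>w j x - b j\<bar> \<partial>lborel) \<longlonglongrightarrow> 0"
      using local_poincare_sequence[OF \<Omega> \<rho> w lim] by blast
    have "good z'" if z: "z \<in> ball y \<rho>" "good z" "z' \<in> ball y \<rho>" for z z'
    proof -
      obtain r where r: "0 < r" "(\<lambda>j. \<integral>\<^sup>+y\<in>\<Omega> \<inter> ball z r. ennreal \<bar>w j y - a j\<bar> \<partial>lborel) \<longlonglongrightarrow> 0"
        using z(2) by (auto simp: good_def)
      obtain r' where r': "0 < r'" "ball z r' \<subseteq> ball y \<rho>" using z(1) by (meson open_ball openE)
      have "(\<lambda>j. \<integral>\<^sup>+x\<in>ball y \<rho>. ennreal \<bar>w j x - a j\<bar> \<partial>lborel) \<longlonglongrightarrow> 0"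
      proof (rule L1_limit_transfer[OF _ _ wm _ _ _ _ r(2) b])
        show "0 < min r r'" using r r' by simp
        show "ball z (min r r') \<subseteq> \<Omega> \<inter> ball z r" "ball z (min r r') \<subseteq> ball y \<rho>"
          using r' \<rho> by (auto simp: subset_iff)
        show "emeasure lborel (ball y \<rho>) < \<infinity>" by (simp add: emeasure_ball less_imp_le[OF \<rho>(1)])
      qed auto
      from goodI[OF this z(3)] show ?thesis .
    qed
    then have "\<forall>z\<in>ball y \<rho>. \<forall>z'\<in>ball y \<rho>. good z \<longrightarrow> good z'" by blast
    moreover have "openin (top_of_set \<Omega>) (ball y \<rho>)"
      using \<rho> by (simp add: openin_open_eq[OF \<open>open \<Omega>\<close>])
    moreover have "y \<in> ball y \<rho>" using \<rho> by simp
    ultimately show "\<exists>T. openin (top_of_set \<Omega>) T \<and> y \<in> T \<and> (\<forall>x\<in>T. \<forall>y\<in>T. good x \<longrightarrow> good y)"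
      by blast
  qed
  have boundary: "good x" if bd: "x \<in> frontier \<Omega>" for x
  proof -
    obtain s \<rho> e where s: "0 < s" "0 < \<rho>" "norm e = 1" "x + s *\<^sub>R e \<in> \<Omega>"
      "\<And>y t. y \<in> \<Omega> \<inter> ball x \<rho> \<Longrightarrow> 0 \<le> t \<Longrightarrow> t \<le> s \<Longrightarrow> y + t *\<^sub>R e \<in> \<Omega>"
      using seg[OF bd] unfolding segment_condition_def by blast
    obtain r where r: "0 < r" "(\<lambda>j. \<integral>\<^sup>+y\<in>\<Omega> \<inter> ball (x + s *\<^sub>R e) r. ennreal \<bar>w j y - a j\<bar> \<partial>lborel) \<longlonglongrightarrow> 0"
      using inside[OF s(4)] by (auto simp: good_def)
    \<comment> \<open>The shift by \<open>s *\<^sub>R e\<close> carries \<open>S\<close> into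
      \<Omega> near \<open>x + s *\<^sub>R e\<close>, an interior point already known to be good;
      the price is one translation estimate.\<close>
    define S where "S = \<Omega> \<inter> ball x (min \<rho> r)"
    have [measurable]: "S \<in> sets borel" "ball (x + s *\<^sub>R e) r \<in> sets borel" by (simp_all add: S_def)
    have le: "(\<integral>\<^sup>+y\<in>S. ennreal \<bar>w j y - a j\<bar> \<partial>lborel) \<le>
      ennreal s * (\<integral>\<^sup>+x\<in>\<Omega>. ennreal (norm (G j x)) \<partial>lborel) +
      (\<integral>\<^sup>+y\<in>\<Omega> \<inter> ball (x + s *\<^sub>R e) r. ennreal \<bar>w j y - a j\<bar> \<partial>lborel)" for j
    proof -
      have [measurable]: "w j \<in> borel_measurable borel" by (rule wm)
      have "(\<integral>\<^sup>+y\<in>S. ennreal \<bar>w j y - a j\<bar> \<partial>lborel) \<le>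
        (\<integral>\<^sup>+y\<in>S. ennreal \<bar>w j y - w j (y + s *\<^sub>R e)\<bar> \<partial>lborel) + (\<integral>\<^sup>+y\<in>S. ennreal \<bar>w j (y + s *\<^sub>R e) - a j\<bar> \<partial>lborel)"
        by (rule set_nn_integral_abs_triangle) measurable
      also have "(\<integral>\<^sup>+y\<in>S. ennreal \<bar>w j y - w j (y + s *\<^sub>R e)\<bar> \<partial>lborel) \<le>
          ennreal s * (\<integral>\<^sup>+x\<in>\<Omega>. ennreal (norm (G j x)) \<partial>lborel)"
        unfolding abs_minus_commute[of "w j _" "w j (_ + _)"]
        using s by (intro nn_integral_shift_diff_le[OF w]) (auto simp: S_def)
      also have "(\<integral>\<^sup>+y\<in>S. ennreal \<bar>w j (y + s *\<^sub>R e) - a j\<bar> \<partial>lborel) \<le>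
        (\<integral>\<^sup>+y. ennreal \<bar>w j (s *\<^sub>R e + y) - a j\<bar> * indicator (\<Omega> \<inter> ball (x + s *\<^sub>R e) r) (s *\<^sub>R e + y) \<partial>lborel)"
      proof (rule nn_integral_mono)
        fix y
        have "s *\<^sub>R e + y \<in> \<Omega> \<inter> ball (x + s *\<^sub>R e) r" if "y \<in> S"
          using that s(5)[of y s] \<open>0 < s\<close> by (auto simp: S_def dist_norm add.commute algebra_simps)
        then show "ennreal \<bar>w j (y + s *\<^sub>R e) - a j\<bar> * indicator S y \<le>
          ennreal \<bar>w j (s *\<^sub>R e + y) - a j\<bar> * indicator (\<Omega> \<inter> ball (x + s *\<^sub>R e) r) (s *\<^sub>R e + y)"
          by (cases "y \<in> S") (auto simp: add.commute)
      qed
      also have "\<dots> = (\<integral>\<^sup>+y\<in>\<Omega> \<inter> ball (x + s *\<^sub>R e) r. ennreal \<bar>w j y - a j\<bar> \<partial>lborel)"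
        by (rule nn_integral_lborel_translate[where f="\<lambda>y. ennreal \<bar>w j y - a j\<bar> * indicator (\<Omega> \<inter> ball (x + s *\<^sub>R e) r) y"]) measurable
      finally show ?thesis by (simp add: add_mono)
    qed
    have "(\<lambda>j. \<integral>\<^sup>+y\<in>S. ennreal \<bar>w j y - a j\<bar> \<partial>lborel) \<longlonglongrightarrow> 0"
      by (rule ennreal_tendsto_0_squeeze[OF _ le])
        (intro ennreal_tendsto_0_add ennreal_tendsto_0_cmult lim r(2))
    then show ?thesis unfolding good_def S_def using r s by (intro exI[of _ "min \<rho> r"]) simp
  qed
  have "\<forall>x\<in>closure \<Omega>. good x"
    using inside boundary \<open>open \<Omega>\<close> by (auto simp: frontier_def interior_open)
  from bchoice[OF this[unfolded good_def]] obtain R where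
    *: "\<forall>x\<in>closure \<Omega>. 0 < R x \<and> (\<lambda>j. \<integral>\<^sup>+y\<in>\<Omega> \<inter> ball x (R x). ennreal \<bar>w j y - a j\<bar> \<partial>lborel) \<longlonglongrightarrow> 0"
    by (rule exE)
  have R: "0 < R x" "(\<lambda>j. \<integral>\<^sup>+y\<in>\<Omega> \<inter> ball x (R x). ennreal \<bar>w j y - a j\<bar> \<partial>lborel) \<longlonglongrightarrow> 0"
    if "x \<in> closure \<Omega>" for x
    using bspec[OF * that] by simp_all
  have "compact (closure \<Omega>)" using \<open>bounded \<Omega>\<close> by simp
  then obtain C where C: "C \<subseteq> closure \<Omega>" "finite C" "closure \<Omega> \<subseteq> (\<Union>x\<in>C. ball x (R x))"
    by (rule compactE_image[of _ "closure \<Omega>" "\<lambda>x. ball x (R x)"]) (use R(1) in \<open>auto intro!: centre_in_ball[THEN iffD2]\<close>)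
  have le: "(\<integral>\<^sup>+x\<in>\<Omega>. ennreal \<bar>w j x - a j\<bar> \<partial>lborel) \<le>
     (\<Sum>x\<in>C. \<integral>\<^sup>+y\<in>\<Omega> \<inter> ball x (R x). ennreal \<bar>w j y - a j\<bar> \<partial>lborel)" for j
  proof -
    have [measurable]: "ball x (R x) \<in> sets borel" for x by simp
    have "(\<integral>\<^sup>+x\<in>\<Omega>. ennreal \<bar>w j x - a j\<bar> \<partial>lborel) \<le>
      (\<integral>\<^sup>+y. (\<Sum>x\<in>C. ennreal \<bar>w j y - a j\<bar> * indicator (\<Omega> \<inter> ball x (R x)) y) \<partial>lborel)"
    proof (rule nn_integral_mono)
      fix y
      show "ennreal \<bar>w j y - a j\<bar> * indicator \<Omega> y \<le> (\<Sum>x\<in>C. ennreal \<bar>w j y - a j\<bar> * indicator (\<Omega> \<inter> ball x (R x)) y)"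
      proof (cases "y \<in> \<Omega>")
        case True
        then obtain x where "x \<in> C" "y \<in> ball x (R x)" using C(3) closure_subset by blast
        then show ?thesis
          using True member_le_sum[of x C "\<lambda>x. ennreal \<bar>w j y - a j\<bar> * indicator (\<Omega> \<inter> ball x (R x)) y"] C(2)
          by (simp add: indicator_def)
      qed simp
    qed
    also have "\<dots> = (\<Sum>x\<in>C. \<integral>\<^sup>+y\<in>\<Omega> \<inter> ball x (R x). ennreal \<bar>w j y - a j\<bar> \<partial>lborel)"
      by (intro nn_integral_sum) measurable
    finally show ?thesis .
  qed
  have "(\<lambda>j. \<Sum>x\<in>C. \<integral>\<^sup>+y\<in>\<Omega> \<inter> ball x (R x). ennreal \<bar>w j y - a j\<bar> \<partial>lborel) \<longlonglongrightarrow> (\<Sum>x\<in>C. 0)"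
    using C(1) by (intro tendsto_sum R(2)) auto
  then have "(\<lambda>j. \<Sum>x\<in>C. \<integral>\<^sup>+y\<in>\<Omega> \<inter> ball x (R x). ennreal \<bar>w j y - a j\<bar> \<partial>lborel) \<longlonglongrightarrow> 0" by simp
  from ennreal_tendsto_0_squeeze[OF this le] show thesis by (rule that)
qed


subsection \<open>Boundary charts and the trace inequality\<close>

lemma borel_measurable_hausdorff:
  fixes f :: "'a::metric_space \<Rightarrow> 'b::topological_space"
  assumes "0 \<le> s" "f \<in> borel_measurable borel"
  shows "f \<in> borel_measurable (hausdorff_measure s)"
  using assms borel_subset_sets_hausdorff_measure[OF assms(1)]
  by (auto simp: measurable_def)

text \<open>A chart in Lipschitz form. As \<gamma> lives on the whole space and is constant along
  \<open>e\<close>, heights and the projection onto the graph can be written without coordinates on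
  the hyperplane.\<close>

locale boundary_chart =
  fixes \<Omega> :: "'a::euclidean_space set" and x0 :: 'a and R :: real and e :: 'a
    and \<gamma> :: "'a \<Rightarrow> real" and M s :: real
  assumes s_def: "s = real DIM('a) - 1" and dim: "2 \<le> DIM('a)" and open_\<Omega>: "open \<Omega>" and x0: "x0 \<in> frontier \<Omega>"
    and R: "0 < R" and e: "norm e = 1" and \<gamma>_shift: "\<And>x t. \<gamma> (x + t *\<^sub>R e) = \<gamma> x"
    and \<gamma>_cont: "continuous_on UNIV \<gamma>" and M: "0 \<le> M"
    and \<gamma>_lip: "\<And>x y. x \<in> ball x0 R \<Longrightarrow> y \<in> ball x0 R \<Longrightarrow> \<bar>\<gamma> x - \<gamma> y\<bar> \<le> M * dist x y"
    and graph: "\<Omega> \<inter> ball x0 R = {x \<in> ball x0 R. \<gamma> x < x \<bullet> e}"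
begin

abbreviation "D \<equiv> \<Omega> \<inter> ball x0 R"
abbreviation "HM \<equiv> hausdorff_measure s :: 'a measure"

definition \<pi> :: "'a \<Rightarrow> 'a" where "\<pi> x = x + (\<gamma> x - x \<bullet> e) *\<^sub>R e"

text \<open>The \<nu>-mass of a small ball around a graph point is the volume of the column of the
  chart domain that projects into it. The column has bounded height, so this mass scales like
  \<open>\<rho> powr s\<close>, as surface measure should.\<close>

definition \<nu> :: "'a measure" where "\<nu> = distr (density lborel (indicator D)) borel \<pi>"

lemma s_pos: "0 < s" using dim by (simp add: s_def)

lemma ee: "e \<bullet> e = 1" using e by (simp add: dot_square_norm)

lemma abs_inner_e: "\<bar>v \<bullet> e\<bar> \<le> norm v"
  using Cauchy_Schwarz_ineq2[of v e] e by simp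

lemma \<pi>_measurable [measurable]: "\<pi> \<in> borel_measurable borel"
  unfolding \<pi>_def by (intro borel_measurable_continuous_onI continuous_intros \<gamma>_cont)

lemma D_sets [measurable]: "D \<in> sets borel" using open_\<Omega> by simp

lemma \<pi>_shift: "\<pi> (x + t *\<^sub>R e) = \<pi> x"
  unfolding \<pi>_def \<gamma>_shift by (simp add: inner_add_left ee algebra_simps)

lemma \<pi>_eq: "x = \<pi> x + (x \<bullet> e - \<gamma> x) *\<^sub>R e"
  unfolding \<pi>_def by (simp add: algebra_simps)

lemma \<gamma>_\<pi>: "\<gamma> (\<pi> x) = \<gamma> x" "\<pi> x \<bullet> e = \<gamma> x"
  unfolding \<pi>_def \<gamma>_shift by (simp_all add: inner_add_left ee)

lemma graph_iff: "x \<in> ball x0 R \<Longrightarrow> x \<in> \<Omega> \<longleftrightarrow> \<gamma> x < x \<bullet> e"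
proof -
  assume "x \<in> ball x0 R"
  moreover have "x \<in> D \<longleftrightarrow> x \<in> {x \<in> ball x0 R. \<gamma> x < x \<bullet> e}" by (simp only: graph)
  ultimately show ?thesis by simp
qed

lemma frontier_graph: "frontier \<Omega> \<inter> ball x0 R = {x \<in> ball x0 R. \<gamma> x = x \<bullet> e}"
proof (intro set_eqI iffI)
  fix x assume x: "x \<in> frontier \<Omega> \<inter> ball x0 R"
  then have "x \<notin> \<Omega>" using open_\<Omega> by (simp add: frontier_def interior_open)
  then have 1: "\<not> \<gamma> x < x \<bullet> e" using x graph_iff[of x] by simp
  have "x \<in> closure (ball x0 R \<inter> \<Omega>)"
    using x open_Int_closure_subset[of "ball x0 R" \<Omega>] by (auto simp: frontier_def)
  also have "ball x0 R \<inter> \<Omega> \<subseteq> {x. \<gamma> x \<le> x \<bullet> e}"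
    unfolding Int_commute[of "ball x0 R"] graph by auto
  then have "closure (ball x0 R \<inter> \<Omega>) \<subseteq> {x. \<gamma> x \<le> x \<bullet> e}"
    by (rule closure_minimal) (intro closed_Collect_le continuous_intros \<gamma>_cont)
  finally show "x \<in> {x \<in> ball x0 R. \<gamma> x = x \<bullet> e}" using 1 x by auto
next
  fix x assume x: "x \<in> {x \<in> ball x0 R. \<gamma> x = x \<bullet> e}"
  then have "x \<notin> \<Omega>" using graph_iff[of x] by simp
  moreover have "x \<in> closure \<Omega>"
  proof (rule closure_approachable[THEN iffD2], intro allI impI)
    fix d :: real assume "0 < d"
    define t where "t = min (d / 2) ((R - dist x0 x) / 2)"
    have t: "0 < t" "t < d" "t < R - dist x0 x" using \<open>0 < d\<close> x by (auto simp: t_def min_def field_simps)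
    have "dist x (x + t *\<^sub>R e) = t" using t e by (simp add: dist_norm)
    then have "x + t *\<^sub>R e \<in> ball x0 R"
      using t dist_triangle[of x0 "x + t *\<^sub>R e" x] by simp
    moreover have "\<gamma> (x + t *\<^sub>R e) < (x + t *\<^sub>R e) \<bullet> e"
      using x t by (simp add: \<gamma>_shift inner_add_left ee)
    ultimately have "x + t *\<^sub>R e \<in> \<Omega>" using graph_iff by blast
    then show "\<exists>y\<in>\<Omega>. dist y x < d"
      using \<open>dist x (x + t *\<^sub>R e) = t\<close> t by (intro bexI[of _ "x + t *\<^sub>R e"]) (simp_all add: dist_commute)
  qed
  ultimately show "x \<in> frontier \<Omega> \<inter> ball x0 R"
    using x open_\<Omega> by (simp add: frontier_def interior_open)
qed

lemma frontier_iff: "x \<in> ball x0 R \<Longrightarrow> x \<in> frontier \<Omega> \<longleftrightarrow> \<gamma> x = x \<bullet> e"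
proof -
  assume "x \<in> ball x0 R"
  moreover have "x \<in> frontier \<Omega> \<inter> ball x0 R \<longleftrightarrow> x \<in> {x \<in> ball x0 R. \<gamma> x = x \<bullet> e}"
    by (simp only: frontier_graph)
  ultimately show ?thesis by simp
qed

lemma \<gamma>_x0: "\<gamma> x0 = x0 \<bullet> e"
  using frontier_iff[of x0] x0 R by simp

text \<open>A step along \<open>e\<close> raises \<open>x \<bullet> e\<close> and leaves
  \<open>\<gamma> x\<close> unchanged, so it stays in \<Omega> as long as it stays in the chart
  ball; the fractions of \<open>R\<close> ensure the latter.\<close>

lemma segment_condition: "segment_condition \<Omega> x0"
proof -
  have up: "x + t *\<^sub>R e \<in> \<Omega>" if "x \<in> ball x0 (R / 2)" "\<gamma> x < x \<bullet> e + t" "0 \<le> t" "t \<le> R / 4" for x t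
  proof -
    have "dist x (x + t *\<^sub>R e) = t" using that e by (simp add: dist_norm)
    then have "x + t *\<^sub>R e \<in> ball x0 R"
      using that R dist_triangle[of x0 "x + t *\<^sub>R e" x] by simp
    moreover have "\<gamma> (x + t *\<^sub>R e) < (x + t *\<^sub>R e) \<bullet> e"
      using that by (simp add: \<gamma>_shift inner_add_left ee)
    ultimately show ?thesis using graph_iff by blast
  qed
  have 1: "x0 + (R / 4) *\<^sub>R e \<in> \<Omega>" using R by (intro up) (auto simp: \<gamma>_x0)
  have 2: "x + t *\<^sub>R e \<in> \<Omega>" if x: "x \<in> \<Omega> \<inter> ball x0 (R / 4)" "0 \<le> t \<and> t \<le> R / 4" for x t
  proof -
    from x have "x \<in> \<Omega> \<inter> ball x0 R" using R by auto
    then have "\<gamma> x < x \<bullet> e" unfolding graph by simp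
    then show "x + t *\<^sub>R e \<in> \<Omega>" using x R by (intro up) auto
  qed
  have R4: "0 < R / 4" using R by simp
  show ?thesis
    unfolding segment_condition_def using R4 e 1 2 by blast
qed

section \<open>The projected Lebesgue measure and its densities\<close>

lemma sets_\<nu> [simp, measurable_cong]: "sets \<nu> = sets borel" by (simp add: \<nu>_def)

lemma emeasure_\<nu>: "B \<in> sets borel \<Longrightarrow> emeasure \<nu> B = emeasure lborel (D \<inter> \<pi> -` B)"
proof -
  assume B: "B \<in> sets borel"
  have pre: "\<pi> -` B \<in> sets borel" using measurable_sets[OF \<pi>_measurable B] by simp
  have "emeasure \<nu> B = emeasure (density lborel (indicator D)) (\<pi> -` B)"
    unfolding \<nu>_def using B by (subst emeasure_distr) (auto simp: space_density)
  also have "\<dots> = (\<integral>\<^sup>+x. indicator D x * indicator (\<pi> -` B) x \<partial>lborel)"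
    using pre D_sets by (intro emeasure_density) auto
  also have "\<dots> = (\<integral>\<^sup>+x. indicator (D \<inter> \<pi> -` B) x \<partial>lborel)"
    by (intro nn_integral_cong) (auto simp: indicator_def)
  also have "\<dots> = emeasure lborel (D \<inter> \<pi> -` B)"
    using pre D_sets by (intro nn_integral_indicator) auto
  finally show ?thesis .
qed

lemma nn_integral_\<nu>:
  assumes [measurable]: "f \<in> borel_measurable borel"
  shows "(\<integral>\<^sup>+x. f x \<partial>\<nu>) = (\<integral>\<^sup>+x\<in>D. f (\<pi> x) \<partial>lborel)"
  unfolding \<nu>_def using D_sets
  by (subst nn_integral_distr) (auto simp: nn_integral_density mult.commute)

lemma finite_\<nu>: "emeasure \<nu> UNIV < \<infinity>"
proof -
  have "emeasure \<nu> UNIV \<le> emeasure lborel (ball x0 R)"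
    by (subst emeasure_\<nu>) (auto intro!: emeasure_mono)
  also have "\<dots> < \<infinity>" using R by (simp add: emeasure_ball)
  finally show ?thesis .
qed

text \<open>At heights between \<open>R / 4\<close> and \<open>R / 2\<close> over \<open>z\<close>
  there is room for a ball of radius \<eta> above the graph, which rises by at most
  \<open>M * \<eta>\<close> over it. The projection of the ball stays within
  \<open>(2 + M) * \<eta>\<close> of \<open>z\<close>: \<eta> for the displacement \<open>v\<close>,
  \<eta> for removing its height, and \<open>M * \<eta>\<close> for the slope.\<close>

lemma column_ball:
  assumes z: "z \<in> frontier \<Omega>" "z \<in> cball x0 (R / 4)" and \<eta>: "0 < \<eta>" "\<eta> + M * \<eta> < R / 4"
    and t: "R / 4 \<le> t" "t \<le> R / 2"
  shows "ball (z + t *\<^sub>R e) \<eta> \<subseteq> D \<inter> \<pi> -` cball z ((2 + M) * \<eta>)"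
proof
  fix y assume y: "y \<in> ball (z + t *\<^sub>R e) \<eta>"
  define v where "v = y - (z + t *\<^sub>R e)"
  have v: "norm v < \<eta>" "y = (z + v) + t *\<^sub>R e" using y by (auto simp: v_def dist_norm norm_minus_commute)
  have M\<eta>: "0 \<le> M * \<eta>" using M \<eta> by simp
  have zR: "z \<in> ball x0 R" using z R by simp
  then have \<gamma>z: "\<gamma> z = z \<bullet> e" using frontier_iff[of z] z by simp
  have d1: "dist z (z + v) = norm v" by (simp add: dist_norm)
  have d2: "dist (z + v) y = t" using v(2) e t R by (simp add: dist_norm)
  have zv: "z + v \<in> ball x0 R" using dist_triangle[of x0 "z + v" z] d1 z v \<eta> M\<eta> R by simp
  have yR: "y \<in> ball x0 R"
    using dist_triangle[of x0 y "z + v"] dist_triangle[of x0 "z + v" z] d1 d2 z v \<eta> M\<eta> R t by simp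
  have lip: "\<bar>\<gamma> (z + v) - \<gamma> z\<bar> \<le> M * \<eta>"
  proof -
    have "\<bar>\<gamma> (z + v) - \<gamma> z\<bar> \<le> M * norm v" using \<gamma>_lip[OF zv zR] d1 by (simp add: dist_commute)
    also have "\<dots> \<le> M * \<eta>" using v M by (intro mult_left_mono) auto
    finally show ?thesis .
  qed
  have ve: "\<bar>v \<bullet> e\<bar> < \<eta>" using abs_inner_e[of v] v by simp
  have "\<gamma> y < y \<bullet> e"
    using v(2) lip ve \<gamma>z \<eta> t by (simp add: \<gamma>_shift inner_add_left ee)
  then have "y \<in> D" using yR graph_iff[of y] by blast
  moreover have "\<pi> y = \<pi> (z + v)" using v(2) \<pi>_shift by simp
  moreover have "norm (\<pi> (z + v) - z) \<le> (2 + M) * \<eta>"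
  proof -
    have "\<pi> (z + v) - z = v + (\<gamma> (z + v) - \<gamma> z - v \<bullet> e) *\<^sub>R e"
      by (simp add: \<pi>_def \<gamma>z inner_add_left algebra_simps)
    also have "norm \<dots> \<le> norm v + \<bar>\<gamma> (z + v) - \<gamma> z - v \<bullet> e\<bar>"
      using norm_triangle_ineq[of v "(\<gamma> (z + v) - \<gamma> z - v \<bullet> e) *\<^sub>R e"] e by simp
    also have "\<dots> \<le> \<eta> + (M * \<eta> + \<eta>)" using v lip ve by linarith
    finally show ?thesis by (simp add: algebra_simps)
  qed
  ultimately show "y \<in> D \<inter> \<pi> -` cball z ((2 + M) * \<eta>)"
    by (simp add: dist_norm norm_minus_commute)
qed

text \<open>With \<open>\<eta> = \<rho> / (2 + M)\<close>, at least \<open>R / (16 * \<eta>)\<close>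
  disjoint balls of volume \<open>unit_ball_vol DIM('a) * \<eta> ^ DIM('a)\<close> fit into the
  column over \<open>cball z \<rho>\<close>; their total volume is
  \<open>c_low * \<rho> powr s\<close>. The bound \<open>\<rho>_low\<close> forces \<eta> to be at
  most \<open>R / 16\<close>, so that there is at least one ball.\<close>

definition "c_low = R * unit_ball_vol DIM('a) / (16 * (2 + M) powr s)"
definition "\<rho>_low = R / 16"

lemma c_low: "0 < c_low" "0 < \<rho>_low"
  using R M by (auto simp: c_low_def \<rho>_low_def)

text \<open>About \<open>R / (8\<eta>)\<close> disjoint balls of radius \<open>\<eta>\<close> are stacked above \<open>z\<close>.\<close>

lemma density_lower:
  assumes z: "z \<in> frontier \<Omega>" "z \<in> cball x0 (R / 4)" and \<rho>: "0 < \<rho>" "\<rho> < \<rho>_low"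
  shows "ennreal (c_low * \<rho> powr s) \<le> emeasure \<nu> (cball z \<rho>)"
proof -
  define \<eta> where "\<eta> = \<rho> / (2 + M)"
  have \<eta>: "0 < \<eta>" "(2 + M) * \<eta> = \<rho>" using M \<rho> by (auto simp: \<eta>_def)
  have "\<eta> + M * \<eta> = \<rho> - \<eta>" using \<eta>(2) by (simp add: algebra_simps)
  then have small: "\<eta> + M * \<eta> < R / 4" using \<rho> \<eta>(1) R by (simp add: \<rho>_low_def)
  have M\<eta>: "0 \<le> M * \<eta>" using M \<eta> by simp
  then have \<eta>16: "\<eta> \<le> R / 16" using \<eta>(2) \<rho> \<eta>(1) by (simp add: \<rho>_low_def algebra_simps)
  define N where "N = nat \<lfloor>R / (8 * \<eta>)\<rfloor>"
  have N: "real N \<le> R / (8 * \<eta>)" "R / (8 * \<eta>) - 1 \<le> real N"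
    using R \<eta> by (auto simp: N_def)
  \<comment> \<open>Rounding down loses at most 1, which this bounds by half of
    \<open>R / (8 * \<eta>)\<close>.\<close>
  have "1 \<le> R / (16 * \<eta>)" using \<eta>16 \<eta>(1) by (simp add: field_simps)
  then have N2: "R / (16 * \<eta>) \<le> real N" using N(2) by (simp add: field_simps)
  have N1: "2 * (real N * \<eta>) \<le> R / 4" using N(1) \<eta>(1) by (simp add: field_simps)
  define t where "t k = R / 4 + 2 * (real k * \<eta>)" for k
  have sub: "ball (z + t k *\<^sub>R e) \<eta> \<subseteq> D \<inter> \<pi> -` cball z \<rho>" if "k < N" for k
  proof -
    have "real k * \<eta> \<le> real N * \<eta>" using that \<eta>(1) by (intro mult_right_mono) auto
    moreover have "0 \<le> real k * \<eta>" using \<eta>(1) by simp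
    ultimately have "R / 4 \<le> t k" "t k \<le> R / 2" using N1 unfolding t_def by linarith+
    from column_ball[OF z \<eta>(1) small this] show ?thesis using \<eta>(2) by simp
  qed
  have disj: "disjoint_family_on (\<lambda>k. ball (z + t k *\<^sub>R e) \<eta>) {..<N}"
    unfolding disjoint_family_on_def
  proof (intro ballI impI)
    fix k l :: nat assume "k \<noteq> l"
    then have "1 \<le> \<bar>real k - real l\<bar>" by linarith
    then have "2 * \<eta> \<le> 2 * \<eta> * \<bar>real k - real l\<bar>" using \<eta>(1) by simp
    also have "\<dots> = \<bar>2 * \<eta> * (real k - real l)\<bar>" using \<eta>(1) by (simp add: abs_mult)
    also have "2 * \<eta> * (real k - real l) = t k - t l" by (simp add: t_def algebra_simps)
    also have "\<bar>t k - t l\<bar> = dist (z + t k *\<^sub>R e) (z + t l *\<^sub>R e)"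
      using e by (simp add: dist_norm scaleR_left_diff_distrib[symmetric])
    finally show "ball (z + t k *\<^sub>R e) \<eta> \<inter> ball (z + t l *\<^sub>R e) \<eta> = {}"
      by (intro disjoint_ballI) simp
  qed
  have "c_low * \<rho> powr s = R / 16 * unit_ball_vol DIM('a) * \<eta> powr s"
    using M \<rho> by (simp add: c_low_def \<eta>_def powr_divide)
  also have "\<eta> powr s = \<eta> ^ DIM('a) / \<eta>"
    using \<eta>(1) by (simp add: s_def powr_diff powr_realpow)
  also have "R / 16 * unit_ball_vol DIM('a) * (\<eta> ^ DIM('a) / \<eta>) = R / (16 * \<eta>) * (unit_ball_vol DIM('a) * \<eta> ^ DIM('a))"
    by simp
  also have "\<dots> \<le> real N * (unit_ball_vol DIM('a) * \<eta> ^ DIM('a))"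
    using N2 \<eta>(1) by (intro mult_right_mono) auto
  finally have "ennreal (c_low * \<rho> powr s) \<le> ennreal (real N * (unit_ball_vol DIM('a) * \<eta> ^ DIM('a)))"
    by (rule ennreal_leI)
  also have "\<dots> = (\<Sum>k<N. emeasure lborel (ball (z + t k *\<^sub>R e) \<eta>))"
    using \<eta>(1) by (simp add: emeasure_ball ennreal_mult ennreal_of_nat_eq_real_of_nat)
  also have "\<dots> = emeasure lborel (\<Union>k<N. ball (z + t k *\<^sub>R e) \<eta>)"
    by (intro sum_emeasure disj) auto
  also have "\<dots> \<le> emeasure lborel (D \<inter> \<pi> -` cball z \<rho>)"
  proof (rule emeasure_mono)
    show "(\<Union>k<N. ball (z + t k *\<^sub>R e) \<eta>) \<subseteq> D \<inter> \<pi> -` cball z \<rho>" using sub by blast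
    show "D \<inter> \<pi> -` cball z \<rho> \<in> sets lborel"
      using measurable_sets[OF \<pi>_measurable, of "cball z \<rho>"] D_sets by auto
  qed
  also have "\<dots> = emeasure \<nu> (cball z \<rho>)" by (simp add: emeasure_\<nu>)
  finally show ?thesis .
qed

lemma height_bound:
  assumes "y \<in> D" shows "0 < y \<bullet> e - \<gamma> y" "y \<bullet> e - \<gamma> y \<le> (1 + M) * R"
proof -
  have y: "y \<in> ball x0 R" "\<gamma> y < y \<bullet> e" using assms unfolding graph by auto
  show "0 < y \<bullet> e - \<gamma> y" using y by simp
  have "\<bar>\<gamma> y - \<gamma> x0\<bar> \<le> M * dist y x0" using \<gamma>_lip[OF y(1), of x0] R by simp
  also have "\<dots> \<le> M * R" using y M by (intro mult_left_mono) (auto simp: dist_commute)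
  finally have 1: "\<bar>\<gamma> y - x0 \<bullet> e\<bar> \<le> M * R" unfolding \<gamma>_x0 .
  have "\<bar>y \<bullet> e - x0 \<bullet> e\<bar> \<le> R"
    using abs_inner_e[of "y - x0"] y by (simp add: inner_diff_left dist_norm norm_minus_commute)
  with 1 have "y \<bullet> e - \<gamma> y \<le> R + M * R" by linarith
  then show "y \<bullet> e - \<gamma> y \<le> (1 + M) * R" by (simp add: algebra_simps)
qed

text \<open>At most \<open>((1 + M) * R + 1) / \<rho>\<close> balls, each of volume
  \<open>unit_ball_vol DIM('a) * (2 * \<rho>) ^ DIM('a)\<close>.\<close>

definition "C_up = ((1 + M) * R + 1) * (unit_ball_vol DIM('a) * 2 ^ DIM('a))"

lemma C_up: "0 < C_up" using R M by (simp add: C_up_def add_nonneg_pos)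

text \<open>The column over \<open>cball z \<rho>\<close> has height at most
  \<open>(1 + M) * R\<close>. Cut into slices of thickness \<rho>, each slice fits into a ball of
  radius \<open>2 * \<rho>\<close> centred on the line through \<open>z\<close> along
  \<open>e\<close>. Since \<rho> is at most 1, the one extra slice from rounding is absorbed into
  the constant.\<close>

lemma density_upper:
  assumes \<rho>: "0 < \<rho>" "\<rho> \<le> 1"
  shows "emeasure \<nu> (cball z \<rho>) \<le> ennreal (C_up * \<rho> powr s)"
proof -
  let ?T = "(1 + M) * R"
  have T: "0 < ?T" using M R by simp
  define N where "N = nat \<lfloor>?T / \<rho>\<rfloor>"
  have "D \<inter> \<pi> -` cball z \<rho> \<subseteq> (\<Union>k\<le>N. cball (z + (real k * \<rho>) *\<^sub>R e) (2 * \<rho>))"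
  proof
    fix y assume y: "y \<in> D \<inter> \<pi> -` cball z \<rho>"
    define \<tau> where "\<tau> = y \<bullet> e - \<gamma> y"
    have \<tau>: "0 < \<tau>" "\<tau> \<le> ?T" using height_bound[of y] y by (auto simp: \<tau>_def)
    define k where "k = nat \<lfloor>\<tau> / \<rho>\<rfloor>"
    have "\<tau> / \<rho> \<le> ?T / \<rho>" using \<tau> \<rho> by (intro divide_right_mono) auto
    then have "k \<le> N" unfolding k_def N_def by (intro nat_mono floor_mono)
    have "real k \<le> \<tau> / \<rho>" "\<tau> / \<rho> < real k + 1" using \<tau> \<rho> by (auto simp: k_def)
    then have "real k * \<rho> \<le> \<tau>" "\<tau> \<le> real k * \<rho> + \<rho>" using \<rho> by (auto simp: field_simps)
    then have k: "\<bar>\<tau> - real k * \<rho>\<bar> \<le> \<rho>" by linarith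
    have eq: "y - (z + (real k * \<rho>) *\<^sub>R e) = (\<pi> y - z) + (\<tau> - real k * \<rho>) *\<^sub>R e"
      using \<pi>_eq[of y] unfolding \<tau>_def[symmetric] by (metis (no_types, opaque_lifting) add_diff_add scaleR_left_diff_distrib)
    have "norm (y - (z + (real k * \<rho>) *\<^sub>R e)) \<le> norm (\<pi> y - z) + \<bar>\<tau> - real k * \<rho>\<bar>"
      unfolding eq using norm_triangle_ineq[of "\<pi> y - z" "(\<tau> - real k * \<rho>) *\<^sub>R e"] e by simp
    also have "\<dots> \<le> 2 * \<rho>" using k y by (simp add: dist_norm norm_minus_commute)
    finally have "y \<in> cball (z + (real k * \<rho>) *\<^sub>R e) (2 * \<rho>)" by (simp add: dist_norm norm_minus_commute)
    then show "y \<in> (\<Union>k\<le>N. cball (z + (real k * \<rho>) *\<^sub>R e) (2 * \<rho>))" using \<open>k \<le> N\<close> by blast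
  qed
  then have "emeasure \<nu> (cball z \<rho>) \<le> emeasure lborel (\<Union>k\<le>N. cball (z + (real k * \<rho>) *\<^sub>R e) (2 * \<rho>))"
    by (simp add: emeasure_\<nu>) (intro emeasure_mono, auto)
  also have "\<dots> \<le> (\<Sum>k\<le>N. emeasure lborel (cball (z + (real k * \<rho>) *\<^sub>R e) (2 * \<rho>)))"
    by (intro emeasure_subadditive_finite) auto
  also have "\<dots> = ennreal ((real N + 1) * (unit_ball_vol DIM('a) * (2 * \<rho>) ^ DIM('a)))"
    using \<rho> by (simp add: emeasure_cball ennreal_mult ennreal_of_nat_eq_real_of_nat add.commute[of 1] ennreal_plus[symmetric] del: ennreal_plus)
  also have "\<dots> \<le> ennreal (C_up * \<rho> powr s)"
  proof (rule ennreal_leI)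
    have "real N \<le> ?T / \<rho>" using T \<rho> by (simp add: N_def)
    moreover have "1 \<le> 1 / \<rho>" using \<rho> by simp
    ultimately have "real N + 1 \<le> (?T + 1) / \<rho>" by (simp add: add_divide_distrib)
    then have "(real N + 1) * (unit_ball_vol DIM('a) * (2 * \<rho>) ^ DIM('a)) \<le>
      (?T + 1) / \<rho> * (unit_ball_vol DIM('a) * (2 * \<rho>) ^ DIM('a))"
      using \<rho> by (intro mult_right_mono) auto
    also have "\<dots> = C_up * (\<rho> ^ DIM('a) / \<rho>)"
      by (simp add: C_up_def power_mult_distrib)
    also have "\<rho> ^ DIM('a) / \<rho> = \<rho> powr s" using \<rho> by (simp add: s_def powr_diff powr_realpow)
    finally show "(real N + 1) * (unit_ball_vol DIM('a) * (2 * \<rho>) ^ DIM('a)) \<le> C_up * \<rho> powr s" .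
  qed
  finally show ?thesis .
qed

lemma compact_frontier_cball: "compact (frontier \<Omega> \<inter> cball x0 r)"
  by (simp add: closed_Int_compact)

text \<open>The lower density makes the \<nu>-mass near \<open>x0\<close> positive; the upper
  density and the mass distribution principle convert it into Hausdorff measure. This is what later
  allows a \<sigma> of prescribed mass to be concentrated near \<open>x0\<close>.\<close>

lemma hausdorff_frontier_pos:
  assumes "0 < r" shows "0 < emeasure HM (frontier \<Omega> \<inter> cball x0 r)"
proof -
  define \<rho> where "\<rho> = min (r / 2) (min (R / 4) (\<rho>_low / 2))"
  have \<rho>: "0 < \<rho>" "\<rho> \<le> r" "\<rho> < \<rho>_low" "\<rho> < R" using assms R c_low by (auto simp: \<rho>_def min_def)
  have B: "frontier \<Omega> \<inter> cball x0 r \<in> sets borel" by simp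
  have "0 < ennreal (c_low * \<rho> powr s)" using c_low \<rho> by simp
  also have "\<dots> \<le> emeasure \<nu> (cball x0 \<rho>)" using x0 R \<rho> by (intro density_lower) auto
  also have "\<dots> \<le> emeasure \<nu> (frontier \<Omega> \<inter> cball x0 r)"
  proof -
    have "\<pi> y \<in> frontier \<Omega>" if "\<pi> y \<in> cball x0 \<rho>" for y
    proof -
      have "\<pi> y \<in> ball x0 R" using that \<rho> by simp
      then show ?thesis using frontier_iff[of "\<pi> y"] by (simp add: \<gamma>_\<pi>)
    qed
    then have "D \<inter> \<pi> -` cball x0 \<rho> \<subseteq> D \<inter> \<pi> -` (frontier \<Omega> \<inter> cball x0 r)" using \<rho> by auto
    moreover have "D \<inter> \<pi> -` (frontier \<Omega> \<inter> cball x0 r) \<in> sets lborel"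
      using measurable_sets[OF \<pi>_measurable B] D_sets by auto
    ultimately show ?thesis by (simp add: emeasure_\<nu> emeasure_mono)
  qed
  finally have "0 < ennreal (unit_ball_vol s / (C_up * 2 powr s)) * emeasure \<nu> (frontier \<Omega> \<inter> cball x0 r)"
    using C_up s_pos by (simp add: ennreal_zero_less_mult_iff)
  also have "\<dots> \<le> hausdorff_outer s (frontier \<Omega> \<inter> cball x0 r)"
    by (rule mass_distribution_principle[OF sets_\<nu> B s_pos C_up density_upper])
  also have "\<dots> = emeasure HM (frontier \<Omega> \<inter> cball x0 r)"
    using s_pos B by (intro emeasure_hausdorff_measure[symmetric] borel_subset_sets_hausdorff_measure) auto
  finally show ?thesis .
qed

definition "C_tr = unit_ball_vol s * 2 powr s / c_low"

lemma hausdorff_compact_le: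
  assumes "compact K" "K \<subseteq> frontier \<Omega> \<inter> cball x0 (R / 4)"
  shows "emeasure HM K \<le> ennreal C_tr * emeasure \<nu> K"
proof -
  have "emeasure HM K = hausdorff_outer s K"
    using s_pos assms(1) by (intro emeasure_hausdorff_measure borel_subset_sets_hausdorff_measure) (auto simp: compact_imp_closed)
  also have "\<dots> \<le> ennreal C_tr * emeasure \<nu> K"
    unfolding C_tr_def using assms s_pos
    by (intro hausdorff_outer_le_of_density[OF sets_\<nu> finite_\<nu> _ c_low(1,2)] density_lower) auto
  finally show ?thesis .
qed

abbreviation "A \<equiv> frontier \<Omega> \<inter> cball x0 (R / 4)"

lemma hausdorff_frontier_finite: "emeasure HM A < \<infinity>"
proof -
  have "emeasure HM A \<le> ennreal C_tr * emeasure \<nu> A"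
    by (intro hausdorff_compact_le compact_frontier_cball) simp
  also have "\<dots> \<le> ennreal C_tr * emeasure \<nu> UNIV" by (intro mult_left_mono emeasure_mono) auto
  also have "\<dots> < \<infinity>" using finite_\<nu> by (simp add: ennreal_mult_less_top)
  finally show ?thesis .
qed

text \<open>\<open>HM\<close> restricted to \<open>A\<close> and moved to the Borel sets by the
  identity. Inner regularity of finite Borel measures then spreads the bound for compact sets to all
  Borel sets, hence to integrals.\<close>

definition HA :: "'a measure" where "HA = distr (density HM (indicator A)) borel (\<lambda>x. x)"

lemma id_measurable: "(\<lambda>x. x) \<in> density HM (indicator A) \<rightarrow>\<^sub>M borel"
  using borel_measurable_hausdorff[of s "\<lambda>x. x"] s_pos by simp

lemma A_sets: "A \<in> sets HM"
  using s_pos by (intro borel_subset_sets_hausdorff_measure) auto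

lemma emeasure_HA: "B \<in> sets borel \<Longrightarrow> emeasure HA B = emeasure HM (B \<inter> A)"
proof -
  assume B: "B \<in> sets borel"
  then have B': "B \<in> sets HM" using s_pos by (intro borel_subset_sets_hausdorff_measure) auto
  have "emeasure HA B = emeasure (density HM (indicator A)) B"
    unfolding HA_def using B by (subst emeasure_distr[OF id_measurable]) (auto simp: space_density)
  also have "\<dots> = (\<integral>\<^sup>+x. indicator A x * indicator B x \<partial>HM)"
    using B' A_sets by (intro emeasure_density) auto
  also have "\<dots> = (\<integral>\<^sup>+x. indicator (B \<inter> A) x \<partial>HM)"
    by (intro nn_integral_cong) (auto simp: indicator_def)
  also have "\<dots> = emeasure HM (B \<inter> A)"
    using B' A_sets by (intro nn_integral_indicator) auto
  finally show ?thesis .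
qed

lemma nn_integral_HA:
  assumes f: "f \<in> borel_measurable borel"
  shows "(\<integral>\<^sup>+x. f x \<partial>HA) = (\<integral>\<^sup>+x\<in>A. f x \<partial>HM)"
proof -
  have f': "f \<in> borel_measurable HM" using f s_pos by (intro borel_measurable_hausdorff) auto
  show ?thesis
    unfolding HA_def using A_sets f'
    by (subst nn_integral_distr[OF id_measurable]) (auto simp: f nn_integral_density mult.commute)
qed

lemma HA_le: "HA \<le> scale_measure (ennreal C_tr) \<nu>"
proof -
  have sets_HA: "sets HA = sets borel" by (simp add: HA_def)
  have "emeasure HA B \<le> ennreal C_tr * emeasure \<nu> B" if B: "B \<in> sets borel" for B
  proof -
    have "emeasure HA B = (SUP K \<in> {K. K \<subseteq> B \<and> compact K}. emeasure HA K)"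
    proof (rule inner_regular[OF sets_HA _ B])
      have "space HA = UNIV" using sets_eq_imp_space_eq[OF sets_HA] by simp
      then show "emeasure HA (space HA) \<noteq> \<infinity>"
        using hausdorff_frontier_finite by (simp add: emeasure_HA)
    qed
    also have "\<dots> \<le> ennreal C_tr * emeasure \<nu> B"
    proof (rule SUP_least)
      fix K assume "K \<in> {K. K \<subseteq> B \<and> compact K}"
      then have K: "K \<subseteq> B" "compact K" by auto
      have KA: "compact (K \<inter> A)" using K(2) compact_frontier_cball compact_imp_closed by (intro compact_Int_closed) auto
      have "emeasure HA K = emeasure HM (K \<inter> A)" using K(2) by (simp add: emeasure_HA compact_imp_closed)
      also have "\<dots> \<le> ennreal C_tr * emeasure \<nu> (K \<inter> A)" by (rule hausdorff_compact_le[OF KA]) auto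
      also have "\<dots> \<le> ennreal C_tr * emeasure \<nu> B"
        using K B by (intro mult_left_mono emeasure_mono) auto
      finally show "emeasure HA K \<le> ennreal C_tr * emeasure \<nu> B" .
    qed
    finally show ?thesis .
  qed
  then show ?thesis
    by (subst le_measure) (auto simp: sets_HA)
qed

text \<open>The boundary value \<open>w (\<pi> x)\<close> differs from \<open>w x\<close> by at most
  an integral of the gradient down the vertical segment. Integrating with respect to \<nu> averages
  this over all heights and produces volume integrals.\<close>

proposition trace_inequality:
  assumes w: "C1_gradient w G"
  shows "(\<integral>\<^sup>+x\<in>A. ennreal \<bar>w x\<bar> \<partial>HM) \<le> ennreal C_tr *
    ((\<integral>\<^sup>+x\<in>D. ennreal \<bar>w x\<bar> \<partial>lborel) + ennreal ((1 + M) * R) * (\<integral>\<^sup>+x\<in>D. ennreal (norm (G x)) \<partial>lborel))"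
proof -
  have [measurable]: "w \<in> borel_measurable borel" "G \<in> borel_measurable borel" using C1_gradientD[OF w] by auto
  have [measurable]: "A \<in> sets borel" by simp
  have "(\<integral>\<^sup>+x\<in>A. ennreal \<bar>w x\<bar> \<partial>HM) = (\<integral>\<^sup>+x\<in>A. ennreal \<bar>w x\<bar> * indicator A x \<partial>HM)"
    by (intro nn_integral_cong) (auto simp: indicator_def)
  also have "\<dots> = (\<integral>\<^sup>+x. ennreal \<bar>w x\<bar> * indicator A x \<partial>HA)"
    by (rule nn_integral_HA[symmetric]) measurable
  also have "\<dots> \<le> (\<integral>\<^sup>+x. ennreal \<bar>w x\<bar> * indicator A x \<partial>scale_measure (ennreal C_tr) \<nu>)"
    by (intro nn_integral_mono_measure HA_le) (simp add: HA_def)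
  also have "\<dots> = ennreal C_tr * (\<integral>\<^sup>+x. ennreal \<bar>w x\<bar> * indicator A x \<partial>\<nu>)"
    by (intro nn_integral_scale_measure) measurable
  also have "(\<integral>\<^sup>+x. ennreal \<bar>w x\<bar> * indicator A x \<partial>\<nu>) = (\<integral>\<^sup>+x\<in>D. ennreal \<bar>w (\<pi> x)\<bar> * indicator A (\<pi> x) \<partial>lborel)"
    by (rule nn_integral_\<nu>) measurable
  also have "\<dots> \<le> (\<integral>\<^sup>+x. ennreal \<bar>w x\<bar> * indicator D x + ennreal \<bar>w (\<pi> x) - w x\<bar> * indicator (D \<inter> \<pi> -` A) x \<partial>lborel)"
    by (intro nn_integral_mono)
      (auto simp: indicator_def ennreal_plus[symmetric] simp del: ennreal_plus intro!: ennreal_leI)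
  also have "\<dots> = (\<integral>\<^sup>+x\<in>D. ennreal \<bar>w x\<bar> \<partial>lborel) + (\<integral>\<^sup>+x. ennreal \<bar>w (\<pi> x) - w x\<bar> * indicator (D \<inter> \<pi> -` A) x \<partial>lborel)"
    by (rule nn_integral_add) (use measurable_sets[OF \<pi>_measurable, of A] D_sets in auto)
  also have "(\<integral>\<^sup>+x. ennreal \<bar>w (\<pi> x) - w x\<bar> * indicator (D \<inter> \<pi> -` A) x \<partial>lborel) \<le>
      ennreal ((1 + M) * R) * (\<integral>\<^sup>+x\<in>D. ennreal (norm (G x)) \<partial>lborel)"
  proof (rule nn_integral_le_line_integrals[where e="- e"])
    fix x
    show "ennreal \<bar>w (\<pi> x) - w x\<bar> * indicator (D \<inter> \<pi> -` A) x \<le>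
      (\<integral>\<^sup>+t. ennreal (norm (G (x + t *\<^sub>R - e))) * indicator D (x + t *\<^sub>R - e) * indicator {0<..<(1 + M) * R} t \<partial>lborel)"
    proof (cases "x \<in> D \<inter> \<pi> -` A")
      case True
      define \<tau> where "\<tau> = x \<bullet> e - \<gamma> x"
      have \<tau>: "0 < \<tau>" "\<tau> \<le> (1 + M) * R" using height_bound[of x] True by (auto simp: \<tau>_def)
      have px: "\<pi> x = x + \<tau> *\<^sub>R - e" using \<pi>_eq[of x] unfolding \<tau>_def by (simp add: algebra_simps)
      have pball: "\<pi> x \<in> ball x0 R" "x \<in> ball x0 R" using True R by auto
      \<comment> \<open>Both ends of the segment lie in the chart ball, \<open>\<pi> x\<close>
        because it belongs to \<open>A\<close>, and the ball is convex; the graph is met only at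
        \<open>t = \<tau>\<close>.\<close>
      have inD: "x + t *\<^sub>R - e \<in> D" if t: "0 < t" "t < \<tau>" for t
      proof -
        have "x + t *\<^sub>R - e = (1 - t / \<tau>) *\<^sub>R x + (t / \<tau>) *\<^sub>R \<pi> x"
          using \<tau>(1) unfolding px by (simp add: algebra_simps)
        also have "\<dots> \<in> ball x0 R"
          using convexD[OF convex_ball pball(2,1), of "1 - t / \<tau>" "t / \<tau>"] t \<tau>(1) by simp
        finally have "x + t *\<^sub>R - e \<in> ball x0 R" .
        moreover have "\<gamma> (x + t *\<^sub>R - e) < (x + t *\<^sub>R - e) \<bullet> e"
          using \<gamma>_shift[of x "- t"] t by (simp add: inner_diff_left ee \<tau>_def)
        ultimately show ?thesis unfolding graph by simp
      qed
      have "ennreal \<bar>w (\<pi> x) - w x\<bar> \<le> (\<integral>\<^sup>+t\<in>{0<..<\<tau>}. ennreal (norm (G (x + t *\<^sub>R - e))) \<partial>lborel)"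
        unfolding px using e \<tau>(1) by (intro abs_diff_le_line_integral[OF w]) auto
      also have "\<dots> \<le> (\<integral>\<^sup>+t. ennreal (norm (G (x + t *\<^sub>R - e))) * indicator D (x + t *\<^sub>R - e) * indicator {0<..<(1 + M) * R} t \<partial>lborel)"
      proof (rule nn_integral_mono)
        fix t
        show "ennreal (norm (G (x + t *\<^sub>R - e))) * indicator {0<..<\<tau>} t \<le>
          ennreal (norm (G (x + t *\<^sub>R - e))) * indicator D (x + t *\<^sub>R - e) * indicator {0<..<(1 + M) * R} t"
          using inD[of t] \<tau>(2) by (cases "t \<in> {0<..<\<tau>}") auto
      qed
      finally show ?thesis using True by simp
    qed simp
  qed (use M R D_sets in auto)
  finally show ?thesis by (simp add: mult_left_mono)
qed

end

text \<open>Hoelder continuity bounds \<Gamma> on the ball, and convexity of the ball turns this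
  into a Lipschitz bound for \<gamma>. The radius can be made as small as desired, so that estimates
  can be confined to a prescribed neighbourhood of \<open>x0\<close>.\<close>

lemma C1_Hoelder_boundary_chart:
  fixes \<Omega> :: "'a::euclidean_space set"
  assumes "2 \<le> DIM('a)" "open \<Omega>" "0 < \<epsilon>" "C1_Hoelder_boundary \<epsilon> \<Omega>" "x0 \<in> frontier \<Omega>" "0 < R0"
  obtains R e \<gamma> M where "R \<le> R0" "boundary_chart \<Omega> x0 R e \<gamma> M (real DIM('a) - 1)"
proof -
  from assms(4,5) obtain r e \<gamma> \<Gamma> C where r: "0 < r" and e: "norm e = 1"
    and shift: "\<And>x t. \<gamma> (x + t *\<^sub>R e) = \<gamma> x"
    and deriv: "\<And>x. (\<gamma> has_derivative (\<lambda>h. \<Gamma> x \<bullet> h)) (at x)"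
    and hoelder: "\<And>x y. norm (\<Gamma> x - \<Gamma> y) \<le> C * dist x y powr \<epsilon>"
    and graph: "\<Omega> \<inter> ball x0 r = {x \<in> ball x0 r. \<gamma> x < x \<bullet> e}"
    unfolding C1_Hoelder_boundary_def by (elim ballE exE conjE) blast+
  define M where "M = norm (\<Gamma> x0) + \<bar>C\<bar> * r powr \<epsilon>"
  have bound: "norm (\<Gamma> x) \<le> M" if "x \<in> ball x0 r" for x
  proof -
    have "norm (\<Gamma> x) \<le> norm (\<Gamma> x0) + norm (\<Gamma> x - \<Gamma> x0)" by (rule norm_triangle_sub)
    also have "norm (\<Gamma> x - \<Gamma> x0) \<le> \<bar>C\<bar> * dist x x0 powr \<epsilon>"
      using hoelder[of x x0] by (rule order_trans) (intro mult_right_mono, auto)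
    also have "\<dots> \<le> \<bar>C\<bar> * r powr \<epsilon>"
      using that assms(3) by (intro mult_left_mono powr_mono2) (auto simp: dist_commute)
    finally show ?thesis by (simp add: M_def)
  qed
  have lip: "\<bar>\<gamma> x - \<gamma> y\<bar> \<le> M * dist x y" if "x \<in> ball x0 r" "y \<in> ball x0 r" for x y
  proof -
    have "norm (\<gamma> x - \<gamma> y) \<le> M * norm (x - y)"
    proof (rule differentiable_bound[OF convex_ball _ _ that])
      fix z assume z: "z \<in> ball x0 r"
      show "(\<gamma> has_derivative (\<lambda>h. \<Gamma> z \<bullet> h)) (at z within ball x0 r)"
        using deriv by (rule has_derivative_at_withinI)
      show "onorm (\<lambda>h. \<Gamma> z \<bullet> h) \<le> M"
      proof (rule onorm_le)
        fix h
        have "norm (\<Gamma> z \<bullet> h) \<le> norm (\<Gamma> z) * norm h" using Cauchy_Schwarz_ineq2 by simp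
        also have "\<dots> \<le> M * norm h" using bound[OF z] by (intro mult_right_mono) auto
        finally show "norm (\<Gamma> z \<bullet> h) \<le> M * norm h" .
      qed
    qed
    then show ?thesis by (simp add: dist_norm)
  qed
  define R where "R = min r R0"
  have R: "0 < R" "R \<le> r" "R \<le> R0" using r assms(6) by (auto simp: R_def)
  have graphR: "\<Omega> \<inter> ball x0 R = {x \<in> ball x0 R. \<gamma> x < x \<bullet> e}"
  proof -
    have "\<Omega> \<inter> ball x0 R = (\<Omega> \<inter> ball x0 r) \<inter> ball x0 R" using R by auto
    also have "\<dots> = {x \<in> ball x0 R. \<gamma> x < x \<bullet> e}" unfolding graph using R by auto
    finally show ?thesis .
  qed
  have "boundary_chart \<Omega> x0 R e \<gamma> M (real DIM('a) - 1)"
  proof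
    show "continuous_on UNIV \<gamma>"
      by (intro continuous_at_imp_continuous_on ballI has_derivative_continuous[OF deriv])
    show "0 \<le> M" by (simp add: M_def)
    show "\<bar>\<gamma> x - \<gamma> y\<bar> \<le> M * dist x y" if "x \<in> ball x0 R" "y \<in> ball x0 R" for x y
      using that R by (intro lip) auto
  qed (use assms R e shift graphR in auto)
  with R show thesis by (intro that)
qed

section \<open>The surface measure and the local trace inequality\<close>

lemma sets_surface_measure:
  fixes \<Omega> :: "'a::euclidean_space set"
  assumes "B \<in> sets borel" "B \<subseteq> frontier \<Omega>"
  shows "B \<in> sets (surface_measure \<Omega>)"
proof -
  have "B \<in> sets (hausdorff_measure (real DIM('a) - 1))"
    using assms(1) DIM_ge_Suc0[where 'a='a] by (intro borel_subset_sets_hausdorff_measure) auto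
  then show ?thesis
    unfolding surface_measure_def sets_restrict_space using assms(2) by (auto intro!: image_eqI[of _ _ B])
qed

lemma frontier_sets_hausdorff:
  fixes \<Omega> :: "'a::euclidean_space set"
  shows "frontier \<Omega> \<inter> space (hausdorff_measure (real DIM('a) - 1) :: 'a measure) \<in> sets (hausdorff_measure (real DIM('a) - 1))"
  using DIM_ge_Suc0[where 'a='a] by (auto intro!: borel_subset_sets_hausdorff_measure)

lemma space_surface_measure: "space (surface_measure \<Omega>) = frontier \<Omega>"
  by (simp add: surface_measure_def space_restrict_space)

lemma emeasure_surface_measure:
  fixes \<Omega> :: "'a::euclidean_space set"
  assumes "B \<subseteq> frontier \<Omega>"
  shows "emeasure (surface_measure \<Omega>) B = emeasure (hausdorff_measure (real DIM('a) - 1)) B"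
  unfolding surface_measure_def using assms by (intro emeasure_restrict_space frontier_sets_hausdorff)

lemma set_nn_integral_surface_measure:
  fixes \<Omega> :: "'a::euclidean_space set"
  assumes "B \<subseteq> frontier \<Omega>"
  shows "(\<integral>\<^sup>+x\<in>B. f x \<partial>surface_measure \<Omega>) = (\<integral>\<^sup>+x\<in>B. f x \<partial>hausdorff_measure (real DIM('a) - 1))"
  unfolding surface_measure_def nn_integral_restrict_space[OF frontier_sets_hausdorff]
  using assms by (intro nn_integral_cong) (auto simp: indicator_def)

lemma borel_measurable_surface_measure:
  fixes f :: "'a::euclidean_space \<Rightarrow> 'b::topological_space"
  assumes "f \<in> borel_measurable borel"
  shows "f \<in> borel_measurable (surface_measure \<Omega>)"
  unfolding surface_measure_def using DIM_ge_Suc0[where 'a='a]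
  by (intro measurable_restrict_space1 borel_measurable_hausdorff assms) auto

text \<open>The interior integrals extend only over \<open>ball x0 R0\<close>: a function small in
  that ball has a small trace near \<open>x0\<close>, whatever it does elsewhere.\<close>

lemma local_trace_inequality:
  fixes \<Omega> :: "'a::euclidean_space set"
  assumes "2 \<le> DIM('a)" "open \<Omega>" "0 < \<epsilon>" "C1_Hoelder_boundary \<epsilon> \<Omega>" "x0 \<in> frontier \<Omega>" "0 < R0"
  obtains \<rho> C K where "0 < \<rho>" "\<rho> \<le> R0"
    "emeasure (surface_measure \<Omega>) (frontier \<Omega> \<inter> cball x0 \<rho>) < \<infinity>"
    "0 < emeasure (surface_measure \<Omega>) (frontier \<Omega> \<inter> cball x0 \<rho>)"
    "\<And>w G. C1_gradient w G \<Longrightarrow>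
      (\<integral>\<^sup>+x\<in>frontier \<Omega> \<inter> cball x0 \<rho>. ennreal \<bar>w x\<bar> \<partial>surface_measure \<Omega>) \<le> ennreal C *
        ((\<integral>\<^sup>+x\<in>\<Omega> \<inter> ball x0 R0. ennreal \<bar>w x\<bar> \<partial>lborel) + ennreal K * (\<integral>\<^sup>+x\<in>\<Omega> \<inter> ball x0 R0. ennreal (norm (G x)) \<partial>lborel))"
proof -
  obtain R e \<gamma> M where R0: "R \<le> R0" and chart: "boundary_chart \<Omega> x0 R e \<gamma> M (real DIM('a) - 1)"
    by (rule C1_Hoelder_boundary_chart[OF assms])
  interpret boundary_chart \<Omega> x0 R e \<gamma> M "real DIM('a) - 1" by (rule chart)
  show thesis
  proof (rule that[of "R / 4" C_tr "(1 + M) * R"])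
    show "0 < R / 4" "R / 4 \<le> R0" using R R0 by auto
    show "emeasure (surface_measure \<Omega>) (frontier \<Omega> \<inter> cball x0 (R / 4)) < \<infinity>"
      using hausdorff_frontier_finite by (simp add: emeasure_surface_measure)
    show "0 < emeasure (surface_measure \<Omega>) (frontier \<Omega> \<inter> cball x0 (R / 4))"
      using hausdorff_frontier_pos[of "R / 4"] R by (simp add: emeasure_surface_measure)
    fix w :: "'a \<Rightarrow> real" and G assume w: "C1_gradient w G"
    have sub: "\<Omega> \<inter> ball x0 R \<subseteq> \<Omega> \<inter> ball x0 R0" using R0 by auto
    have "(\<integral>\<^sup>+x\<in>frontier \<Omega> \<inter> cball x0 (R / 4). ennreal \<bar>w x\<bar> \<partial>surface_measure \<Omega>) =
       (\<integral>\<^sup>+x\<in>frontier \<Omega> \<inter> cball x0 (R / 4). ennreal \<bar>w x\<bar> \<partial>hausdorff_measure (real DIM('a) - 1))"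
      by (rule set_nn_integral_surface_measure) simp
    also have "\<dots> \<le> ennreal C_tr *
      ((\<integral>\<^sup>+x\<in>\<Omega> \<inter> ball x0 R. ennreal \<bar>w x\<bar> \<partial>lborel) + ennreal ((1 + M) * R) * (\<integral>\<^sup>+x\<in>\<Omega> \<inter> ball x0 R. ennreal (norm (G x)) \<partial>lborel))"
      by (rule trace_inequality[OF w])
    also have "\<dots> \<le> ennreal C_tr *
      ((\<integral>\<^sup>+x\<in>\<Omega> \<inter> ball x0 R0. ennreal \<bar>w x\<bar> \<partial>lborel) + ennreal ((1 + M) * R) * (\<integral>\<^sup>+x\<in>\<Omega> \<inter> ball x0 R0. ennreal (norm (G x)) \<partial>lborel))"
      by (intro mult_left_mono add_mono set_nn_integral_mono_set sub) auto
    finally show "(\<integral>\<^sup>+x\<in>frontier \<Omega> \<inter> cball x0 (R / 4). ennreal \<bar>w x\<bar> \<partial>surface_measure \<Omega>) \<le> ennreal C_tr *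
      ((\<integral>\<^sup>+x\<in>\<Omega> \<inter> ball x0 R0. ennreal \<bar>w x\<bar> \<partial>lborel) + ennreal ((1 + M) * R) * (\<integral>\<^sup>+x\<in>\<Omega> \<inter> ball x0 R0. ennreal (norm (G x)) \<partial>lborel))" .
  qed
qed

lemma segment_condition_C1_Hoelder:
  fixes \<Omega> :: "'a::euclidean_space set"
  assumes "2 \<le> DIM('a)" "open \<Omega>" "0 < \<epsilon>" "C1_Hoelder_boundary \<epsilon> \<Omega>" "x0 \<in> frontier \<Omega>"
  shows "segment_condition \<Omega> x0"
proof -
  obtain R e \<gamma> M where "boundary_chart \<Omega> x0 R e \<gamma> M (real DIM('a) - 1)"
    using C1_Hoelder_boundary_chart[OF assms zero_less_one] by blast
  then show ?thesis by (rule boundary_chart.segment_condition)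
qed

lemma finite_surface_measure:
  fixes \<Omega> :: "'a::euclidean_space set"
  assumes "2 \<le> DIM('a)" "open \<Omega>" "bounded \<Omega>" "0 < \<epsilon>" "C1_Hoelder_boundary \<epsilon> \<Omega>"
  shows "finite_measure (surface_measure \<Omega>)"
proof
  let ?S = "surface_measure \<Omega>"
  have "\<forall>x\<in>frontier \<Omega>. \<exists>\<rho>>0. emeasure ?S (frontier \<Omega> \<inter> cball x \<rho>) < \<infinity>"
  proof
    fix x assume x: "x \<in> frontier \<Omega>"
    show "\<exists>\<rho>>0. emeasure ?S (frontier \<Omega> \<inter> cball x \<rho>) < \<infinity>"
      by (rule local_trace_inequality[OF assms(1,2,4,5) x zero_less_one]) blast
  qed
  from bchoice[OF this] obtain \<rho> where \<rho>: "\<And>x. x \<in> frontier \<Omega> \<Longrightarrow> 0 < \<rho> x"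
    "\<And>x. x \<in> frontier \<Omega> \<Longrightarrow> emeasure ?S (frontier \<Omega> \<inter> cball x (\<rho> x)) < \<infinity>" by blast
  have "compact (frontier \<Omega>)" using assms(3) by (rule compact_frontier_bounded)
  then obtain C where C: "C \<subseteq> frontier \<Omega>" "finite C" "frontier \<Omega> \<subseteq> (\<Union>x\<in>C. ball x (\<rho> x))"
    by (rule compactE_image[of _ "frontier \<Omega>" "\<lambda>x. ball x (\<rho> x)"]) (use \<rho>(1) in \<open>auto intro!: centre_in_ball[THEN iffD2]\<close>)
  have "emeasure ?S (space ?S) \<le> emeasure ?S (\<Union>x\<in>C. frontier \<Omega> \<inter> cball x (\<rho> x))"
    unfolding space_surface_measure
  proof (rule emeasure_mono)
    show "frontier \<Omega> \<subseteq> (\<Union>x\<in>C. frontier \<Omega> \<inter> cball x (\<rho> x))" using C(3) ball_subset_cball by blast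
    show "(\<Union>x\<in>C. frontier \<Omega> \<inter> cball x (\<rho> x)) \<in> sets ?S"
      using C(2) by (intro sets.finite_UN sets_surface_measure) auto
  qed
  also have "\<dots> \<le> (\<Sum>x\<in>C. emeasure ?S (frontier \<Omega> \<inter> cball x (\<rho> x)))"
    using C(2) by (intro emeasure_subadditive_finite) (auto intro: sets_surface_measure)
  also have "\<dots> < \<infinity>" using C(1,2) \<rho>(2) by auto
  finally show "emeasure ?S (space ?S) \<noteq> \<infinity>" by simp
qed

text \<open>Depending on whether \<open>b \<le> t * a\<close>, one of the two terms alone suffices.
  The weight \<open>t\<close> is free: a small \<open>t\<close> will be paired with gradients whose
  L^p integrals are of order \<open>t powr p\<close>.\<close>

lemma young_powr:
  fixes a b t p :: real
  assumes "0 \<le> a" "0 \<le> b" "0 < t" "1 < p"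
  shows "a powr (p - 1) * b \<le> t * a powr p + t powr (1 - p) * b powr p"
proof (cases "b \<le> t * a")
  case True
  have "a powr (p - 1) * b \<le> a powr (p - 1) * (t * a)" using True by (intro mult_left_mono) auto
  also have "\<dots> = t * a powr p" using assms by (cases "a = 0") (auto simp: powr_diff)
  also have "\<dots> \<le> t * a powr p + t powr (1 - p) * b powr p" by simp
  finally show ?thesis .
next
  case False
  moreover have "0 \<le> t * a" using assms by simp
  ultimately have b: "0 < b" by linarith
  have "a \<le> b / t" using False assms by (simp add: field_simps)
  then have "a powr (p - 1) * b \<le> (b / t) powr (p - 1) * b"
    using assms by (intro mult_right_mono powr_mono2) auto
  also have "\<dots> = t powr (1 - p) * b powr p"
    using b assms by (simp add: powr_divide powr_diff)
  also have "\<dots> \<le> t * a powr p + t powr (1 - p) * b powr p" using assms by simp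
  finally show ?thesis .
qed

lemma norm_gradient_abs_powr_le:
  assumes "0 < t" "1 < p"
  shows "norm ((p * (\<bar>u\<bar> powr (p - 1) * sgn u)) *\<^sub>R (g::'a::real_normed_vector)) \<le>
    p * t * \<bar>u\<bar> powr p + p * t powr (1 - p) * norm g powr p"
proof -
  have "norm ((p * (\<bar>u\<bar> powr (p - 1) * sgn u)) *\<^sub>R g) = p * (\<bar>u\<bar> powr (p - 1) * \<bar>sgn u\<bar> * norm g)"
    using assms by (simp add: abs_mult)
  also have "\<dots> \<le> p * (\<bar>u\<bar> powr (p - 1) * norm g)"
    using assms by (intro mult_left_mono mult_right_mono) (auto simp: abs_sgn_eq)
  also have "\<dots> \<le> p * (t * \<bar>u\<bar> powr p + t powr (1 - p) * norm g powr p)"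
    using assms by (intro mult_left_mono young_powr) auto
  finally show ?thesis by (simp add: algebra_simps)
qed


subsection \<open>Uniqueness of the weak gradient\<close>

text \<open>All derivatives are given at once as a sequence, so smoothness passes to the derivative
  by shifting the sequence and to affine substitutions by rescaling it.\<close>

definition smooth_real :: "(real \<Rightarrow> real) \<Rightarrow> bool" where
  "smooth_real g \<longleftrightarrow> (\<exists>D. D 0 = g \<and> (\<forall>k x. (D k has_real_derivative D (Suc k) x) (at x)))"

lemma smooth_realD:
  assumes "smooth_real g"
  obtains g' where "smooth_real g'" "\<And>x. (g has_real_derivative g' x) (at x)"
proof -
  obtain D where "D 0 = g" "\<And>k x. (D k has_real_derivative D (Suc k) x) (at x)"
    using assms by (auto simp: smooth_real_def)
  then show thesis
    by (intro that[of "D 1"]) (auto simp: smooth_real_def intro!: exI[of _ "\<lambda>k. D (Suc k)"])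
qed

lemma smooth_real_affine:
  assumes "smooth_real g" shows "smooth_real (\<lambda>x. g (a * x + b))"
proof -
  obtain D where D: "D 0 = g" "\<And>k x. (D k has_real_derivative D (Suc k) x) (at x)"
    using assms by (auto simp: smooth_real_def)
  have "((\<lambda>x. a ^ k * D k (a * x + b)) has_real_derivative a ^ Suc k * D (Suc k) (a * x + b)) (at x)" for k x
  proof -
    have "((\<lambda>x. a * x + b) has_real_derivative a) (at x)" by (auto intro!: derivative_eq_intros)
    from DERIV_cmult[OF DERIV_chain2[OF D(2) this], of "a ^ k"] show ?thesis by (simp add: mult_ac)
  qed
  with D(1) show ?thesis
    unfolding smooth_real_def by (intro exI[of _ "\<lambda>k x. a ^ k * D k (a * x + b)"]) simp
qed

text \<open>An algebra of functions closed under \<open>partial\<close>, hence contained in every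
  \<open>Ck k\<close> by induction on \<open>k\<close>. It contains the products of one-variable
  bumps in the coordinates.\<close>

inductive coordinate_smooth :: "('a::euclidean_space \<Rightarrow> real) \<Rightarrow> bool" where
  coord: "smooth_real g \<Longrightarrow> i \<in> Basis \<Longrightarrow> coordinate_smooth (\<lambda>x. g (x \<bullet> i))"
| const: "coordinate_smooth (\<lambda>x. c)"
| add: "coordinate_smooth f \<Longrightarrow> coordinate_smooth g \<Longrightarrow> coordinate_smooth (\<lambda>x. f x + g x)"
| mult: "coordinate_smooth f \<Longrightarrow> coordinate_smooth g \<Longrightarrow> coordinate_smooth (\<lambda>x. f x * g x)"

lemma partial_eqI: "(f has_derivative f') (at x) \<Longrightarrow> partial i f x = f' i"
  unfolding partial_def by (simp add: frechet_derivative_at[symmetric])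

lemma coordinate_smooth_partial:
  assumes "coordinate_smooth f"
  shows "(\<forall>x. f differentiable (at x)) \<and> coordinate_smooth (partial i f)"
  using assms
proof induction
  case (coord g j)
  obtain g' where g': "smooth_real g'" "\<And>x. (g has_real_derivative g' x) (at x)"
    using smooth_realD[OF coord(1)] by blast
  have d: "((\<lambda>x. g (x \<bullet> j)) has_derivative (\<lambda>h. g' (x \<bullet> j) * (h \<bullet> j))) (at x)" for x
    using has_derivative_compose[OF has_derivative_inner_left[OF has_derivative_ident]
        g'(2)[THEN has_field_derivative_imp_has_derivative], of j x UNIV] by simp
  have "partial i (\<lambda>x. g (x \<bullet> j)) = (\<lambda>x. g' (x \<bullet> j) * (i \<bullet> j))"
    using partial_eqI[OF d] by blast
  then show ?case
    using d coordinate_smooth.mult[OF coordinate_smooth.coord[OF g'(1) coord(2)] coordinate_smooth.const[of "i \<bullet> j"]]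
    by (auto simp: differentiable_def)
next
  case (const c)
  have "partial i (\<lambda>x. c) = (\<lambda>x. 0)"
    using partial_eqI[OF has_derivative_const] by blast
  then show ?case using coordinate_smooth.const[of 0] by auto
next
  case (add f g)
  have d: "((\<lambda>x. f x + g x) has_derivative (\<lambda>h. frechet_derivative f (at x) h + frechet_derivative g (at x) h)) (at x)" for x
    using add by (intro has_derivative_add) (auto simp: frechet_derivative_works[symmetric])
  have "partial i (\<lambda>x. f x + g x) = (\<lambda>x. partial i f x + partial i g x)"
    using partial_eqI[OF d] unfolding partial_def[symmetric] by blast
  then show ?case using add coordinate_smooth.add by auto
next
  case (mult f g)
  have d: "((\<lambda>x. f x * g x) has_derivative (\<lambda>h. f x * frechet_derivative g (at x) h + frechet_derivative f (at x) h * g x)) (at x)" for x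
    using mult by (intro has_derivative_mult) (auto simp: frechet_derivative_works[symmetric])
  have "partial i (\<lambda>x. f x * g x) = (\<lambda>x. f x * partial i g x + partial i f x * g x)"
    using partial_eqI[OF d] unfolding partial_def[symmetric] by blast
  then show ?case using mult coordinate_smooth.add coordinate_smooth.mult by auto
qed

lemma coordinate_smooth_imp_Ck: "coordinate_smooth f \<Longrightarrow> Ck k f"
proof (induction k arbitrary: f)
  case 0
  then show ?case
    using coordinate_smooth_partial[OF 0]
    by (auto intro!: continuous_at_imp_continuous_on differentiable_imp_continuous_within)
qed (use coordinate_smooth_partial in auto)

lemma coordinate_smooth_prod:
  "finite A \<Longrightarrow> (\<And>i. i \<in> A \<Longrightarrow> coordinate_smooth (f i)) \<Longrightarrow> coordinate_smooth (\<lambda>x. \<Prod>i\<in>A. f i x)"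
  by (induction A rule: finite_induct) (auto intro: coordinate_smooth.intros)

section \<open>Smooth approximations of the indicators of boxes\<close>

definition exp_bump :: "real \<Rightarrow> real" where
  "exp_bump x = (if x \<le> 0 then 0 else exp (- inverse x))"

lemma poly_div_exp_tendsto_0: "((\<lambda>y. poly q y / exp y) \<longlongrightarrow> (0::real)) at_top"
proof -
  have "((\<lambda>y. \<Sum>i\<le>degree q. coeff q i * (y ^ i / exp y)) \<longlongrightarrow> (\<Sum>i\<le>degree q. coeff q i * 0)) at_top"
    by (intro tendsto_intros tendsto_power_div_exp_0)
  then show ?thesis by (simp add: poly_altdef sum_divide_distrib)
qed

lemma poly_inverse_exp_tendsto_0:
  "((\<lambda>x. poly q (inverse x) * exp (- inverse x)) \<longlongrightarrow> (0::real)) (at_right 0)"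
  using filterlim_compose[OF poly_div_exp_tendsto_0[of q] filterlim_inverse_at_top_right]
  by (simp add: exp_minus divide_inverse)

lemma smooth_exp_bump: "smooth_real exp_bump"
proof -
  \<comment> \<open>The k-th derivative at positive \<open>x\<close> is
    \<open>poly (P k) y * exp (- y)\<close> with \<open>y = inverse x\<close>. Differentiating
    \<open>y\<close> gives \<open>- y\<^sup>2\<close>, whence the factor \<open>[:0, 0, 1:]\<close>
    and the sign of \<open>pderiv\<close>.\<close>
  define P :: "nat \<Rightarrow> real poly" where "P k = ((\<lambda>q. [:0, 0, 1:] * (q - pderiv q)) ^^ k) 1" for k
  define D where "D k x = (if x \<le> 0 then 0 else poly (P k) (inverse x) * exp (- inverse x))" for k and x :: real
  have P: "P 0 = 1" "P (Suc k) = [:0, 0, 1:] * (P k - pderiv (P k))" for k by (simp_all add: P_def)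
  have "(D k has_real_derivative D (Suc k) x) (at x)" for k x
  proof -
    consider "x < 0" | "x > 0" | "x = 0" by linarith
    then show ?thesis
    proof cases
      case 1
      have ev: "\<forall>\<^sub>F y in nhds x. D k y = 0"
        using eventually_nhds_in_open[of "{..<0}" x] 1 by (auto elim!: eventually_mono simp: D_def)
      show ?thesis
        using DERIV_cong_ev[OF refl ev refl, THEN iffD2, OF DERIV_const]
        by (rule DERIV_cong) (use 1 in \<open>simp add: D_def\<close>)
    next
      case 2
      have ev: "\<forall>\<^sub>F y in nhds x. D k y = poly (P k) (inverse y) * exp (- inverse y)"
        using eventually_nhds_in_open[of "{0<..}" x] 2 by (auto elim!: eventually_mono simp: D_def)
      have "((\<lambda>y. inverse y) has_real_derivative - (inverse x * inverse x)) (at x)"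
        using 2 DERIV_inverse'[OF DERIV_ident, of x UNIV] by simp
      from DERIV_mult[OF DERIV_chain2[OF poly_DERIV this] DERIV_chain2[OF DERIV_exp DERIV_minus[OF this]], of "P k"]
      have "((\<lambda>y. poly (P k) (inverse y) * exp (- inverse y)) has_real_derivative D (Suc k) x) (at x)"
        by (rule DERIV_cong) (use 2 in \<open>simp add: D_def P algebra_simps\<close>)
      with DERIV_cong_ev[OF refl ev refl] show ?thesis by (rule iffD2)
    next
      case 3
      have "((\<lambda>h. D k h / h) \<longlongrightarrow> 0) (at 0)"
      proof (rule filterlim_split_at)
        show "((\<lambda>h. D k h / h) \<longlongrightarrow> 0) (at_left 0)"
          by (rule Lim_transform_eventually[OF tendsto_const]) (auto simp: eventually_at_filter D_def)
        \<comment> \<open>Dividing by \<open>h\<close> multiplies the polynomial in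
          \<open>inverse h\<close> by its variable, which is \<open>pCons 0\<close>; the exponential
          still wins.\<close>
        show "((\<lambda>h. D k h / h) \<longlongrightarrow> 0) (at_right 0)"
          by (rule Lim_transform_eventually[OF poly_inverse_exp_tendsto_0[of "pCons 0 (P k)"]])
            (auto simp: eventually_at_filter D_def divide_inverse)
      qed
      then show ?thesis by (simp add: DERIV_def 3 D_def)
    qed
  qed
  moreover have "D 0 = exp_bump" by (auto simp: D_def exp_bump_def P fun_eq_iff)
  ultimately show ?thesis unfolding smooth_real_def by blast
qed

lemma exp_bump_bounds: "0 \<le> exp_bump x" "exp_bump x \<le> 1"
  by (auto simp: exp_bump_def)

lemma exp_bump_scaled_tendsto: "0 < x \<Longrightarrow> (\<lambda>n. exp_bump (real (Suc n) * x)) \<longlonglongrightarrow> 1"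
proof -
  assume "0 < x"
  then have "exp_bump (real (Suc n) * x) = exp (- (inverse (real (Suc n)) * inverse x))" for n
    by (simp add: exp_bump_def not_le mult_less_0_iff zero_less_mult_iff)
  moreover have "(\<lambda>n. exp (- (inverse (real (Suc n)) * inverse x))) \<longlonglongrightarrow> exp (- (0 * inverse x))"
    by (intro tendsto_exp tendsto_minus tendsto_mult tendsto_const LIMSEQ_inverse_real_of_nat)
  ultimately show ?thesis by simp
qed

text \<open>The scaling by \<open>Suc n\<close> steepens the flanks: inside the box every factor
  tends to 1, because \<open>exp_bump\<close> tends to 1 at infinity, while outside some factor is
  always 0.\<close>

definition box_bump :: "'a::euclidean_space \<Rightarrow> 'a \<Rightarrow> nat \<Rightarrow> 'a \<Rightarrow> real" where
  "box_bump a b n x = (\<Prod>i\<in>Basis. exp_bump (real (Suc n) * (x \<bullet> i - a \<bullet> i)) * exp_bump (real (Suc n) * (b \<bullet> i - x \<bullet> i)))"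

lemma box_bump_eq_0: "x \<notin> box a b \<Longrightarrow> box_bump a b n x = 0"
  by (force simp: box_bump_def mem_box exp_bump_def not_less mult_le_0_iff)

lemma box_bump_bounds: "0 \<le> box_bump a b n x" "box_bump a b n x \<le> 1"
  unfolding box_bump_def
  by (auto intro!: prod_nonneg prod_le_1 mult_nonneg_nonneg mult_le_one exp_bump_bounds)

lemma box_bump_tendsto: "(\<lambda>n. box_bump a b n x) \<longlonglongrightarrow> indicator (box a b) x"
proof (cases "x \<in> box a b")
  case True
  have "(\<lambda>n. box_bump a b n x) \<longlonglongrightarrow> (\<Prod>i\<in>(Basis::'a set). 1 * 1)"
    unfolding box_bump_def using True
    by (intro tendsto_prod tendsto_mult exp_bump_scaled_tendsto) (auto simp: mem_box)
  then show ?thesis using True by simp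
qed (simp add: box_bump_eq_0)

lemma test_function_box_bump:
  assumes "cbox a b \<subseteq> \<Omega>" shows "test_function \<Omega> (box_bump a b n)"
proof -
  have "coordinate_smooth (\<lambda>x. box_bump a b n x)"
    unfolding box_bump_def
  proof (intro coordinate_smooth_prod coordinate_smooth.mult finite_Basis)
    fix i :: 'a assume "i \<in> Basis"
    show "coordinate_smooth (\<lambda>x. exp_bump (real (Suc n) * (x \<bullet> i - a \<bullet> i)))"
      using coordinate_smooth.coord[OF smooth_real_affine[OF smooth_exp_bump, of "real (Suc n)" "- (real (Suc n) * (a \<bullet> i))"] \<open>i \<in> Basis\<close>]
      by (simp add: right_diff_distrib)
    show "coordinate_smooth (\<lambda>x. exp_bump (real (Suc n) * (b \<bullet> i - x \<bullet> i)))"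
      using coordinate_smooth.coord[OF smooth_real_affine[OF smooth_exp_bump, of "- real (Suc n)" "real (Suc n) * (b \<bullet> i)"] \<open>i \<in> Basis\<close>]
      by (simp add: right_diff_distrib algebra_simps)
  qed
  then have "Ck k (box_bump a b n)" for k by (simp add: coordinate_smooth_imp_Ck)
  moreover have "closure {x. box_bump a b n x \<noteq> 0} \<subseteq> cbox a b"
    using box_bump_eq_0[of _ a b n] box_subset_cbox[of a b] by (intro closure_minimal) auto
  moreover from this have "compact (closure {x. box_bump a b n x \<noteq> 0})"
    using compact_cbox[of a b] by (metis bounded_closure_image bounded_subset closed_closure compact_eq_bounded_closed)
  ultimately show ?thesis using assms unfolding test_function_def by blast
qed

text \<open>Boxes are stable under intersection and generate the Borel sets, so the integral of
  \<open>g\<close> vanishes over every Borel set; complements use the vanishing total integral. The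
  sets \<open>{x. 0 < s * g x}\<close> with \<open>s\<close> equal to 1 and -1 then dispose of the
  positive and the negative part.\<close>

lemma box_integrals_zero_imp_AE_zero:
  fixes g :: "'a::euclidean_space \<Rightarrow> real"
  assumes g: "integrable lborel g" and zero: "integral\<^sup>L lborel g = 0"
    and box: "\<And>c d. (LINT x:box c d|lborel. g x) = 0"
  shows "AE x in lborel. g x = 0"
proof -
  have [measurable]: "g \<in> borel_measurable borel" using g by (simp add: borel_measurable_integrable)
  have si: "set_integrable lborel A g" if "A \<in> sets borel" for A
    using g that unfolding set_integrable_def by (intro integrable_mult_indicator) auto
  have borel_zero: "(LINT x:A|lborel. g x) = 0" if "A \<in> sets borel" for A
  proof -
    let ?G = "range (\<lambda>(a, b). box a b :: 'a set)"
    have "Int_stable ?G" by (auto simp: Int_stable_def box_Int_box image_def) blast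
    moreover have "?G \<subseteq> Pow UNIV" by simp
    moreover have "A \<in> sigma_sets UNIV ?G"
      using that unfolding borel_eq_box by simp
    ultimately show ?thesis
    proof (induction rule: sigma_sets_induct_disjoint)
      case (basic A)
      then show ?case using box by auto
    next
      case empty
      then show ?case by (simp add: set_lebesgue_integral_def)
    next
      case (compl A)
      then have A: "A \<in> sets borel" unfolding borel_eq_box by simp
      have "(LINT x:UNIV|lborel. g x) = (LINT x:A|lborel. g x) + (LINT x:UNIV - A|lborel. g x)"
        using set_integral_Un[of A "UNIV - A" lborel g] si A by simp
      then show ?case using compl zero by (simp add: set_lebesgue_integral_def)
    next
      case (union A)
      have A: "A i \<in> sets lborel" for i
        unfolding sets_lborel borel_eq_box using union(2) by (subst sets_measure_of) auto
      have "(LINT x:(\<Union>i. A i)|lborel. g x) = (\<Sum>i. (LINT x:A i|lborel. g x))"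
        using A union(1) si by (intro lebesgue_integral_countable_add) (auto simp: disjoint_family_on_def)
      with union(3) show ?case by simp
    qed
  qed
  have "AE x in lborel. (s * g x) * indicator {x. 0 < s * g x} x = 0" for s :: real
  proof (subst integral_nonneg_eq_0_iff_AE[symmetric])
    have A: "{x. 0 < s * g x} \<in> sets borel" by measurable
    show "integrable lborel (\<lambda>x. (s * g x) * indicator {x. 0 < s * g x} x)"
      using A by (intro integrable_real_mult_indicator integrable_mult_right g) simp
    have "(LINT x|lborel. (s * g x) * indicator {x. 0 < s * g x} x) = s * (LINT x:{x. 0 < s * g x}|lborel. g x)"
      unfolding set_lebesgue_integral_def integral_mult_right_zero[symmetric]
      by (intro Bochner_Integration.integral_cong) auto
    with borel_zero[OF A] show "(LINT x|lborel. (s * g x) * indicator {x. 0 < s * g x} x) = 0" by simp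
  qed (auto simp: indicator_def)
  from this[of 1] this[of "-1"] show ?thesis
    by eventually_elim (auto simp: indicator_def split: if_splits)
qed

text \<open>The fundamental lemma of the calculus of variations. Testing with
  \<open>box_bump\<close> and dominated convergence give vanishing integrals over all boxes with
  \<open>cbox a b \<subseteq> \<Omega>\<close>, and countably many such closed boxes exhaust
  \<Omega>.\<close>

lemma AE_zero_if_test_integrals_zero:
  fixes f :: "'a::euclidean_space \<Rightarrow> real"
  assumes "open \<Omega>" and f: "locally_integrable \<Omega> f"
    and test: "\<And>\<phi>. test_function \<Omega> \<phi> \<Longrightarrow> (LINT x|lebesgue_on \<Omega>. f x * \<phi> x) = 0"
  shows "AE x in lebesgue_on \<Omega>. f x = 0"
proof -
  have \<Omega>: "\<Omega> \<in> sets lebesgue" using \<open>open \<Omega>\<close> by (simp add: borel_open)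
  have int_cbox: "integrable lebesgue (\<lambda>x. indicator (cbox a b) x * f x)" if "cbox a b \<subseteq> \<Omega>" for a b
    using f that unfolding locally_integrable_def
    by (auto simp: integrable_restrict_space dest!: spec[of _ "cbox a b"])
  have int_box: "(LINT x|lebesgue. indicator (box a b) x * f x) = 0" if sub: "cbox a b \<subseteq> \<Omega>" for a b
  proof -
    have Fm: "(\<lambda>x. indicator (cbox a b) x * f x) \<in> borel_measurable lebesgue"
      using int_cbox[OF sub] by (rule borel_measurable_integrable)
    have bm: "box_bump a b n \<in> borel_measurable lebesgue" for n
      using test_function_box_bump[OF sub, of n]
      by (auto simp: test_function_def intro!: measurable_completion borel_measurable_continuous_onI dest: spec[of _ 0])
    have "(\<lambda>n. LINT x|lebesgue. (indicator (cbox a b) x * f x) * box_bump a b n x) \<longlonglongrightarrow>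
      (LINT x|lebesgue. (indicator (cbox a b) x * f x) * indicator (box a b) x)"
    proof (rule integral_dominated_convergence[where w="\<lambda>x. norm (indicator (cbox a b) x * f x)"])
      show "integrable lebesgue (\<lambda>x. norm (indicator (cbox a b) x * f x))"
        using int_cbox[OF sub] by (rule integrable_norm)
      show "AE x in lebesgue. (\<lambda>n. (indicator (cbox a b) x * f x) * box_bump a b n x) \<longlonglongrightarrow>
          (indicator (cbox a b) x * f x) * indicator (box a b) x"
        by (intro AE_I2 tendsto_mult tendsto_const box_bump_tendsto)
      show "AE x in lebesgue. norm ((indicator (cbox a b) x * f x) * box_bump a b n x) \<le> norm (indicator (cbox a b) x * f x)" for n
        using box_bump_bounds[of a b n] by (intro AE_I2) (auto simp: abs_mult intro!: mult_left_le)
      show "(\<lambda>x. (indicator (cbox a b) x * f x) * box_bump a b n x) \<in> borel_measurable lebesgue" for n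
        by (rule borel_measurable_times[OF Fm bm])
      show "(\<lambda>x. (indicator (cbox a b) x * f x) * indicator (box a b) x) \<in> borel_measurable lebesgue"
        by (rule borel_measurable_times[OF Fm borel_measurable_indicator]) simp
    qed
    moreover have "(LINT x|lebesgue. (indicator (cbox a b) x * f x) * box_bump a b n x) = 0" for n
    proof -
      have "(LINT x|lebesgue. (indicator (cbox a b) x * f x) * box_bump a b n x) =
          (LINT x|lebesgue. indicator \<Omega> x *\<^sub>R (f x * box_bump a b n x))"
        using sub box_subset_cbox[of a b] box_bump_eq_0[of _ a b n]
        by (intro Bochner_Integration.integral_cong) (auto simp: indicator_def)
      also have "\<dots> = 0"
        using test[OF test_function_box_bump[OF sub]] \<Omega> by (simp add: integral_restrict_space)
      finally show ?thesis .
    qed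
    ultimately have "(LINT x|lebesgue. (indicator (cbox a b) x * f x) * indicator (box a b) x) = 0"
      using LIMSEQ_unique[OF _ tendsto_const] by auto
    also have "(\<lambda>x. (indicator (cbox a b) x * f x) * indicator (box a b) x) = (\<lambda>x. indicator (box a b) x * f x)"
      using box_subset_cbox[of a b] by (auto simp: indicator_def fun_eq_iff)
    finally show ?thesis .
  qed
  have AE_cbox: "AE x in lebesgue. x \<in> cbox a b \<longrightarrow> f x = 0" if sub: "cbox a b \<subseteq> \<Omega>" for a b
  proof -
    define F where "F x = indicator (box a b) x * f x" for x
    have F_eq: "F x = (indicator (cbox a b) x * f x) * indicator (box a b) x" for x
      using box_subset_cbox[of a b] by (auto simp: indicator_def F_def)
    have F: "integrable lebesgue F"
      unfolding F_eq[abs_def] by (intro integrable_real_mult_indicator int_cbox sub) auto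
    \<comment> \<open>\<open>F\<close> is only Lebesgue measurable; a Borel version is needed
      because the argument by generators concerns Borel sets.\<close>
    then obtain g where g[measurable]: "g \<in> borel_measurable lborel" and Fg: "AE x in lborel. F x = g x"
      using completion_ex_borel_measurable_real[of F lborel] by (auto dest: borel_measurable_integrable)
    have Fg': "AE x in lebesgue. F x = g x" using Fg by (rule AE_completion)
    have gl: "g \<in> borel_measurable lebesgue" using g by (rule measurable_completion)
    have Fl: "F \<in> borel_measurable lebesgue" using F by (rule borel_measurable_integrable)
    have "integrable lebesgue g" using F integrable_cong_AE[OF Fl gl Fg'] by simp
    then have gi: "integrable lborel g" using integrable_completion[OF g] by simp
    have set_int: "(LINT x|lborel. indicator A x * g x) = (LINT x|lebesgue. indicator A x * F x)"
      if A: "A \<in> sets borel" for A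
    proof -
      have "(LINT x|lborel. indicator A x * g x) = (LINT x|lebesgue. indicator A x * g x)"
        using A by (intro integral_completion[symmetric]) auto
      also have "\<dots> = (LINT x|lebesgue. indicator A x * F x)"
        using A gl Fl Fg' by (intro integral_cong_AE) (auto intro!: borel_measurable_times borel_measurable_indicator)
      finally show ?thesis .
    qed
    have box_F: "(LINT x|lebesgue. indicator (box c d) x * F x) = 0" for c d
    proof -
      obtain p q where pq: "box c d \<inter> box a b = box p q" using box_Int_box[of c d a b] by blast
      have "(LINT x|lebesgue. indicator (box c d) x * F x) = (LINT x|lebesgue. indicator (box p q) x * f x)"
        unfolding pq[symmetric] by (intro Bochner_Integration.integral_cong) (auto simp: F_def indicator_def)
      also have "\<dots> = 0"
      proof (cases "box p q = {}")
        case False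
        have "cbox p q = closure (box p q)" using False by (simp add: closure_box)
        also have "\<dots> \<subseteq> cbox a b" using pq box_subset_cbox[of a b] by (intro closure_minimal) auto
        finally show ?thesis using sub by (intro int_box) auto
      qed simp
      finally show ?thesis .
    qed
    have "AE x in lborel. g x = 0"
    proof (rule box_integrals_zero_imp_AE_zero[OF gi])
      show "integral\<^sup>L lborel g = 0"
        using set_int[of UNIV] int_box[OF sub] by (simp add: F_def[abs_def])
      show "(LINT x:box c d|lborel. g x) = 0" for c d
        using set_int[of "box c d"] box_F[of c d] by (simp add: set_lebesgue_integral_def)
    qed
    then have "AE x in lebesgue. g x = 0" by (rule AE_completion)
    \<comment> \<open>\<open>F\<close> sees only the open box; its faces form a null set.\<close>
    moreover have "AE x in lebesgue. x \<notin> cbox a b - box a b"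
      using negligible_frontier_interval[of a b] by (intro AE_not_in) (simp add: negligible_iff_null_sets)
    ultimately show ?thesis using Fg' by eventually_elim (auto simp: F_def indicator_def split: if_splits)
  qed
  obtain \<D> where D: "countable \<D>" "\<D> \<subseteq> Pow \<Omega>" "\<And>X. X \<in> \<D> \<Longrightarrow> \<exists>a b. X = cbox a b" "\<Union>\<D> = \<Omega>"
    using open_countable_Union_open_cbox[OF \<open>open \<Omega>\<close>] by blast
  have "AE x in lebesgue. \<forall>X\<in>\<D>. x \<in> X \<longrightarrow> f x = 0"
  proof (subst AE_ball_countable[OF D(1)], rule ballI)
    fix X assume "X \<in> \<D>"
    then obtain a b where "X = cbox a b" "cbox a b \<subseteq> \<Omega>" using D by blast
    then show "AE x in lebesgue. x \<in> X \<longrightarrow> f x = 0" using AE_cbox by simp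
  qed
  then have "AE x in lebesgue. x \<in> \<Omega> \<longrightarrow> f x = 0"
    by eventually_elim (use D(4) in blast)
  then show ?thesis using \<Omega> by (simp add: AE_restrict_space_iff)
qed

text \<open>The difference quotients of \<open>\<psi>\<close> integrate to zero by translation invariance.\<close>

lemma integral_gradient_compact_support:
  fixes \<psi> :: "'a::euclidean_space \<Rightarrow> real"
  assumes \<psi>: "C1_gradient \<psi> \<Gamma>" and supp: "\<And>x. R < norm x \<Longrightarrow> \<psi> x = 0"
  shows "(LINT x|lborel. \<Gamma> x \<bullet> i) = 0"
proof -
  have cont: "continuous_on UNIV \<psi>" and [measurable]: "\<psi> \<in> borel_measurable borel" "\<Gamma> \<in> borel_measurable borel"
    using C1_gradientD[OF \<psi>] by auto
  have \<Gamma>0: "\<Gamma> x = 0" if "R < norm x" for x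
  proof (rule C1_gradient_eq_0[OF \<psi>])
    show "open {x. R < norm x}" by (intro open_Collect_less continuous_intros)
  qed (use that supp in auto)
  obtain B where B: "\<And>x. norm (\<Gamma> x) \<le> B"
  proof -
    have "compact (\<Gamma> ` cball 0 R)"
      using continuous_on_subset[OF C1_gradientD(2)[OF \<psi>]] by (intro compact_continuous_image) auto
    then obtain B where "0 < B" "\<And>x. x \<in> cball 0 R \<Longrightarrow> norm (\<Gamma> x) \<le> B"
      using compact_imp_bounded bounded_pos by (metis (no_types, lifting) imageI)
    then show thesis using \<Gamma>0 by (intro that[of B]) (metis linorder_not_le mem_cball_0 less_imp_le norm_zero)
  qed
  have lip: "\<bar>\<psi> x - \<psi> y\<bar> \<le> B * norm (x - y)" for x y
  proof -
    have "norm (\<psi> x - \<psi> y) \<le> B * norm (x - y)"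
    proof (rule differentiable_bound[of UNIV])
      fix z
      show "(\<psi> has_derivative (\<lambda>h. \<Gamma> z \<bullet> h)) (at z within UNIV)" using C1_gradientD(1)[OF \<psi>] by simp
      show "onorm (\<lambda>h. \<Gamma> z \<bullet> h) \<le> B"
        using B by (intro onorm_le) (metis Cauchy_Schwarz_ineq2 mult_right_mono norm_ge_zero order_trans real_norm_def)
    qed auto
    then show ?thesis by simp
  qed
  have \<psi>_int: "integrable lborel \<psi>"
  proof -
    have "integrable lborel (\<lambda>x. indicator (cball 0 R) x *\<^sub>R \<psi> x)"
      using cont by (intro borel_integrable_compact) (auto intro: continuous_on_subset)
    also have "(\<lambda>x. indicator (cball 0 R) x *\<^sub>R \<psi> x) = \<psi>"
      using supp by (auto simp: indicator_def fun_eq_iff not_le)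
    finally show ?thesis .
  qed
  define \<delta> where "\<delta> n = inverse (real (Suc n))" for n
  have \<delta>: "0 < \<delta> n" "\<delta> n \<le> 1" for n by (auto simp: \<delta>_def field_simps)
  have \<delta>0: "\<delta> \<longlonglongrightarrow> 0" unfolding \<delta>_def by (rule LIMSEQ_inverse_real_of_nat)
  define q where "q n x = (\<psi> (\<delta> n *\<^sub>R i + x) - \<psi> x) / \<delta> n" for n x
  have "(\<lambda>n. integral\<^sup>L lborel (q n)) \<longlonglongrightarrow> (LINT x|lborel. \<Gamma> x \<bullet> i)"
  \<comment> \<open>The Lipschitz bound controls the quotients by \<open>B * norm i\<close>, and
    since the steps \<open>\<delta> n\<close> are at most 1 they vanish outside the ball enlarged by
    \<open>norm i\<close>.\<close>
  proof (rule integral_dominated_convergence[where w="\<lambda>x. indicator (cball 0 (\<bar>R\<bar> + norm i)) x *\<^sub>R (B * norm i)"])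
    show "integrable lborel (\<lambda>x. indicator (cball 0 (\<bar>R\<bar> + norm i)) x *\<^sub>R (B * norm i))"
      by (intro borel_integrable_compact) auto
    show "AE x in lborel. (\<lambda>n. q n x) \<longlonglongrightarrow> \<Gamma> x \<bullet> i"
    proof (rule AE_I2)
      fix x
      have "((\<lambda>t. \<psi> (t *\<^sub>R i + x)) has_derivative (\<lambda>h. \<Gamma> (0 *\<^sub>R i + x) \<bullet> (h *\<^sub>R i))) (at 0)"
        by (rule has_derivative_compose[OF _ C1_gradientD(1)[OF \<psi>]]) (auto intro!: derivative_eq_intros)
      then have "((\<lambda>t. \<psi> (t *\<^sub>R i + x)) has_real_derivative \<Gamma> x \<bullet> i) (at 0)"
        by (simp add: has_field_derivative_def mult.commute[of _ "\<Gamma> x \<bullet> i"])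
      then have "((\<lambda>h. (\<psi> (h *\<^sub>R i + x) - \<psi> x) / h) \<longlongrightarrow> \<Gamma> x \<bullet> i) (at 0)"
        by (simp add: DERIV_def)
      moreover have "filterlim \<delta> (at 0) sequentially"
        using \<delta>0 \<delta>(1) by (auto simp: filterlim_at intro!: always_eventually less_imp_neq[symmetric])
      ultimately show "(\<lambda>n. q n x) \<longlonglongrightarrow> \<Gamma> x \<bullet> i"
        unfolding q_def by (rule filterlim_compose)
    qed
    show "AE x in lborel. norm (q n x) \<le> indicator (cball 0 (\<bar>R\<bar> + norm i)) x *\<^sub>R (B * norm i)" for n
    proof (rule AE_I2)
      fix x
      show "norm (q n x) \<le> indicator (cball 0 (\<bar>R\<bar> + norm i)) x *\<^sub>R (B * norm i)"
      proof (cases "x \<in> cball 0 (\<bar>R\<bar> + norm i)")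
        case True
        have "\<bar>\<psi> (\<delta> n *\<^sub>R i + x) - \<psi> x\<bar> \<le> B * (\<delta> n * norm i)"
          using lip[of "\<delta> n *\<^sub>R i + x" x] \<delta>(1)[of n] by simp
        then show ?thesis using True \<delta>(1)[of n] by (simp add: q_def field_simps)
      next
        case False
        then have "\<bar>R\<bar> + norm i < norm x" by simp
        moreover have "norm (\<delta> n *\<^sub>R i) \<le> norm i" using \<delta>[of n] by (simp add: mult_left_le_one_le)
        moreover have "norm x \<le> norm (\<delta> n *\<^sub>R i + x) + norm (\<delta> n *\<^sub>R i)"
          using norm_triangle_ineq4[of "\<delta> n *\<^sub>R i + x" "\<delta> n *\<^sub>R i"] by simp
        ultimately have "R < norm x" "R < norm (\<delta> n *\<^sub>R i + x)" using norm_ge_zero[of i] by linarith+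
        then show ?thesis using supp False by (simp add: q_def)
      qed
    qed
  qed (auto simp: q_def[abs_def])
  moreover have "integral\<^sup>L lborel (q n) = 0" for n
  proof -
    have "integrable lborel (\<lambda>x. \<psi> (\<delta> n *\<^sub>R i + x))"
      using \<psi>_int integrable_distr_eq[of "(+) (\<delta> n *\<^sub>R i)" lborel borel \<psi>] by (simp add: lborel_distr_plus)
    moreover have "(LINT x|lborel. \<psi> (\<delta> n *\<^sub>R i + x)) = integral\<^sup>L lborel \<psi>"
      using integral_distr[of "(+) (\<delta> n *\<^sub>R i)" lborel borel \<psi>] by (simp add: lborel_distr_plus)
    ultimately show ?thesis using \<psi>_int by (simp add: q_def[abs_def])
  qed
  ultimately show ?thesis using LIMSEQ_unique[OF _ tendsto_const] by auto
qed

section \<open>Weak gradients of continuously differentiable functions\<close>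

lemma integrable_compact_support:
  fixes f :: "'a::euclidean_space \<Rightarrow> 'b::euclidean_space"
  assumes "continuous_on UNIV f" "compact K" "\<And>x. x \<notin> K \<Longrightarrow> f x = 0"
  shows "integrable lborel f"
proof -
  have "integrable lborel (\<lambda>x. indicator K x *\<^sub>R f x)"
    using assms by (intro borel_integrable_compact) (auto intro: continuous_on_subset)
  also have "(\<lambda>x. indicator K x *\<^sub>R f x) = f"
    using assms(3) by (auto simp: indicator_def fun_eq_iff)
  finally show ?thesis .
qed

lemma continuous_imp_locally_integrable:
  fixes f :: "'a::euclidean_space \<Rightarrow> 'b::euclidean_space"
  assumes "continuous_on UNIV f" shows "locally_integrable \<Omega> f"
  unfolding locally_integrable_def
proof (intro allI impI)
  fix K assume "compact K \<and> K \<subseteq> \<Omega>"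
  then have K: "compact K" "K \<in> sets borel" by (auto simp: compact_imp_closed)
  have "integrable lborel (\<lambda>x. indicator K x *\<^sub>R f x)"
    using assms K by (intro borel_integrable_compact) (auto intro: continuous_on_subset)
  then have "integrable lebesgue (\<lambda>x. indicator K x *\<^sub>R f x)"
    using integrable_completion[of "\<lambda>x. indicator K x *\<^sub>R f x" lborel] by (auto dest: borel_measurable_integrable)
  then show "integrable (lebesgue_on K) f" using K by (simp add: integrable_restrict_space)
qed

lemma integral_lebesgue_on_supported:
  fixes f :: "'a::euclidean_space \<Rightarrow> real"
  assumes "\<Omega> \<in> sets borel" "continuous_on UNIV f" "\<And>x. x \<notin> \<Omega> \<Longrightarrow> f x = 0"
  shows "(LINT x|lebesgue_on \<Omega>. f x) = (LINT x|lborel. f x)"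
proof -
  have "(LINT x|lebesgue_on \<Omega>. f x) = (LINT x|lebesgue. indicator \<Omega> x *\<^sub>R f x)"
    using assms(1) by (intro integral_restrict_space) simp
  also have "(\<lambda>x. indicator \<Omega> x *\<^sub>R f x) = f"
    using assms(3) by (auto simp: indicator_def fun_eq_iff)
  also have "(LINT x|lebesgue. f x) = (LINT x|lborel. f x)"
    using assms(2) by (intro integral_completion) (simp add: borel_measurable_continuous_onI)
  finally show ?thesis .
qed

lemma test_functionD:
  assumes "test_function \<Omega> \<phi>"
  obtains K where "compact K" "K \<subseteq> \<Omega>" "\<And>x. x \<notin> K \<Longrightarrow> \<phi> x = 0" "\<And>x. x \<notin> K \<Longrightarrow> grad \<phi> x = 0"
    "C1_gradient \<phi> (grad \<phi>)"
proof -
  let ?K = "closure {x. \<phi> x \<noteq> 0}"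
  have C1: "C1_gradient \<phi> (grad \<phi>)" using assms by (intro Ck_imp_C1_gradient) (auto simp: test_function_def)
  have zero: "\<phi> x = 0" if "x \<notin> ?K" for x using that closure_subset[of "{x. \<phi> x \<noteq> 0}"] by auto
  have gzero: "grad \<phi> x = 0" if "x \<notin> ?K" for x
  proof (rule C1_gradient_eq_0[OF C1])
    show "open (- ?K)" by (rule open_Compl[OF closed_closure])
    show "x \<in> - ?K" using that by simp
    show "\<phi> y = 0" if "y \<in> - ?K" for y by (rule zero) (use that in simp)
  qed
  have "compact ?K" "?K \<subseteq> \<Omega>" using assms by (simp_all add: test_function_def)
  then show thesis using zero gzero C1 by (rule that)
qed

text \<open>The product of \<open>u\<close> with a test function has compact support, so its
  gradient integrates to zero; the product rule turns this into integration by parts.\<close>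

lemma has_weak_gradient_C1:
  fixes u :: "'a::euclidean_space \<Rightarrow> real"
  assumes "open \<Omega>" and u: "C1_gradient u G"
  shows "has_weak_gradient \<Omega> u G"
  unfolding has_weak_gradient_def
proof (intro conjI allI impI ballI)
  show "locally_integrable \<Omega> u" "locally_integrable \<Omega> G"
    using C1_gradientD[OF u] by (auto intro: continuous_imp_locally_integrable)
  fix \<phi> and i :: 'a assume "test_function \<Omega> \<phi>" "i \<in> Basis"
  then obtain K where K: "compact K" "K \<subseteq> \<Omega>" "\<And>x. x \<notin> K \<Longrightarrow> \<phi> x = 0" "\<And>x. x \<notin> K \<Longrightarrow> grad \<phi> x = 0"
    and \<phi>: "C1_gradient \<phi> (grad \<phi>)" using test_functionD by blast
  have out: "\<phi> x = 0" "grad \<phi> x = 0" if "x \<notin> \<Omega>" for x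
    using K that by blast+
  have cont: "continuous_on UNIV \<phi>" "continuous_on UNIV (grad \<phi>)" "continuous_on UNIV u" "continuous_on UNIV G"
    using C1_gradientD[OF u] C1_gradientD[OF \<phi>] by auto
  have C1: "C1_gradient (\<lambda>x. u x * \<phi> x) (\<lambda>x. u x *\<^sub>R grad \<phi> x + \<phi> x *\<^sub>R G x)"
    unfolding C1_gradient_def
  proof (intro conjI allI)
    fix x
    show "((\<lambda>x. u x * \<phi> x) has_derivative (\<lambda>h. (u x *\<^sub>R grad \<phi> x + \<phi> x *\<^sub>R G x) \<bullet> h)) (at x)"
      by (rule has_derivative_eq_rhs[OF has_derivative_mult[OF C1_gradientD(1)[OF u] C1_gradientD(1)[OF \<phi>]]])
        (simp add: fun_eq_iff inner_add_left mult.commute)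
  qed (intro continuous_intros cont)
  obtain R where R: "\<And>x. x \<in> K \<Longrightarrow> norm x \<le> R"
    using compact_imp_bounded[OF K(1)] by (auto simp: bounded_iff)
  have "u x * \<phi> x = 0" if "R < norm x" for x
  proof -
    have "x \<notin> K" using R[of x] that by auto
    then show ?thesis using K(3) by simp
  qed
  then have "(LINT x|lborel. (u x *\<^sub>R grad \<phi> x + \<phi> x *\<^sub>R G x) \<bullet> i) = 0"
    by (rule integral_gradient_compact_support[OF C1])
  also have "(\<lambda>x. (u x *\<^sub>R grad \<phi> x + \<phi> x *\<^sub>R G x) \<bullet> i) = (\<lambda>x. u x * (grad \<phi> x \<bullet> i) + (G x \<bullet> i) * \<phi> x)"
    by (auto simp: inner_add_left mult.commute)
  also have "(LINT x|lborel. u x * (grad \<phi> x \<bullet> i) + (G x \<bullet> i) * \<phi> x) =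
     (LINT x|lborel. u x * (grad \<phi> x \<bullet> i)) + (LINT x|lborel. (G x \<bullet> i) * \<phi> x)"
    using K(3,4) by (intro Bochner_Integration.integral_add integrable_compact_support[OF _ K(1)] continuous_intros cont) auto
  also have "(LINT x|lborel. u x * (grad \<phi> x \<bullet> i)) = (LINT x|lebesgue_on \<Omega>. u x * (grad \<phi> x \<bullet> i))"
    using out \<open>open \<Omega>\<close> by (intro integral_lebesgue_on_supported[symmetric] continuous_intros cont) auto
  also have "(LINT x|lborel. (G x \<bullet> i) * \<phi> x) = (LINT x|lebesgue_on \<Omega>. (G x \<bullet> i) * \<phi> x)"
    using out \<open>open \<Omega>\<close> by (intro integral_lebesgue_on_supported[symmetric] continuous_intros cont) auto
  finally show "(LINT x|lebesgue_on \<Omega>. u x * partial i \<phi> x) = - (LINT x|lebesgue_on \<Omega>. (G x \<bullet> i) * \<phi> x)"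
    by (simp add: C1_gradient_partial[OF \<phi>])
qed

lemma integrable_locally_integrable_test:
  fixes f :: "'a::euclidean_space \<Rightarrow> real"
  assumes "open \<Omega>" "locally_integrable \<Omega> f" "test_function \<Omega> \<phi>"
  shows "integrable (lebesgue_on \<Omega>) (\<lambda>x. f x * \<phi> x)"
proof -
  obtain K where K: "compact K" "K \<subseteq> \<Omega>" "\<And>x. x \<notin> K \<Longrightarrow> \<phi> x = 0"
    and \<phi>: "C1_gradient \<phi> (grad \<phi>)" using test_functionD[OF assms(3)] by metis
  have K': "K \<in> sets borel" using K(1) by (simp add: compact_imp_closed)
  have cont: "continuous_on UNIV \<phi>" using C1_gradientD(3)[OF \<phi>] .
  have "bounded (\<phi> ` K)"
    using K(1) continuous_on_subset[OF cont] by (intro compact_imp_bounded compact_continuous_image) auto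
  then obtain B where B: "\<And>x. x \<in> K \<Longrightarrow> \<bar>\<phi> x\<bar> \<le> B" by (auto simp: bounded_iff)
  have B': "\<bar>\<phi> x\<bar> \<le> \<bar>B\<bar>" for x using B[of x] K(3)[of x] by (cases "x \<in> K") auto
  have "integrable (lebesgue_on K) f" using assms(2) K by (auto simp: locally_integrable_def)
  then have fi: "integrable lebesgue (\<lambda>x. indicator K x *\<^sub>R f x)" using K' by (simp add: integrable_restrict_space)
  have "integrable lebesgue (\<lambda>x. (indicator K x *\<^sub>R f x) * \<phi> x)"
  proof (rule Bochner_Integration.integrable_bound[OF integrable_mult_right[OF fi, of "\<bar>B\<bar>"]])
    show "(\<lambda>x. (indicator K x *\<^sub>R f x) * \<phi> x) \<in> borel_measurable lebesgue"
      using cont by (intro borel_measurable_times borel_measurable_integrable[OF fi] measurable_completion)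
        (simp add: borel_measurable_continuous_onI)
    show "AE x in lebesgue. norm ((indicator K x *\<^sub>R f x) * \<phi> x) \<le> norm (\<bar>B\<bar> * (indicator K x *\<^sub>R f x))"
      using B' by (intro AE_I2) (auto simp: abs_mult indicator_def mult.commute intro!: mult_right_mono)
  qed
  also have "(\<lambda>x. (indicator K x *\<^sub>R f x) * \<phi> x) = (\<lambda>x. indicator \<Omega> x *\<^sub>R (f x * \<phi> x))"
    using K(2,3) by (auto simp: indicator_def fun_eq_iff)
  finally show ?thesis using \<open>open \<Omega>\<close> by (simp add: integrable_restrict_space)
qed

text \<open>\<open>AE_zero_if_test_integrals_zero\<close>, applied to each component of the
  difference, shows that the unspecified choice behind \<open>weak_grad\<close> is invisible to
  integrals.\<close>

lemma weak_grad_C1: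
  fixes u :: "'a::euclidean_space \<Rightarrow> real"
  assumes "open \<Omega>" and u: "C1_gradient u G"
  shows "AE x in lebesgue_on \<Omega>. weak_grad \<Omega> u x = G x"
proof -
  let ?W = "weak_grad \<Omega> u"
  note G = has_weak_gradient_C1[OF assms]
  have W: "has_weak_gradient \<Omega> u ?W" unfolding weak_grad_def by (rule someI[where P="has_weak_gradient \<Omega> u", OF G])
  have "AE x in lebesgue_on \<Omega>. (?W x - G x) \<bullet> i = 0" if i: "i \<in> Basis" for i
  proof (rule AE_zero_if_test_integrals_zero[OF \<open>open \<Omega>\<close>])
    have li: "locally_integrable \<Omega> (\<lambda>x. ?W x \<bullet> i)" "locally_integrable \<Omega> (\<lambda>x. G x \<bullet> i)"
      using W G by (auto simp: has_weak_gradient_def locally_integrable_def)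
    then show "locally_integrable \<Omega> (\<lambda>x. (?W x - G x) \<bullet> i)"
      by (auto simp: locally_integrable_def inner_diff_left)
    fix \<phi> assume \<phi>: "test_function \<Omega> \<phi>"
    have "(LINT x|lebesgue_on \<Omega>. (?W x - G x) \<bullet> i * \<phi> x) =
       (LINT x|lebesgue_on \<Omega>. (?W x \<bullet> i) * \<phi> x) - (LINT x|lebesgue_on \<Omega>. (G x \<bullet> i) * \<phi> x)"
      unfolding inner_diff_left left_diff_distrib
      by (intro Bochner_Integration.integral_diff integrable_locally_integrable_test[OF \<open>open \<Omega>\<close> _ \<phi>] li)
    also have "\<dots> = 0" using W G \<phi> i unfolding has_weak_gradient_def by (metis diff_self minus_minus)
    finally show "(LINT x|lebesgue_on \<Omega>. (?W x - G x) \<bullet> i * \<phi> x) = 0" .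
  qed
  then have "AE x in lebesgue_on \<Omega>. \<forall>i\<in>Basis. (?W x - G x) \<bullet> i = 0"
    by (subst AE_ball_countable) (auto intro: countable_finite)
  then show ?thesis by eventually_elim (auto simp: euclidean_eq_iff[of _ "G _"] inner_diff_left)
qed


subsection \<open>Dyadic cutoffs\<close>

lemma smooth_real_continuous: "smooth_real g \<Longrightarrow> continuous_on UNIV g"
  by (metis DERIV_isCont continuous_at_imp_continuous_on smooth_realD)

text \<open>The quotient \<open>exp_bump t / (exp_bump t + exp_bump (1 - t))\<close>: its
  denominator is positive because \<open>t\<close> or \<open>1 - t\<close> is. The derivative lives
  on the unit interval and is therefore bounded.\<close>

lemma cutoff_profile:
  obtains \<eta> \<eta>' :: "real \<Rightarrow> real" and B where
    "\<And>t. (\<eta> has_real_derivative \<eta>' t) (at t)" "continuous_on UNIV \<eta>'"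
    "\<And>t. t \<le> 0 \<Longrightarrow> \<eta> t = 0" "\<And>t. 1 \<le> t \<Longrightarrow> \<eta> t = 1" "\<And>t. 0 \<le> \<eta> t" "\<And>t. \<eta> t \<le> 1"
    "0 < B" "\<And>t. \<bar>\<eta>' t\<bar> \<le> B" "\<And>t. t < 0 \<or> 1 < t \<Longrightarrow> \<eta>' t = 0"
proof -
  let ?g = exp_bump
  obtain g' where g': "smooth_real g'" "\<And>x. (?g has_real_derivative g' x) (at x)"
    using smooth_realD[OF smooth_exp_bump] by blast
  have pos: "0 < ?g t + ?g (1 - t)" for t by (auto simp: exp_bump_def add_pos_nonneg add_nonneg_pos)
  define \<eta> where "\<eta> t = ?g t / (?g t + ?g (1 - t))" for t
  define \<eta>' where "\<eta>' t = (g' t * (?g t + ?g (1 - t)) - ?g t * (g' t - g' (1 - t))) / ((?g t + ?g (1 - t)) * (?g t + ?g (1 - t)))" for t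
  have d: "(\<eta> has_real_derivative \<eta>' t) (at t)" for t
  proof -
    have "((\<lambda>t. 1 - t) has_real_derivative - 1) (at t)" by (auto intro!: derivative_eq_intros)
    from DERIV_chain2[OF g'(2) this] have "((\<lambda>t. ?g (1 - t)) has_real_derivative - g' (1 - t)) (at t)" by simp
    from DERIV_divide[OF g'(2) DERIV_add[OF g'(2) this]] pos[of t]
    show ?thesis unfolding \<eta>_def[abs_def] \<eta>'_def by simp
  qed
  have cg: "continuous_on UNIV ?g" "continuous_on UNIV g'" "continuous_on UNIV (\<lambda>t. ?g (1 - t))" "continuous_on UNIV (\<lambda>t. g' (1 - t))"
    using smooth_real_continuous[OF smooth_exp_bump] smooth_real_continuous[OF g'(1)]
    by (auto intro!: continuous_on_compose2[of UNIV _ UNIV "\<lambda>t. 1 - t"] continuous_intros)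
  have c: "continuous_on UNIV \<eta>'"
    unfolding \<eta>'_def[abs_def] using pos by (intro continuous_intros cg) (auto simp: less_imp_neq[symmetric])
  have e0: "\<eta> t = 0" if "t \<le> 0" for t using that by (simp add: \<eta>_def exp_bump_def)
  have e1: "\<eta> t = 1" if "1 \<le> t" for t using that by (simp add: \<eta>_def exp_bump_def)
  have z: "\<eta>' t = 0" if "t < 0 \<or> 1 < t" for t
  proof -
    obtain U k where U: "open U" "t \<in> U" "\<And>y. y \<in> U \<Longrightarrow> \<eta> y = k"
    proof (cases "t < 0")
      case True
      show thesis by (rule that[of "{..<0}" 0]) (use True e0 in auto)
    next
      case False
      show thesis by (rule that[of "{1<..}" 1]) (use False \<open>t < 0 \<or> 1 < t\<close> e1 in auto)
    qed
    have "\<forall>\<^sub>F y in nhds t. \<eta> y = k" using eventually_nhds_in_open[OF U(1,2)] U(3) by (auto elim!: eventually_mono)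
    then have "(\<eta> has_real_derivative 0) (at t)"
      using DERIV_cong_ev[OF refl _ refl, of \<eta> "\<lambda>_. k" t 0] by simp
    with d show ?thesis by (rule DERIV_unique)
  qed
  have "compact (\<eta>' ` {0..1})" using continuous_on_subset[OF c] by (intro compact_continuous_image) auto
  then obtain B where B: "0 < B" "\<And>y. y \<in> \<eta>' ` {0..1} \<Longrightarrow> norm y \<le> B"
    using compact_imp_bounded bounded_pos by metis
  have "\<bar>\<eta>' t\<bar> \<le> B" for t
  proof (cases "t < 0 \<or> 1 < t")
    case True then show ?thesis using z B(1) by simp
  next
    case False then show ?thesis using B(2)[of "\<eta>' t"] by auto
  qed
  moreover have "0 \<le> \<eta> t" "\<eta> t \<le> 1" for t
    using exp_bump_bounds[of t] exp_bump_bounds[of "1 - t"] pos[of t] by (auto simp: \<eta>_def)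
  ultimately show thesis using d c e0 e1 z B(1) by (intro that[of \<eta> \<eta>' B]) assumption+
qed

lemma nn_integral_sum_indicator:
  fixes c :: "'b \<Rightarrow> ennreal"
  assumes "\<And>j. S j \<in> sets M"
  shows "(\<integral>\<^sup>+x. (\<Sum>j\<in>J. c j * indicator (S j) x) \<partial>M) = (\<Sum>j\<in>J. c j * emeasure M (S j))"
  using assms by (subst nn_integral_sum) (simp_all add: nn_integral_cmult_indicator)

text \<open>The average of \<open>N\<close> dyadic cutoffs whose gradients have disjoint supports: each gradient has
  \<open>L\<^sup>p\<close> norm bounded independently of the scale since \<open>p \<le> n\<close>, so the average gains \<open>N powr (1 - p)\<close>.\<close>

lemma dyadic_cutoff:
  fixes x0 :: "'a::euclidean_space"
  assumes R: "0 < R" and p: "1 < p" "p \<le> real DIM('a)" and \<delta>: "0 < \<delta>"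
  obtains u G r where "C1_gradient u G" "0 < r" "\<And>x. x \<in> ball x0 r \<Longrightarrow> u x = 0"
    "\<And>x. 2 * R \<le> dist x0 x \<Longrightarrow> u x = 1" "\<And>x. 0 \<le> u x" "\<And>x. u x \<le> 1"
    "(\<integral>\<^sup>+x. ennreal (norm (G x) powr p) \<partial>lborel) \<le> ennreal \<delta>"
proof -
  obtain \<eta> \<eta>' :: "real \<Rightarrow> real" and B where
    \<eta>: "\<And>t. (\<eta> has_real_derivative \<eta>' t) (at t)" "continuous_on UNIV \<eta>'"
    "\<And>t. t \<le> 0 \<Longrightarrow> \<eta> t = 0" "\<And>t. 1 \<le> t \<Longrightarrow> \<eta> t = 1" "\<And>t. 0 \<le> \<eta> t" "\<And>t. \<eta> t \<le> 1"
    "0 < B" "\<And>t. \<bar>\<eta>' t\<bar> \<le> B" "\<And>t. t < 0 \<or> 1 < t \<Longrightarrow> \<eta>' t = 0"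
    using cutoff_profile by metis
  \<comment> \<open>The squared distance keeps the cutoff differentiable at \<open>x0\<close>. The
    j-th cutoff rises from 0 to 1 while \<open>2 ^ j * dist x0 x / R\<close> runs from 1 to the
    square root of 2.\<close>
  define q where "q j x = 4 ^ j / R\<^sup>2 * ((x - x0) \<bullet> (x - x0)) - 1" for j :: nat and x
  define \<psi> where "\<psi> j x = \<eta> (q j x)" for j x
  define g where "g j x = (\<eta>' (q j x) * (2 * (4 ^ j / R\<^sup>2))) *\<^sub>R (x - x0)" for j x
  have q_dist: "q j x = (2 ^ j * dist x0 x / R)\<^sup>2 - 1" for j x
    by (simp add: q_def dist_norm norm_minus_commute power_divide power_mult_distrib dot_square_norm
        power_mult[symmetric] mult.commute[of j 2]) (simp add: power_mult)
  have cq: "continuous_on UNIV (q j)" for j unfolding q_def by (intro continuous_intros)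
  have C1_\<psi>: "C1_gradient (\<psi> j) (g j)" for j
    unfolding C1_gradient_def
  proof (intro conjI allI)
    fix x
    have "((\<lambda>x. c * ((x - x0) \<bullet> (x - x0)) - 1) has_derivative (\<lambda>h. 2 * c * ((x - x0) \<bullet> h))) (at x)" for c
      by (auto intro!: derivative_eq_intros simp: inner_commute fun_eq_iff)
    from this[of "4 ^ j / R\<^sup>2"]
    have "(q j has_derivative (\<lambda>h. 2 * (4 ^ j / R\<^sup>2) * ((x - x0) \<bullet> h))) (at x)" unfolding q_def[abs_def] .
    from has_derivative_compose[OF this \<eta>(1)[THEN has_field_derivative_imp_has_derivative]]
    show "(\<psi> j has_derivative (\<lambda>h. g j x \<bullet> h)) (at x)"
      by (simp add: \<psi>_def[abs_def] g_def mult_ac)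
  next
    show "continuous_on UNIV (g j)"
      unfolding g_def[abs_def]
      by (intro continuous_intros continuous_on_compose2[OF \<eta>(2) cq]) auto
  qed
  \<comment> \<open>The transition zone rounded up to a dyadic annulus, half-open so that different
    annuli are disjoint.\<close>
  define Ann where "Ann j = {x. 1 \<le> 2 ^ j * dist x0 x / R \<and> 2 ^ j * dist x0 x / R < 2}" for j :: nat
  have g_zero: "g j x = 0" if "x \<notin> Ann j" for j x
  proof -
    have "q j x < 0 \<or> 1 < q j x"
    proof (cases "2 ^ j * dist x0 x / R < 1")
      case True
      then have "(2 ^ j * dist x0 x / R)\<^sup>2 < 1" using R by (simp add: power_less_one_iff abs_square_less_1)
      then show ?thesis by (simp add: q_dist)
    next
      case False
      then have "2 \<le> 2 ^ j * dist x0 x / R" using that by (simp add: Ann_def)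
      then have "2\<^sup>2 \<le> (2 ^ j * dist x0 x / R)\<^sup>2" by (intro power_mono) auto
      then show ?thesis by (simp add: q_dist)
    qed
    then show ?thesis using \<eta>(9) by (simp add: g_def)
  qed
  have g_bound: "norm (g j x) \<le> 4 * B * 2 ^ j / R" for j x
  proof (cases "x \<in> Ann j")
    case True
    have "norm (g j x) = \<bar>\<eta>' (q j x)\<bar> * (2 * (2 ^ j / R) * (2 ^ j * dist x0 x / R))"
      using R by (simp add: g_def abs_mult dist_norm norm_minus_commute power2_eq_square mult_ac)
        (simp add: power_mult_distrib[symmetric] mult.assoc[symmetric])
    also have "\<dots> \<le> B * (2 * (2 ^ j / R) * 2)"
      using True R \<eta>(7,8) by (intro mult_mono) (auto simp: Ann_def)
    finally show ?thesis by (simp add: mult_ac)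
  next
    case False
    then show ?thesis using g_zero R \<eta>(7) by simp
  qed
  have Ann_disj: "j = k" if "x \<in> Ann j" "x \<in> Ann k" for j k x
  proof -
    have False if "x \<in> Ann j" "x \<in> Ann k" "j < k" for j k
    proof -
      have "2 * 2 ^ j \<le> (2 ^ k :: real)" using \<open>j < k\<close> power_increasing[of "Suc j" k "2::real"] by simp
      then have "2 * 2 ^ j * (dist x0 x / R) \<le> 2 ^ k * (dist x0 x / R)" using R by (intro mult_right_mono) auto
      then show False using that by (auto simp: Ann_def)
    qed
    with that show ?thesis by (metis nat_neq_iff)
  qed
  define V where "V = unit_ball_vol DIM('a)"
  have V: "0 < V" by (simp add: V_def)
  \<comment> \<open>The p-th power of the bound \<open>4 * B * 2 ^ j / R\<close> times the volume of
    a ball of radius \<open>2 * R / 2 ^ j\<close>, with the powers of \<open>2 ^ j\<close> left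
    out.\<close>
  define K where "K = (4 * B / R) powr p * (V * (2 * R) ^ DIM('a))"
  have K: "0 < K" using \<eta>(7) R V by (simp add: K_def)
  have "((\<lambda>N. K * real (Suc N) powr (1 - p)) \<longlongrightarrow> K * 0) sequentially"
  proof (intro tendsto_intros)
    have "((\<lambda>N. real (Suc N) powr - (p - 1)) \<longlongrightarrow> 0) sequentially"
      using p by (intro tendsto_neg_powr filterlim_compose[OF filterlim_real_sequentially filterlim_Suc]) auto
    then show "((\<lambda>N. real (Suc N) powr (1 - p)) \<longlongrightarrow> 0) sequentially" by simp
  qed
  then have "\<forall>\<^sub>F N in sequentially. K * real (Suc N) powr (1 - p) < \<delta>"
    using \<delta> by (intro order_tendstoD(2)) auto
  then obtain N0 where "K * real (Suc N0) powr (1 - p) < \<delta>" by (auto simp: eventually_sequentially)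
  then obtain N where N: "0 < N" "K * real N powr (1 - p) < \<delta>" by blast
  define u where "u x = (\<Sum>j<N. \<psi> j x) / real N" for x
  define G where "G x = (1 / real N) *\<^sub>R (\<Sum>j<N. g j x)" for x
  have C1: "C1_gradient u G"
    unfolding C1_gradient_def
  proof (intro conjI allI)
    fix x
    have "((\<lambda>x. (1 / real N) * (\<Sum>j<N. \<psi> j x)) has_derivative (\<lambda>h. (1 / real N) * (\<Sum>j<N. g j x \<bullet> h))) (at x)"
      by (intro has_derivative_mult_right has_derivative_sum C1_gradientD(1)[OF C1_\<psi>])
    then show "(u has_derivative (\<lambda>h. G x \<bullet> h)) (at x)"
      by (simp add: u_def[abs_def] G_def inner_sum_left)
    show "continuous_on UNIV G"
      unfolding G_def[abs_def] by (intro continuous_intros C1_gradientD(2)[OF C1_\<psi>])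
  qed
  define r where "r = R / 2 ^ N"
  show thesis
  proof (rule that[OF C1, of r])
    show "0 < r" using R by (simp add: r_def)
    show "u x = 0" if "x \<in> ball x0 r" for x
    proof -
      have "\<psi> j x = 0" if "j < N" for j
      proof -
        have "(2::real) ^ j \<le> 2 ^ N" using that by (intro power_increasing) auto
        then have "2 ^ j * dist x0 x \<le> 2 ^ N * dist x0 x" by (intro mult_right_mono) auto
        also have "\<dots> \<le> R" using \<open>x \<in> ball x0 r\<close> by (simp add: r_def field_simps)
        finally have "2 ^ j * dist x0 x / R \<le> 1" using R by simp
        then have "(2 ^ j * dist x0 x / R)\<^sup>2 \<le> 1" using R by (intro power_le_one) auto
        then show ?thesis unfolding \<psi>_def by (intro \<eta>(3)) (simp add: q_dist)
      qed
      then show ?thesis by (simp add: u_def)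
    qed
    show "u x = 1" if "2 * R \<le> dist x0 x" for x
    proof -
      have "\<psi> j x = 1" for j
      proof -
        have "(1::real) \<le> 2 ^ j" by simp
        then have "1 * dist x0 x \<le> 2 ^ j * dist x0 x" by (intro mult_right_mono) auto
        then have "2 \<le> 2 ^ j * dist x0 x / R" using that R by (simp add: field_simps)
        then have "2\<^sup>2 \<le> (2 ^ j * dist x0 x / R)\<^sup>2" by (intro power_mono) auto
        then show ?thesis unfolding \<psi>_def by (intro \<eta>(4)) (simp add: q_dist)
      qed
      then show ?thesis using N by (simp add: u_def)
    qed
    show "0 \<le> u x" for x using \<eta>(5) by (simp add: u_def \<psi>_def sum_nonneg)
    show "u x \<le> 1" for x
    proof -
      have "(\<Sum>j<N. \<psi> j x) \<le> (\<Sum>j<N. 1)" using \<eta>(6) by (intro sum_mono) (simp add: \<psi>_def)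
      then show ?thesis using N by (simp add: u_def)
    qed
    \<comment> \<open>At most one summand of \<open>G x\<close> is nonzero, so the factor
      \<open>1 / real N\<close> acts on a single gradient. Each of the \<open>N\<close> scales then
      contributes of order \<open>real N powr - p\<close>.\<close>
    have pw: "ennreal (norm (G x) powr p) \<le>
      (\<Sum>j<N. ennreal ((4 * B * 2 ^ j / R / real N) powr p) * indicator (cball x0 (2 * R / 2 ^ j)) x)" for x
    proof (cases "\<exists>j<N. x \<in> Ann j")
      case True
      then obtain j where j: "j < N" "x \<in> Ann j" by blast
      have g_other: "g k x = 0" if "k \<noteq> j" for k
        by (rule g_zero) (use that j(2) Ann_disj in blast)
      have "(\<Sum>k<N. g k x) = g j x"
        using j g_other by (subst sum.remove[of _ j]) auto
      then have "norm (G x) = norm (g j x) / real N" by (simp add: G_def)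
      also have "\<dots> \<le> 4 * B * 2 ^ j / R / real N"
        by (rule divide_right_mono[OF g_bound]) simp
      finally have "norm (G x) \<le> 4 * B * 2 ^ j / R / real N" .
      then have "ennreal (norm (G x) powr p) \<le> ennreal ((4 * B * 2 ^ j / R / real N) powr p)"
        using p by (intro ennreal_leI powr_mono2) auto
      also have "\<dots> = ennreal ((4 * B * 2 ^ j / R / real N) powr p) * indicator (cball x0 (2 * R / 2 ^ j)) x"
        using j(2) R by (simp add: Ann_def field_simps)
      also have "\<dots> \<le> (\<Sum>j<N. ennreal ((4 * B * 2 ^ j / R / real N) powr p) * indicator (cball x0 (2 * R / 2 ^ j)) x)"
        using j(1) by (intro member_le_sum) auto
      finally show ?thesis .
    next
      case False
      then have "G x = 0" using g_zero by (simp add: G_def)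
      then show ?thesis by simp
    qed
    have "(\<integral>\<^sup>+x. ennreal (norm (G x) powr p) \<partial>lborel) \<le>
      (\<integral>\<^sup>+x. (\<Sum>j<N. ennreal ((4 * B * 2 ^ j / R / real N) powr p) * indicator (cball x0 (2 * R / 2 ^ j)) x) \<partial>lborel)"
      by (intro nn_integral_mono pw)
    also have "\<dots> = (\<Sum>j<N. ennreal ((4 * B * 2 ^ j / R / real N) powr p) * emeasure lborel (cball x0 (2 * R / 2 ^ j)))"
      by (rule nn_integral_sum_indicator) simp
    also have "\<dots> \<le> (\<Sum>j<N. ennreal (K * real N powr - p))"
    proof (rule sum_mono)
      fix j
      have "(4 * B * 2 ^ j / R / real N) powr p = (4 * B / R) powr p * ((2 ^ j) powr p * real N powr - p)"
        using \<eta>(7) R N by (simp add: powr_divide powr_mult powr_minus_divide)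
      moreover have "(2 * R / 2 ^ j) ^ DIM('a) = (2 * R) ^ DIM('a) / (2 ^ j) powr real DIM('a)"
        by (simp add: power_divide powr_realpow)
      ultimately have "(4 * B * 2 ^ j / R / real N) powr p * (V * (2 * R / 2 ^ j) ^ DIM('a)) =
          K * real N powr - p * ((2 ^ j) powr p / (2 ^ j) powr real DIM('a))"
        by (simp add: K_def)
      \<comment> \<open>What remains of the scale is \<open>2 ^ j\<close> to the power p minus the
        dimension, at most 1 because p does not exceed the dimension.\<close>
      also have "\<dots> \<le> K * real N powr - p * 1"
        using K p by (intro mult_left_mono) (auto intro!: powr_mono)
      finally show "ennreal ((4 * B * 2 ^ j / R / real N) powr p) * emeasure lborel (cball x0 (2 * R / 2 ^ j)) \<le>
          ennreal (K * real N powr - p)"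
        using R V by (simp add: emeasure_cball V_def[symmetric] ennreal_mult[symmetric] ennreal_leI)
    qed
    also have "\<dots> = ennreal (real N * (K * real N powr - p))"
      using K by (simp add: ennreal_mult ennreal_of_nat_eq_real_of_nat)
    also have "real N * (K * real N powr - p) = K * real N powr (1 - p)"
      using N by (simp add: powr_diff powr_minus_divide)
    also have "ennreal (K * real N powr (1 - p)) \<le> ennreal \<delta>"
      using N(2) by (intro ennreal_leI) simp
    finally show "(\<integral>\<^sup>+x. ennreal (norm (G x) powr p) \<partial>lborel) \<le> ennreal \<delta>" .
  qed
qed


subsection \<open>The infimum is zero\<close>

text \<open>The constant comes from bounding \<open>norm a\<close> by twice the larger of the two
  norms; it recurs in all later approximations.\<close>

lemma norm_powr_add_le:
  fixes a b :: "'a::real_normed_vector"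
  assumes "1 < p"
  shows "norm a powr p \<le> 2 powr p * (norm (a - b) powr p + norm b powr p)"
proof -
  have "norm a \<le> norm (a - b) + norm b" using norm_triangle_sub[of a b] by simp
  then have "norm a \<le> 2 * max (norm (a - b)) (norm b)" by simp
  then have "norm a powr p \<le> (2 * max (norm (a - b)) (norm b)) powr p"
    using assms by (intro powr_mono2) auto
  also have "\<dots> = 2 powr p * max (norm (a - b)) (norm b) powr p" by (simp add: powr_mult)
  also have "max (norm (a - b)) (norm b) powr p \<le> norm (a - b) powr p + norm b powr p"
    by (auto simp: max_def)
  finally show ?thesis by simp
qed

lemma nn_integral_norm_powr_add_le:
  fixes f g :: "'a \<Rightarrow> 'b::euclidean_space"
  assumes [measurable]: "f \<in> borel_measurable M" "g \<in> borel_measurable M" and p: "1 < p"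
  shows "(\<integral>\<^sup>+x. ennreal (norm (f x) powr p) \<partial>M) \<le> ennreal (2 powr p) *
    ((\<integral>\<^sup>+x. ennreal (norm (f x - g x) powr p) \<partial>M) + (\<integral>\<^sup>+x. ennreal (norm (g x) powr p) \<partial>M))"
proof -
  have "(\<integral>\<^sup>+x. ennreal (norm (f x) powr p) \<partial>M) \<le>
    (\<integral>\<^sup>+x. ennreal (2 powr p) * (ennreal (norm (f x - g x) powr p) + ennreal (norm (g x) powr p)) \<partial>M)"
    by (intro nn_integral_mono)
      (simp add: ennreal_mult[symmetric] ennreal_plus[symmetric] ennreal_leI norm_powr_add_le[OF p] del: ennreal_plus)
  then show ?thesis by (simp add: nn_integral_cmult nn_integral_add)
qed

lemma nn_integral_lebesgue_on:
  assumes "\<Omega> \<in> sets borel"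
  shows "(\<integral>\<^sup>+x. f x \<partial>lebesgue_on \<Omega>) = (\<integral>\<^sup>+x\<in>\<Omega>. f x \<partial>lborel)"
  using assms by (subst nn_integral_restrict_space) (simp_all add: nn_integral_completion)

lemma borel_measurable_lebesgue_onI:
  fixes f :: "'a::euclidean_space \<Rightarrow> 'b::euclidean_space"
  assumes "f \<in> borel_measurable borel" shows "f \<in> borel_measurable (lebesgue_on \<Omega>)"
  using assms by (intro measurable_restrict_space1 measurable_completion) simp

text \<open>The L^1 inequality is applied to \<open>\<bar>u x\<bar> powr p\<close>, and its gradient
  term is split by the Young inequality with weight 1. Both interior integrals then have the form in
  which \<open>has_trace\<close> measures convergence.\<close>

lemma local_trace_inequality_powr:
  fixes \<Omega> :: "'a::euclidean_space set"
  assumes "C1_gradient u G" "1 < p" and [measurable]: "D \<in> sets borel"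
    and trace: "\<And>w G. C1_gradient w G \<Longrightarrow>
      (\<integral>\<^sup>+x\<in>A. ennreal \<bar>w x\<bar> \<partial>S) \<le> ennreal C *
        ((\<integral>\<^sup>+x\<in>D. ennreal \<bar>w x\<bar> \<partial>lborel) + ennreal K * (\<integral>\<^sup>+x\<in>D. ennreal (norm (G x)) \<partial>lborel))"
  shows "(\<integral>\<^sup>+x\<in>A. ennreal (\<bar>u x\<bar> powr p) \<partial>S) \<le> ennreal C *
    ((\<integral>\<^sup>+x\<in>D. ennreal (\<bar>u x\<bar> powr p) \<partial>lborel) + ennreal K * (ennreal p *
      ((\<integral>\<^sup>+x\<in>D. ennreal (\<bar>u x\<bar> powr p) \<partial>lborel) + (\<integral>\<^sup>+x\<in>D. ennreal (norm (G x) powr p) \<partial>lborel))))"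
proof -
  note [measurable] = C1_gradientD(4,5)[OF assms(1)]
  have "(\<integral>\<^sup>+x\<in>D. ennreal (norm ((p * (\<bar>u x\<bar> powr (p - 1) * sgn (u x))) *\<^sub>R G x)) \<partial>lborel) \<le>
    (\<integral>\<^sup>+x. ennreal p * (ennreal (\<bar>u x\<bar> powr p) * indicator D x + ennreal (norm (G x) powr p) * indicator D x) \<partial>lborel)"
  proof (rule nn_integral_mono)
    fix x
    have "norm ((p * (\<bar>u x\<bar> powr (p - 1) * sgn (u x))) *\<^sub>R G x) \<le> p * (\<bar>u x\<bar> powr p + norm (G x) powr p)"
      using norm_gradient_abs_powr_le[of 1 p "u x" "G x"] assms(2) by (simp add: distrib_left)
    then have "ennreal (norm ((p * (\<bar>u x\<bar> powr (p - 1) * sgn (u x))) *\<^sub>R G x)) \<le>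
        ennreal p * (ennreal (\<bar>u x\<bar> powr p) + ennreal (norm (G x) powr p))"
      using assms(2) by (simp add: ennreal_mult[symmetric] ennreal_plus[symmetric] ennreal_leI del: ennreal_plus norm_scaleR)
    then show "ennreal (norm ((p * (\<bar>u x\<bar> powr (p - 1) * sgn (u x))) *\<^sub>R G x)) * indicator D x \<le>
        ennreal p * (ennreal (\<bar>u x\<bar> powr p) * indicator D x + ennreal (norm (G x) powr p) * indicator D x)"
      by (cases "x \<in> D") auto
  qed
  also have "\<dots> = ennreal p *
      ((\<integral>\<^sup>+x\<in>D. ennreal (\<bar>u x\<bar> powr p) \<partial>lborel) + (\<integral>\<^sup>+x\<in>D. ennreal (norm (G x) powr p) \<partial>lborel))"
    by (subst nn_integral_cmult) (auto simp: nn_integral_add)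
  finally have grad: "(\<integral>\<^sup>+x\<in>D. ennreal (norm ((p * (\<bar>u x\<bar> powr (p - 1) * sgn (u x))) *\<^sub>R G x)) \<partial>lborel) \<le> \<dots>" .
  have "(\<integral>\<^sup>+x\<in>A. ennreal \<bar>\<bar>u x\<bar> powr p\<bar> \<partial>S) \<le> ennreal C *
    ((\<integral>\<^sup>+x\<in>D. ennreal \<bar>\<bar>u x\<bar> powr p\<bar> \<partial>lborel) + ennreal K *
      (\<integral>\<^sup>+x\<in>D. ennreal (norm ((p * (\<bar>u x\<bar> powr (p - 1) * sgn (u x))) *\<^sub>R G x)) \<partial>lborel))"
    by (rule trace[OF C1_gradient_abs_powr[OF assms(1,2)]])
  also have "\<dots> \<le> ennreal C *
    ((\<integral>\<^sup>+x\<in>D. ennreal \<bar>\<bar>u x\<bar> powr p\<bar> \<partial>lborel) + ennreal K * (ennreal p *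
      ((\<integral>\<^sup>+x\<in>D. ennreal (\<bar>u x\<bar> powr p) \<partial>lborel) + (\<integral>\<^sup>+x\<in>D. ennreal (norm (G x) powr p) \<partial>lborel))))"
    by (intro mult_left_mono add_left_mono grad) auto
  finally show ?thesis by simp
qed

text \<open>Since \<^const>\<open>boundary_trace\<close> is chosen arbitrarily, every trace has to be considered.\<close>

lemma trace_vanishes_locally:
  fixes \<Omega> :: "'a::euclidean_space set"
  assumes "open \<Omega>" and p: "1 < p" and u: "C1_gradient u G"
    and zero: "\<And>x. x \<in> ball x0 r \<Longrightarrow> u x = 0"
    and A: "A \<in> sets borel" "A \<subseteq> frontier \<Omega>"
    and trace: "\<And>w G. C1_gradient w G \<Longrightarrow>
      (\<integral>\<^sup>+x\<in>A. ennreal \<bar>w x\<bar> \<partial>surface_measure \<Omega>) \<le> ennreal C *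
        ((\<integral>\<^sup>+x\<in>\<Omega> \<inter> ball x0 r. ennreal \<bar>w x\<bar> \<partial>lborel) + ennreal K * (\<integral>\<^sup>+x\<in>\<Omega> \<inter> ball x0 r. ennreal (norm (G x)) \<partial>lborel))"
    and g: "has_trace p \<Omega> u g"
  shows "AE x in surface_measure \<Omega>. x \<in> A \<longrightarrow> g x = 0"
proof -
  let ?S = "surface_measure \<Omega>" and ?D = "\<Omega> \<inter> ball x0 r" and ?W = "weak_grad \<Omega> u"
  have \<Omega>: "\<Omega> \<in> sets borel" and D: "?D \<in> sets borel" using \<open>open \<Omega>\<close> by auto
  have AS: "A \<in> sets ?S" using A by (rule sets_surface_measure)
  from g obtain U where U: "\<And>k. Ck 1 (U k)"
    and U1: "(\<lambda>k. \<integral>\<^sup>+x. ennreal (\<bar>U k x - u x\<bar> powr p) \<partial>lebesgue_on \<Omega>) \<longlonglongrightarrow> 0"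
    and U2: "(\<lambda>k. \<integral>\<^sup>+x. ennreal (norm (grad (U k) x - ?W x) powr p) \<partial>lebesgue_on \<Omega>) \<longlonglongrightarrow> 0"
    and U3: "(\<lambda>k. \<integral>\<^sup>+x. ennreal (\<bar>U k x - g x\<bar> powr p) \<partial>?S) \<longlonglongrightarrow> 0"
    and gL: "g \<in> Lp p ?S" unfolding has_trace_def by blast
  have [measurable]: "g \<in> borel_measurable ?S" using gL by (simp add: Lp_def)
  note CU = Ck_imp_C1_gradient[OF U]
  have US[measurable]: "U k \<in> borel_measurable ?S" for k
    by (intro borel_measurable_surface_measure C1_gradientD(4)[OF CU])
  have G0: "G x = 0" if "x \<in> ball x0 r" for x
    using C1_gradient_eq_0[OF u open_ball that zero] by simp
  \<comment> \<open>In the ball \<open>u\<close> and its gradient vanish, so there the differences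
    tending to 0 are the approximants themselves.\<close>
  have I1: "(\<integral>\<^sup>+x\<in>?D. ennreal (\<bar>U k x\<bar> powr p) \<partial>lborel) \<le> (\<integral>\<^sup>+x. ennreal (\<bar>U k x - u x\<bar> powr p) \<partial>lebesgue_on \<Omega>)" for k
    unfolding nn_integral_lebesgue_on[OF \<Omega>]
    by (intro nn_integral_mono) (auto simp: indicator_def zero)
  have I2: "(\<integral>\<^sup>+x\<in>?D. ennreal (norm (grad (U k) x) powr p) \<partial>lborel) \<le> (\<integral>\<^sup>+x. ennreal (norm (grad (U k) x - ?W x) powr p) \<partial>lebesgue_on \<Omega>)" for k
  proof -
    have "(\<integral>\<^sup>+x\<in>?D. ennreal (norm (grad (U k) x) powr p) \<partial>lborel) \<le> (\<integral>\<^sup>+x. ennreal (norm (grad (U k) x - G x) powr p) \<partial>lebesgue_on \<Omega>)"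
      unfolding nn_integral_lebesgue_on[OF \<Omega>]
      by (intro nn_integral_mono) (auto simp: indicator_def G0)
    also have "\<dots> = (\<integral>\<^sup>+x. ennreal (norm (grad (U k) x - ?W x) powr p) \<partial>lebesgue_on \<Omega>)"
      by (rule nn_integral_cong_AE, rule eventually_mono[OF weak_grad_C1[OF \<open>open \<Omega>\<close> u]]) simp
    finally show ?thesis .
  qed
  let ?a = "\<lambda>k. \<integral>\<^sup>+x. ennreal (\<bar>U k x - u x\<bar> powr p) \<partial>lebesgue_on \<Omega>"
    and ?b = "\<lambda>k. \<integral>\<^sup>+x. ennreal (norm (grad (U k) x - ?W x) powr p) \<partial>lebesgue_on \<Omega>"
    and ?c = "\<lambda>k. \<integral>\<^sup>+x. ennreal (\<bar>U k x - g x\<bar> powr p) \<partial>?S"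
  \<comment> \<open>\<open>g\<close> is compared with \<open>U k\<close> on the boundary, and
    \<open>U k\<close> on \<open>A\<close> is controlled from inside; the left-hand side is free of
    \<open>k\<close>, while the right-hand side tends to 0.\<close>
  have le: "(\<integral>\<^sup>+x\<in>A. ennreal (\<bar>g x\<bar> powr p) \<partial>?S) \<le>
    ennreal (2 powr p) * (?c k + ennreal C * (?a k + ennreal K * (ennreal p * (?a k + ?b k))))" for k
  proof -
    have "(\<integral>\<^sup>+x\<in>A. ennreal (\<bar>g x\<bar> powr p) \<partial>?S) \<le>
      (\<integral>\<^sup>+x. ennreal (2 powr p) * (ennreal (\<bar>U k x - g x\<bar> powr p) + ennreal (\<bar>U k x\<bar> powr p) * indicator A x) \<partial>?S)"
    proof (rule nn_integral_mono)
      fix x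
      show "ennreal (\<bar>g x\<bar> powr p) * indicator A x \<le>
        ennreal (2 powr p) * (ennreal (\<bar>U k x - g x\<bar> powr p) + ennreal (\<bar>U k x\<bar> powr p) * indicator A x)"
        using norm_powr_add_le[OF p, of "g x" "U k x"]
        by (cases "x \<in> A")
          (auto simp: abs_minus_commute[of "g x"] ennreal_mult[symmetric] ennreal_plus[symmetric] ennreal_leI simp del: ennreal_plus)
    qed
    also have "\<dots> = ennreal (2 powr p) * (?c k + (\<integral>\<^sup>+x\<in>A. ennreal (\<bar>U k x\<bar> powr p) \<partial>?S))"
      using AS by (subst nn_integral_cmult) (auto simp: nn_integral_add)
    also have "(\<integral>\<^sup>+x\<in>A. ennreal (\<bar>U k x\<bar> powr p) \<partial>?S) \<le> ennreal C *
      ((\<integral>\<^sup>+x\<in>?D. ennreal (\<bar>U k x\<bar> powr p) \<partial>lborel) + ennreal K * (ennreal p *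
      ((\<integral>\<^sup>+x\<in>?D. ennreal (\<bar>U k x\<bar> powr p) \<partial>lborel) + (\<integral>\<^sup>+x\<in>?D. ennreal (norm (grad (U k) x) powr p) \<partial>lborel))))"
      by (rule local_trace_inequality_powr[OF CU p D trace])
    also have "\<dots> \<le> ennreal C * (?a k + ennreal K * (ennreal p * (?a k + ?b k)))"
      by (intro mult_left_mono add_mono I1 I2) auto
    finally show ?thesis by (simp add: mult_left_mono add_left_mono)
  qed
  have "(\<lambda>k. ennreal (2 powr p) * (?c k + ennreal C * (?a k + ennreal K * (ennreal p * (?a k + ?b k))))) \<longlonglongrightarrow> 0"
    by (intro ennreal_tendsto_0_cmult ennreal_tendsto_0_add U1 U2 U3)
  then have "(\<integral>\<^sup>+x\<in>A. ennreal (\<bar>g x\<bar> powr p) \<partial>?S) \<le> 0"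
    using le by (intro LIMSEQ_le_const) auto
  then have "AE x in ?S. ennreal (\<bar>g x\<bar> powr p) * indicator A x = 0"
    using AS by (subst nn_integral_0_iff_AE[symmetric]) auto
  then show ?thesis by eventually_elim (auto simp: indicator_def)
qed

text \<open>The constant sequence \<open>u\<close> approximates itself; boundedness of
  \<open>u\<close> and finiteness of the surface measure place it in L^p of the boundary.\<close>

lemma has_trace_C1:
  fixes \<Omega> :: "'a::euclidean_space set"
  assumes "open \<Omega>" "finite_measure (surface_measure \<Omega>)" and p: "1 < p" and u: "C1_gradient u G"
    and bounds: "\<And>x. 0 \<le> u x" "\<And>x. u x \<le> 1"
  shows "has_trace p \<Omega> u u"
  unfolding has_trace_def
proof (intro conjI exI[of _ "\<lambda>_. u"] allI)
  interpret finite_measure "surface_measure \<Omega>" by fact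
  have [measurable]: "u \<in> borel_measurable (surface_measure \<Omega>)"
    by (intro borel_measurable_surface_measure C1_gradientD(4)[OF u])
  have "integrable (surface_measure \<Omega>) (\<lambda>x. norm (u x) powr p)"
    using bounds p by (intro integrable_const_bound[of _ 1]) (auto intro!: powr_le1)
  then show "u \<in> Lp p (surface_measure \<Omega>)" by (simp add: Lp_def)
  show "Ck 1 u" by (rule C1_gradient_imp_Ck[OF u])
  have "(\<integral>\<^sup>+x. ennreal (norm (grad u x - weak_grad \<Omega> u x) powr p) \<partial>lebesgue_on \<Omega>) = (\<integral>\<^sup>+x. 0 \<partial>lebesgue_on \<Omega>)"
    by (rule nn_integral_cong_AE, rule eventually_mono[OF weak_grad_C1[OF \<open>open \<Omega>\<close> u]])
      (simp add: C1_gradient_grad[OF u])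
  then show "(\<lambda>k. \<integral>\<^sup>+x. ennreal (norm (grad u x - weak_grad \<Omega> u x) powr p) \<partial>lebesgue_on \<Omega>) \<longlonglongrightarrow> 0"
    by simp
qed auto

lemma emeasure_lborel_bounded_finite:
  assumes "bounded \<Omega>" shows "emeasure lborel \<Omega> < \<infinity>"
  using emeasure_bounded_finite[OF assms] by simp

lemma optimal_eigenvalue_eq_0:
  fixes \<Omega> :: "'a::euclidean_space set" and p m \<epsilon> :: real
  assumes dim: "DIM('a) \<ge> 2"
    and \<Omega>: "open \<Omega>" "\<Omega> \<noteq> {}" "bounded \<Omega>"
    and \<epsilon>: "0 < \<epsilon>" "C1_Hoelder_boundary \<epsilon> \<Omega>"
    and p: "1 < p" "p \<le> real DIM('a)" and m: "0 < m"
  shows "optimal_eigenvalue p m \<Omega> = 0"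
proof -
  let ?S = "surface_measure \<Omega>"
  interpret S: finite_measure ?S by (rule finite_surface_measure[OF dim \<Omega>(1,3) \<epsilon>])
  have \<Omega>b: "\<Omega> \<in> sets borel" using \<Omega>(1) by simp
  obtain y where y: "y \<in> \<Omega>" using \<Omega>(2) by blast
  have "\<Omega> \<noteq> UNIV" using \<Omega>(3) not_bounded_UNIV by blast
  then obtain x0 where x0: "x0 \<in> frontier \<Omega>" using \<Omega>(2) frontier_eq_empty by blast
  have "x0 \<notin> \<Omega>" using x0 \<Omega>(1) by (simp add: frontier_def interior_open)
  then have d: "0 < dist x0 y" using y by auto
  \<comment> \<open>The cutoff equals 1 beyond \<open>2 * R\<close>, half the distance from
    \<open>x0\<close> to \<open>y\<close>, hence on the ball around \<open>y\<close> fixed below.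
    The volume \<open>V\<close> of that ball bounds the denominator from below for every \<delta>,
    and the energy is therefore asked to be at most \<open>\<delta> * V\<close>.\<close>
  define R where "R = dist x0 y / 4"
  obtain \<rho>0 where \<rho>0: "0 < \<rho>0" "ball y \<rho>0 \<subseteq> \<Omega>" using y \<Omega>(1) by (meson openE)
  define \<rho> where "\<rho> = min \<rho>0 (dist x0 y / 2)"
  have \<rho>: "0 < \<rho>" "ball y \<rho> \<subseteq> \<Omega>" using \<rho>0 d by (auto simp: \<rho>_def)
  obtain V where V: "0 < V" "emeasure lborel (ball y \<rho>) = ennreal V" using ball_measure_pos[OF \<rho>(1)] by blast
  have main: "optimal_eigenvalue p m \<Omega> \<le> ennreal \<delta>" if \<delta>: "0 < \<delta>" for \<delta>
  proof -
    have R: "0 < R" using d by (simp add: R_def)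
    obtain u G r where u: "C1_gradient u G" and r: "0 < r" "\<And>x. x \<in> ball x0 r \<Longrightarrow> u x = 0"
      and u1: "\<And>x. 2 * R \<le> dist x0 x \<Longrightarrow> u x = 1" and bounds: "\<And>x. 0 \<le> u x" "\<And>x. u x \<le> 1"
      and G: "(\<integral>\<^sup>+x. ennreal (norm (G x) powr p) \<partial>lborel) \<le> ennreal (\<delta> * V)"
      by (rule dyadic_cutoff[OF R p mult_pos_pos[OF \<delta> V(1)], of x0], rule that, assumption+)
    have [measurable]: "u \<in> borel_measurable borel" "G \<in> borel_measurable borel" using C1_gradientD[OF u] by auto
    \<comment> \<open>The trace inequality is localised to the ball of radius \<open>r\<close> in
      which \<open>u\<close> vanishes.\<close>
    obtain \<rho>' C K where tr: "emeasure ?S (frontier \<Omega> \<inter> cball x0 \<rho>') < \<infinity>"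
      "0 < emeasure ?S (frontier \<Omega> \<inter> cball x0 \<rho>')"
      "\<And>w G. C1_gradient w G \<Longrightarrow>
      (\<integral>\<^sup>+x\<in>frontier \<Omega> \<inter> cball x0 \<rho>'. ennreal \<bar>w x\<bar> \<partial>?S) \<le> ennreal C *
        ((\<integral>\<^sup>+x\<in>\<Omega> \<inter> ball x0 r. ennreal \<bar>w x\<bar> \<partial>lborel) + ennreal K * (\<integral>\<^sup>+x\<in>\<Omega> \<inter> ball x0 r. ennreal (norm (G x)) \<partial>lborel))"
      by (rule local_trace_inequality[OF dim \<Omega>(1) \<epsilon> x0 r(1)], rule that, assumption+)
    define A where "A = frontier \<Omega> \<inter> cball x0 \<rho>'"
    have A: "A \<in> sets borel" "A \<subseteq> frontier \<Omega>" "A \<in> sets ?S"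
      by (auto simp: A_def intro!: sets_surface_measure)
    have mA: "0 < measure ?S A" using tr(2) by (simp add: A_def S.emeasure_eq_measure)
    \<comment> \<open>Positive and finite surface measure of \<open>A\<close> makes this
      normalisation to mass \<open>m\<close> meaningful.\<close>
    define \<sigma> where "\<sigma> x = m / measure ?S A * indicator A x" for x
    have \<sigma>: "\<sigma> \<in> Sigma_mass m \<Omega>"
      using A(3) mA m by (auto simp: Sigma_mass_def \<sigma>_def[abs_def] S.emeasure_eq_measure)
    have trace_u: "has_trace p \<Omega> u u" by (rule has_trace_C1[OF \<Omega>(1) S.finite_measure_axioms p(1) u bounds])
    then have "has_trace p \<Omega> u (boundary_trace p \<Omega> u)" unfolding boundary_trace_def by (rule someI[where P="has_trace p \<Omega> u"])
    from trace_vanishes_locally[OF \<Omega>(1) p(1) u r(2) A(1,2) tr(3)[folded A_def] this]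
    have g0: "AE x in ?S. x \<in> A \<longrightarrow> boundary_trace p \<Omega> u x = 0" by blast
    have num2: "(\<integral>\<^sup>+x. ennreal (\<sigma> x * \<bar>boundary_trace p \<Omega> u x\<bar> powr p) \<partial>?S) = 0"
    proof -
      have "(\<integral>\<^sup>+x. ennreal (\<sigma> x * \<bar>boundary_trace p \<Omega> u x\<bar> powr p) \<partial>?S) = (\<integral>\<^sup>+x. 0 \<partial>?S)"
        by (rule nn_integral_cong_AE, rule eventually_mono[OF g0]) (auto simp: \<sigma>_def indicator_def)
      then show ?thesis by simp
    qed
    have num1: "(\<integral>\<^sup>+x. ennreal (norm (weak_grad \<Omega> u x) powr p) \<partial>lebesgue_on \<Omega>) \<le> ennreal (\<delta> * V)"
    proof -
      have "(\<integral>\<^sup>+x. ennreal (norm (weak_grad \<Omega> u x) powr p) \<partial>lebesgue_on \<Omega>) = (\<integral>\<^sup>+x. ennreal (norm (G x) powr p) \<partial>lebesgue_on \<Omega>)"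
        by (rule nn_integral_cong_AE, rule eventually_mono[OF weak_grad_C1[OF \<Omega>(1) u]]) simp
      also have "\<dots> \<le> (\<integral>\<^sup>+x. ennreal (norm (G x) powr p) \<partial>lborel)"
        unfolding nn_integral_lebesgue_on[OF \<Omega>b] by (intro nn_integral_mono) (auto simp: indicator_def)
      finally show ?thesis using G by (rule order_trans)
    qed
    have den: "ennreal V \<le> (\<integral>\<^sup>+x. ennreal (\<bar>u x\<bar> powr p) \<partial>lebesgue_on \<Omega>)"
    proof -
      have "u x = 1" if "x \<in> ball y \<rho>" for x
      proof (rule u1)
        show "2 * R \<le> dist x0 x"
          using that dist_triangle[of x0 y x] by (simp add: R_def \<rho>_def dist_commute)
      qed
      then have "indicator (ball y \<rho>) x \<le> ennreal (\<bar>u x\<bar> powr p) * indicator \<Omega> x" for x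
        using \<rho>(2) by (cases "x \<in> ball y \<rho>") auto
      then have "(\<integral>\<^sup>+x. indicator (ball y \<rho>) x \<partial>lborel) \<le> (\<integral>\<^sup>+x. ennreal (\<bar>u x\<bar> powr p) * indicator \<Omega> x \<partial>lborel)"
        by (rule nn_integral_mono)
      then show ?thesis using V(2) by (simp add: nn_integral_lebesgue_on[OF \<Omega>b])
    qed
    have ray: "rayleigh_quotient p \<Omega> \<sigma> u \<le> ennreal \<delta>"
    proof -
      let ?den = "\<integral>\<^sup>+x. ennreal (\<bar>u x\<bar> powr p) \<partial>lebesgue_on \<Omega>"
      have "0 < ennreal V" using V by simp
      then have "0 < ?den" using den by (rule less_le_trans)
      have "rayleigh_quotient p \<Omega> \<sigma> u = (\<integral>\<^sup>+x. ennreal (norm (weak_grad \<Omega> u x) powr p) \<partial>lebesgue_on \<Omega>) / ?den"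
        unfolding rayleigh_quotient_def using trace_u num2 by auto
      also have "\<dots> \<le> ennreal \<delta>"
      proof (rule divide_le_posI_ennreal)
        have "(\<integral>\<^sup>+x. ennreal (norm (weak_grad \<Omega> u x) powr p) \<partial>lebesgue_on \<Omega>) \<le> ennreal V * ennreal \<delta>"
          using num1 \<delta> V by (simp add: ennreal_mult mult.commute)
        also have "\<dots> \<le> ?den * ennreal \<delta>" by (intro mult_right_mono den) auto
        finally show "(\<integral>\<^sup>+x. ennreal (norm (weak_grad \<Omega> u x) powr p) \<partial>lebesgue_on \<Omega>) \<le> ?den * ennreal \<delta>" .
      qed fact
      finally show ?thesis .
    qed
    have fin\<Omega>: "finite_measure (lebesgue_on \<Omega>)"
      using emeasure_lborel_bounded_finite[OF \<Omega>(3)] \<Omega>b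
      by (intro finite_measureI) (simp add: emeasure_restrict_space space_restrict_space)
    have [measurable]: "u \<in> borel_measurable (lebesgue_on \<Omega>)" "G \<in> borel_measurable (lebesgue_on \<Omega>)"
      by (simp_all add: borel_measurable_lebesgue_onI)
    have "integrable (lebesgue_on \<Omega>) (\<lambda>x. norm (u x) powr p)"
      using bounds p by (intro finite_measure.integrable_const_bound[OF fin\<Omega>, of _ 1]) (auto intro!: powr_le1)
    then have "u \<in> Lp p (lebesgue_on \<Omega>)" by (simp add: Lp_def)
    moreover have "G \<in> Lp p (lebesgue_on \<Omega>)"
    proof -
      have "(\<integral>\<^sup>+x. ennreal (norm (G x) powr p) \<partial>lebesgue_on \<Omega>) \<le> (\<integral>\<^sup>+x. ennreal (norm (G x) powr p) \<partial>lborel)"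
        unfolding nn_integral_lebesgue_on[OF \<Omega>b] by (intro nn_integral_mono) (auto simp: indicator_def)
      also have "\<dots> \<le> ennreal (\<delta> * V)" by (rule G)
      also have "\<dots> < \<infinity>" by simp
      finally have "(\<integral>\<^sup>+x. ennreal (norm (G x) powr p) \<partial>lebesgue_on \<Omega>) < \<infinity>" .
      then have "integrable (lebesgue_on \<Omega>) (\<lambda>x. norm (G x) powr p)" by (intro integrableI_bounded) simp_all
      then show ?thesis by (simp add: Lp_def)
    qed
    ultimately have "u \<in> W1p p \<Omega>" unfolding W1p_def using has_weak_gradient_C1[OF \<Omega>(1) u] by blast
    moreover have "\<not> (AE x in lebesgue_on \<Omega>. u x = 0)"
    proof
      assume "AE x in lebesgue_on \<Omega>. u x = 0"
      then have "(\<integral>\<^sup>+x. ennreal (\<bar>u x\<bar> powr p) \<partial>lebesgue_on \<Omega>) = (\<integral>\<^sup>+x. 0 \<partial>lebesgue_on \<Omega>)"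
        by (intro nn_integral_cong_AE) (auto elim!: eventually_mono)
      then show False using den V by simp
    qed
    ultimately have "first_eigenvalue p \<sigma> \<Omega> \<le> rayleigh_quotient p \<Omega> \<sigma> u"
      unfolding first_eigenvalue_def by (intro INF_lower) auto
    then have "optimal_eigenvalue p m \<Omega> \<le> rayleigh_quotient p \<Omega> \<sigma> u"
      unfolding optimal_eigenvalue_def using \<sigma> by (intro INF_lower2[of \<sigma>])
    then show ?thesis using ray by (rule order_trans)
  qed
  have "optimal_eigenvalue p m \<Omega> \<le> 0"
    by (rule ennreal_le_epsilon) (use main in simp)
  then show ?thesis by simp
qed


subsection \<open>The infimum is not attained\<close>

text \<open>Measurability is glued from countably many closed boxes exhausting \<Omega>. It is
  applied to \<open>weak_grad\<close>, of which only \<open>has_weak_gradient\<close> is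
  known.\<close>

lemma locally_integrable_imp_measurable:
  fixes f :: "'a::euclidean_space \<Rightarrow> 'b::euclidean_space"
  assumes "open \<Omega>" "locally_integrable \<Omega> f"
  shows "f \<in> borel_measurable (lebesgue_on \<Omega>)"
proof -
  obtain \<D> where D: "countable \<D>" "\<D> \<subseteq> Pow \<Omega>" "\<And>X. X \<in> \<D> \<Longrightarrow> \<exists>a b. X = cbox a b" "\<Union>\<D> = \<Omega>"
    using open_countable_Union_open_cbox[OF \<open>open \<Omega>\<close>] by blast
  show ?thesis
  proof (rule measurable_piecewise_restrict[OF D(1)])
    show "space (lebesgue_on \<Omega>) \<subseteq> \<Union> \<D>" using D(4) by (simp add: space_restrict_space)
    fix X assume X: "X \<in> \<D>"
    then obtain a b where ab: "X = cbox a b" using D(3) by blast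
    have sub: "X \<subseteq> \<Omega>" using X D(2) by blast
    show "X \<inter> space (lebesgue_on \<Omega>) \<in> sets (lebesgue_on \<Omega>)"
      using sub ab by (simp add: space_restrict_space Int_absorb2 sets_restrict_space image_iff) (metis Int_absorb1 lmeasurable_cbox fmeasurableD)
    have "integrable (lebesgue_on X) f" using assms(2) sub unfolding locally_integrable_def ab by simp
    then have "f \<in> borel_measurable (lebesgue_on X)" by (rule borel_measurable_integrable)
    also have "lebesgue_on X = restrict_space (lebesgue_on \<Omega>) X"
      using sub assms(1) by (simp add: restrict_restrict_space Int_absorb1 ab)
    finally show "f \<in> borel_measurable (restrict_space (lebesgue_on \<Omega>) X)" .
  qed
qed

lemma ennreal_le_if_divide_less:
  fixes s :: ennreal
  assumes "s / ennreal N < ennreal \<epsilon>" "0 < N" "0 < \<epsilon>"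
  shows "s \<le> ennreal (\<epsilon> * N)"
proof (cases s)
  case (real r)
  then have "r / N < \<epsilon>" using assms by (simp add: divide_ennreal ennreal_less_iff)
  then have "r \<le> \<epsilon> * N" using assms(2) by (simp add: field_simps)
  then show ?thesis unfolding real by (rule ennreal_leI)
next
  case top
  then show ?thesis using assms by (simp add: ennreal_top_divide)
qed

text \<open>All errors are relative to \<open>N\<close>, the integral of
  \<open>\<bar>u x\<bar> powr p\<close>, which prepares the normalisation of the p-th powers. The
  trace \<open>g\<close> is kept beside \<open>U\<close> because the boundary integral with \<sigma>
  is known to be small only for \<open>g\<close>. The factors \<open>2 * 2 powr p\<close> come from
  \<open>nn_integral_norm_powr_add_le\<close>.\<close>

lemma approximate_minimizer:
  fixes \<Omega> :: "'a::euclidean_space set"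
  assumes "open \<Omega>" and p: "1 < p" and \<sigma>: "\<sigma> \<in> borel_measurable (surface_measure \<Omega>)"
    "AE x in surface_measure \<Omega>. 0 \<le> \<sigma> x"
    and \<epsilon>: "0 < \<epsilon>" "\<epsilon> \<le> 1" and u: "u \<in> W1p p \<Omega>" "\<not> (AE x in lebesgue_on \<Omega>. u x = 0)"
    and small: "rayleigh_quotient p \<Omega> \<sigma> u < ennreal \<epsilon>"
  obtains U G g N where "C1_gradient U G" "g \<in> borel_measurable (surface_measure \<Omega>)" "0 < N"
    "(\<integral>\<^sup>+x\<in>\<Omega>. ennreal (norm (G x) powr p) \<partial>lborel) \<le> ennreal (2 * 2 powr p * \<epsilon> * N)"
    "(\<integral>\<^sup>+x\<in>\<Omega>. ennreal (\<bar>U x\<bar> powr p) \<partial>lborel) \<le> ennreal (2 * 2 powr p * N)"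
    "ennreal N \<le> ennreal (2 powr p) * ((\<integral>\<^sup>+x\<in>\<Omega>. ennreal (\<bar>U x\<bar> powr p) \<partial>lborel) + ennreal (\<epsilon> * N))"
    "(\<integral>\<^sup>+x. ennreal (\<bar>U x - g x\<bar> powr p) \<partial>surface_measure \<Omega>) \<le> ennreal (\<epsilon> * N)"
    "(\<integral>\<^sup>+x. ennreal (\<sigma> x * \<bar>g x\<bar> powr p) \<partial>surface_measure \<Omega>) \<le> ennreal (\<epsilon> * N)"
proof -
  let ?L = "lebesgue_on \<Omega>" and ?S = "surface_measure \<Omega>" and ?W = "weak_grad \<Omega> u" and ?g = "boundary_trace p \<Omega> u"
  have \<Omega>: "\<Omega> \<in> sets borel" using \<open>open \<Omega>\<close> by simp
  have um[measurable]: "u \<in> borel_measurable ?L" and ui: "integrable ?L (\<lambda>x. norm (u x) powr p)"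
    using u(1) by (auto simp: W1p_def Lp_def)
  obtain G0 where "has_weak_gradient \<Omega> u G0" using u(1) by (auto simp: W1p_def)
  then have "has_weak_gradient \<Omega> u ?W" unfolding weak_grad_def by (rule someI[where P="has_weak_gradient \<Omega> u"])
  then have Wm[measurable]: "?W \<in> borel_measurable ?L"
    using locally_integrable_imp_measurable[OF \<open>open \<Omega>\<close>] by (auto simp: has_weak_gradient_def)
  \<comment> \<open>A function without trace has quotient \<infinity>, which is not below
    \<epsilon>.\<close>
  have ex: "\<exists>g. has_trace p \<Omega> u g"
    using small by (auto simp: rayleigh_quotient_def split: if_splits)
  then have tr: "has_trace p \<Omega> u ?g" unfolding boundary_trace_def by (rule someI_ex)
  have gm[measurable]: "?g \<in> borel_measurable ?S" using tr by (simp add: has_trace_def Lp_def)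
  let ?den = "\<integral>\<^sup>+x. ennreal (\<bar>u x\<bar> powr p) \<partial>?L"
  let ?n1 = "\<integral>\<^sup>+x. ennreal (norm (?W x) powr p) \<partial>?L" and ?n2 = "\<integral>\<^sup>+x. ennreal (\<sigma> x * \<bar>?g x\<bar> powr p) \<partial>?S"
  have "?den < \<infinity>" using ui by (simp add: integrable_iff_bounded)
  moreover have "?den \<noteq> 0"
  proof
    assume "?den = 0"
    then have "AE x in ?L. ennreal (\<bar>u x\<bar> powr p) = 0" by (subst (asm) nn_integral_0_iff_AE) simp_all
    then have "AE x in ?L. u x = 0" by eventually_elim simp
    with u(2) show False by simp
  qed
  ultimately obtain N where N: "0 < N" "?den = ennreal N"
    by (cases ?den) (auto simp: less_le)
  have quot: "(?n1 + ?n2) / ennreal N < ennreal \<epsilon>"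
    using small ex N(2) by (simp add: rayleigh_quotient_def)
  have num: "?n1 + ?n2 \<le> ennreal (\<epsilon> * N)"
    by (rule ennreal_le_if_divide_less[OF quot N(1) \<epsilon>(1)])
  have n1: "?n1 \<le> ennreal (\<epsilon> * N)" by (rule order_trans[OF _ num]) simp
  have n2: "?n2 \<le> ennreal (\<epsilon> * N)" by (rule order_trans[OF _ num]) simp
  from tr obtain U where U: "\<And>k. Ck 1 (U k)"
    and U1: "(\<lambda>k. \<integral>\<^sup>+x. ennreal (\<bar>U k x - u x\<bar> powr p) \<partial>?L) \<longlonglongrightarrow> 0"
    and U2: "(\<lambda>k. \<integral>\<^sup>+x. ennreal (norm (grad (U k) x - ?W x) powr p) \<partial>?L) \<longlonglongrightarrow> 0"
    and U3: "(\<lambda>k. \<integral>\<^sup>+x. ennreal (\<bar>U k x - ?g x\<bar> powr p) \<partial>?S) \<longlonglongrightarrow> 0"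
    unfolding has_trace_def by blast
  have eN: "0 < ennreal (\<epsilon> * N)" using \<epsilon> N by simp
  have "\<forall>\<^sub>F k in sequentially. (\<integral>\<^sup>+x. ennreal (\<bar>U k x - u x\<bar> powr p) \<partial>?L) < ennreal (\<epsilon> * N) \<and>
     (\<integral>\<^sup>+x. ennreal (norm (grad (U k) x - ?W x) powr p) \<partial>?L) < ennreal (\<epsilon> * N) \<and>
     (\<integral>\<^sup>+x. ennreal (\<bar>U k x - ?g x\<bar> powr p) \<partial>?S) < ennreal (\<epsilon> * N)"
    by (intro eventually_conj order_tendstoD(2)[OF U1 eN] order_tendstoD(2)[OF U2 eN] order_tendstoD(2)[OF U3 eN])
  then obtain k where k: "(\<integral>\<^sup>+x. ennreal (\<bar>U k x - u x\<bar> powr p) \<partial>?L) < ennreal (\<epsilon> * N)"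
     "(\<integral>\<^sup>+x. ennreal (norm (grad (U k) x - ?W x) powr p) \<partial>?L) < ennreal (\<epsilon> * N)"
     "(\<integral>\<^sup>+x. ennreal (\<bar>U k x - ?g x\<bar> powr p) \<partial>?S) < ennreal (\<epsilon> * N)"
    by (auto simp: eventually_sequentially)
  note CU = Ck_imp_C1_gradient[OF U, of k]
  have Um[measurable]: "U k \<in> borel_measurable ?L" "grad (U k) \<in> borel_measurable ?L"
    by (auto intro!: borel_measurable_lebesgue_onI C1_gradientD(4,5)[OF CU])
  show thesis
  proof (rule that[OF CU gm N(1) _ _ _ less_imp_le[OF k(3)] n2])
    have "(\<integral>\<^sup>+x. ennreal (norm (grad (U k) x) powr p) \<partial>?L) \<le> ennreal (2 powr p) *
      ((\<integral>\<^sup>+x. ennreal (norm (grad (U k) x - ?W x) powr p) \<partial>?L) + ?n1)"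
      by (rule nn_integral_norm_powr_add_le[OF Um(2) Wm p])
    also have "\<dots> \<le> ennreal (2 powr p) * (ennreal (\<epsilon> * N) + ennreal (\<epsilon> * N))"
      by (intro mult_left_mono add_mono less_imp_le[OF k(2)] n1) auto
    also have "\<dots> = ennreal (2 * 2 powr p * \<epsilon> * N)"
      using \<epsilon> N by (simp add: ennreal_mult[symmetric] ennreal_plus[symmetric] mult_ac del: ennreal_plus)
    finally show "(\<integral>\<^sup>+x\<in>\<Omega>. ennreal (norm (grad (U k) x) powr p) \<partial>lborel) \<le> ennreal (2 * 2 powr p * \<epsilon> * N)"
      unfolding nn_integral_lebesgue_on[OF \<Omega>] .
    have "(\<integral>\<^sup>+x. ennreal (norm (U k x) powr p) \<partial>?L) \<le> ennreal (2 powr p) *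
      ((\<integral>\<^sup>+x. ennreal (norm (U k x - u x) powr p) \<partial>?L) + (\<integral>\<^sup>+x. ennreal (norm (u x) powr p) \<partial>?L))"
      by (rule nn_integral_norm_powr_add_le[OF Um(1) um p])
    also have "\<dots> \<le> ennreal (2 powr p) * (ennreal (1 * N) + ennreal N)"
    proof (intro mult_left_mono add_mono)
      have "\<epsilon> * N \<le> 1 * N" using \<epsilon> N by (intro mult_right_mono) auto
      then show "(\<integral>\<^sup>+x. ennreal (norm (U k x - u x) powr p) \<partial>?L) \<le> ennreal (1 * N)"
        using less_imp_le[OF k(1)] ennreal_leI[of "\<epsilon> * N" "1 * N"] by (auto intro: order_trans)
    qed (use N in auto)
    also have "\<dots> = ennreal (2 * 2 powr p * N)"
      using N by (simp add: ennreal_mult[symmetric] ennreal_plus[symmetric] mult_ac del: ennreal_plus)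
    finally show "(\<integral>\<^sup>+x\<in>\<Omega>. ennreal (\<bar>U k x\<bar> powr p) \<partial>lborel) \<le> ennreal (2 * 2 powr p * N)"
      unfolding nn_integral_lebesgue_on[OF \<Omega>] by simp
    have "ennreal N = (\<integral>\<^sup>+x. ennreal (norm (u x) powr p) \<partial>?L)" using N by simp
    also have "\<dots> \<le> ennreal (2 powr p) *
      ((\<integral>\<^sup>+x. ennreal (norm (u x - U k x) powr p) \<partial>?L) + (\<integral>\<^sup>+x. ennreal (norm (U k x) powr p) \<partial>?L))"
      by (rule nn_integral_norm_powr_add_le[OF um Um(1) p])
    also have "\<dots> \<le> ennreal (2 powr p) * (ennreal (\<epsilon> * N) + (\<integral>\<^sup>+x. ennreal (norm (U k x) powr p) \<partial>?L))"
      using less_imp_le[OF k(1)] by (intro mult_left_mono add_mono) (auto simp: abs_minus_commute)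
    finally show "ennreal N \<le> ennreal (2 powr p) * ((\<integral>\<^sup>+x\<in>\<Omega>. ennreal (\<bar>U k x\<bar> powr p) \<partial>lborel) + ennreal (\<epsilon> * N))"
      unfolding nn_integral_lebesgue_on[OF \<Omega>] by (simp add: add.commute)
  qed
qed

lemma first_eigenvalue_neq_0:
  fixes \<Omega> :: "'a::euclidean_space set" and p m \<epsilon> :: real
  assumes dim: "DIM('a) \<ge> 2"
    and \<Omega>: "open \<Omega>" "connected \<Omega>" "\<Omega> \<noteq> {}" "bounded \<Omega>"
    and \<epsilon>: "0 < \<epsilon>" "C1_Hoelder_boundary \<epsilon> \<Omega>"
    and p: "1 < p" and m: "0 < m" and \<sigma>: "\<sigma> \<in> Sigma_mass m \<Omega>"
  shows "first_eigenvalue p \<sigma> \<Omega> \<noteq> 0"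
proof
  assume zero: "first_eigenvalue p \<sigma> \<Omega> = 0"
  let ?S = "surface_measure \<Omega>"
  let ?P = "2 powr p"
  interpret S: finite_measure ?S by (rule finite_surface_measure[OF dim \<Omega>(1,4) \<epsilon>])
  have \<Omega>b[measurable]: "\<Omega> \<in> sets borel" using \<Omega>(1) by simp
  have \<sigma>i: "integrable ?S \<sigma>" and \<sigma>0: "AE x in ?S. 0 \<le> \<sigma> x" and \<sigma>m: "(LINT x|?S. \<sigma> x) = m"
    using \<sigma> by (auto simp: Sigma_mass_def)
  have \<sigma>b[measurable]: "\<sigma> \<in> borel_measurable ?S" using \<sigma>i by simp
  define t where "t j = inverse (real (Suc j))" for j
  have t: "0 < t j" "t j \<le> 1" for j by (auto simp: t_def field_simps)
  \<comment> \<open>The tolerance matches the Young inequality with weight \<open>t j\<close>: as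
    \<open>t j powr (1 - p) * \<eta> j = t j\<close>, both terms of the gradient bound are of order
    \<open>t j\<close>.\<close>
  define \<eta> where "\<eta> j = t j powr p" for j
  have \<eta>: "0 < \<eta> j" "\<eta> j \<le> 1" "\<eta> j \<le> t j" for j
  proof -
    show "0 < \<eta> j" using t[of j] by (simp add: \<eta>_def)
    have "t j powr p \<le> t j powr 1" using t[of j] p by (intro powr_mono') auto
    then show "\<eta> j \<le> t j" "\<eta> j \<le> 1" using t[of j] by (auto simp: \<eta>_def)
  qed
  have t0: "(\<lambda>j. ennreal (t j)) \<longlonglongrightarrow> 0" unfolding t_def by (rule ennreal_inverse_Suc_tendsto_0)
  define Q where "Q j U G g N \<longleftrightarrow> C1_gradient U G \<and> g \<in> borel_measurable ?S \<and> 0 < N \<and>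
    (\<integral>\<^sup>+x\<in>\<Omega>. ennreal (norm (G x) powr p) \<partial>lborel) \<le> ennreal (2 * ?P * \<eta> j * N) \<and>
    (\<integral>\<^sup>+x\<in>\<Omega>. ennreal (\<bar>U x\<bar> powr p) \<partial>lborel) \<le> ennreal (2 * ?P * N) \<and>
    ennreal N \<le> ennreal ?P * ((\<integral>\<^sup>+x\<in>\<Omega>. ennreal (\<bar>U x\<bar> powr p) \<partial>lborel) + ennreal (\<eta> j * N)) \<and>
    (\<integral>\<^sup>+x. ennreal (\<bar>U x - g x\<bar> powr p) \<partial>?S) \<le> ennreal (\<eta> j * N) \<and>
    (\<integral>\<^sup>+x. ennreal (\<sigma> x * \<bar>g x\<bar> powr p) \<partial>?S) \<le> ennreal (\<eta> j * N)" for j U G g N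
  have "\<forall>j. \<exists>U G g N. Q j U G g N"
  proof
    fix j
    have "first_eigenvalue p \<sigma> \<Omega> < ennreal (\<eta> j)" using zero \<eta>(1)[of j] by simp
    then obtain u where u: "u \<in> W1p p \<Omega>" "\<not> (AE x in lebesgue_on \<Omega>. u x = 0)"
      "rayleigh_quotient p \<Omega> \<sigma> u < ennreal (\<eta> j)"
      by (auto simp: first_eigenvalue_def INF_less_iff)
    show "\<exists>U G g N. Q j U G g N"
      unfolding Q_def by (rule approximate_minimizer[OF \<Omega>(1) p \<sigma>b \<sigma>0 \<eta>(1,2) u]) blast
  qed
  from choice[OF this] obtain U where "\<forall>j. \<exists>G g N. Q j (U j) G g N" by (rule exE)
  from choice[OF this] obtain G where "\<forall>j. \<exists>g N. Q j (U j) (G j) g N" by (rule exE)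
  from choice[OF this] obtain g where "\<forall>j. \<exists>N. Q j (U j) (G j) (g j) N" by (rule exE)
  from choice[OF this] obtain N where Q: "\<forall>j. Q j (U j) (G j) (g j) (N j)" by (rule exE)
  have U: "C1_gradient (U j) (G j)" and g[measurable]: "g j \<in> borel_measurable ?S" and N: "0 < N j"
    and grad_le: "(\<integral>\<^sup>+x\<in>\<Omega>. ennreal (norm (G j x) powr p) \<partial>lborel) \<le> ennreal (2 * ?P * \<eta> j * N j)"
    and up: "(\<integral>\<^sup>+x\<in>\<Omega>. ennreal (\<bar>U j x\<bar> powr p) \<partial>lborel) \<le> ennreal (2 * ?P * N j)"
    and low: "ennreal (N j) \<le> ennreal ?P * ((\<integral>\<^sup>+x\<in>\<Omega>. ennreal (\<bar>U j x\<bar> powr p) \<partial>lborel) + ennreal (\<eta> j * N j))"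
    and Ug: "(\<integral>\<^sup>+x. ennreal (\<bar>U j x - g j x\<bar> powr p) \<partial>?S) \<le> ennreal (\<eta> j * N j)"
    and \<sigma>g: "(\<integral>\<^sup>+x. ennreal (\<sigma> x * \<bar>g j x\<bar> powr p) \<partial>?S) \<le> ennreal (\<eta> j * N j)" for j
    using Q[unfolded Q_def] by blast+
  note [measurable] = C1_gradientD(4,5)[OF U]
  have US[measurable]: "U j \<in> borel_measurable ?S" for j
    by (intro borel_measurable_surface_measure C1_gradientD(4)[OF U])
  define w where "w j x = (1 / N j) * \<bar>U j x\<bar> powr p" for j x
  define H where "H j x = (1 / N j) *\<^sub>R ((p * (\<bar>U j x\<bar> powr (p - 1) * sgn (U j x))) *\<^sub>R G j x)" for j x
  have w: "C1_gradient (w j) (H j)" for j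
    unfolding w_def[abs_def] H_def[abs_def] by (intro C1_gradient_cmult C1_gradient_abs_powr U p)
  have w0: "0 \<le> w j x" for j x using N[of j] by (simp add: w_def)
  note [measurable] = C1_gradientD(4,5)[OF w]
  have H_lim: "(\<lambda>j. \<integral>\<^sup>+x\<in>\<Omega>. ennreal (norm (H j x)) \<partial>lborel) \<longlonglongrightarrow> 0"
  proof (rule ennreal_tendsto_0_squeeze)
    show "(\<lambda>j. ennreal (4 * p * ?P) * ennreal (t j)) \<longlonglongrightarrow> 0" by (rule ennreal_tendsto_0_cmult[OF t0])
    fix j
    have "(\<integral>\<^sup>+x\<in>\<Omega>. ennreal (norm (H j x)) \<partial>lborel) \<le>
      (\<integral>\<^sup>+x. ennreal (p * t j / N j) * (ennreal (\<bar>U j x\<bar> powr p) * indicator \<Omega> x) +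
         ennreal (p * t j powr (1 - p) / N j) * (ennreal (norm (G j x) powr p) * indicator \<Omega> x) \<partial>lborel)"
    proof (rule nn_integral_mono)
      fix x
      have "norm (H j x) = norm ((p * (\<bar>U j x\<bar> powr (p - 1) * sgn (U j x))) *\<^sub>R G j x) / N j"
        using N[of j] by (simp add: H_def)
      also have "\<dots> \<le> (p * t j * \<bar>U j x\<bar> powr p + p * t j powr (1 - p) * norm (G j x) powr p) / N j"
        using N[of j] t[of j] p by (intro divide_right_mono norm_gradient_abs_powr_le) auto
      finally have "norm (H j x) \<le> p * t j / N j * \<bar>U j x\<bar> powr p + p * t j powr (1 - p) / N j * norm (G j x) powr p"
        by (simp add: add_divide_distrib)
      from ennreal_leI[OF this]
      show "ennreal (norm (H j x)) * indicator \<Omega> x \<le>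
        ennreal (p * t j / N j) * (ennreal (\<bar>U j x\<bar> powr p) * indicator \<Omega> x) +
         ennreal (p * t j powr (1 - p) / N j) * (ennreal (norm (G j x) powr p) * indicator \<Omega> x)"
        using p N[of j] t[of j] by (cases "x \<in> \<Omega>") (simp_all add: ennreal_mult[symmetric] ennreal_plus[symmetric] del: ennreal_plus)
    qed
    also have "\<dots> = ennreal (p * t j / N j) * (\<integral>\<^sup>+x\<in>\<Omega>. ennreal (\<bar>U j x\<bar> powr p) \<partial>lborel) +
         ennreal (p * t j powr (1 - p) / N j) * (\<integral>\<^sup>+x\<in>\<Omega>. ennreal (norm (G j x) powr p) \<partial>lborel)"
      by (simp add: nn_integral_add nn_integral_cmult)
    also have "\<dots> \<le> ennreal (p * t j / N j) * ennreal (2 * ?P * N j) +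
         ennreal (p * t j powr (1 - p) / N j) * ennreal (2 * ?P * \<eta> j * N j)"
      by (intro add_mono mult_left_mono up grad_le) auto
    also have "\<dots> = ennreal (p * t j / N j * (2 * ?P * N j) + p * t j powr (1 - p) / N j * (2 * ?P * \<eta> j * N j))"
      using p N[of j] t[of j] \<eta>[of j] by (simp add: ennreal_mult[symmetric] ennreal_plus[symmetric] del: ennreal_plus)
    also have "p * t j / N j * (2 * ?P * N j) + p * t j powr (1 - p) / N j * (2 * ?P * \<eta> j * N j) = 4 * p * ?P * t j"
    proof -
      have "t j powr (1 - p) * \<eta> j = t j" using t[of j] by (simp add: \<eta>_def powr_add[symmetric])
      then have "p * t j powr (1 - p) / N j * (2 * ?P * \<eta> j * N j) = 2 * p * ?P * t j"
        using N[of j] by (simp add: field_simps)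
      moreover have "p * t j / N j * (2 * ?P * N j) = 2 * p * ?P * t j" using N[of j] by simp
      ultimately show ?thesis by simp
    qed
    also have "ennreal (4 * p * ?P * t j) = ennreal (4 * p * ?P) * ennreal (t j)"
      using p t[of j] by (intro ennreal_mult) auto
    finally show "(\<integral>\<^sup>+x\<in>\<Omega>. ennreal (norm (H j x)) \<partial>lborel) \<le> ennreal (4 * p * ?P) * ennreal (t j)" .
  qed
  obtain a' where a': "(\<lambda>j. \<integral>\<^sup>+x\<in>\<Omega>. ennreal \<bar>w j x - a' j\<bar> \<partial>lborel) \<longlonglongrightarrow> 0"
    using poincare_sequence[OF \<Omega> segment_condition_C1_Hoelder[OF dim \<Omega>(1) \<epsilon>] w H_lim] by blast
  \<comment> \<open>As \<open>w j\<close> is nonnegative, the modulus of the constant is at least as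
    close to it; nonnegative constants pass to \<open>ennreal\<close> without truncation.\<close>
  define a where "a j = \<bar>a' j\<bar>" for j
  let ?F = "\<lambda>j. \<integral>\<^sup>+x\<in>\<Omega>. ennreal \<bar>w j x - a j\<bar> \<partial>lborel"
  have F: "?F \<longlonglongrightarrow> 0"
  proof (rule ennreal_tendsto_0_squeeze[OF a'])
    fix j
    have "\<bar>w j x - a j\<bar> \<le> \<bar>w j x - a' j\<bar>" for x using w0[of j x] by (simp add: a_def abs_if)
    then show "?F j \<le> (\<integral>\<^sup>+x\<in>\<Omega>. ennreal \<bar>w j x - a' j\<bar> \<partial>lborel)"
      by (intro nn_integral_mono mult_right_mono ennreal_leI) auto
  qed
  obtain v where v: "emeasure lborel \<Omega> = ennreal v" "0 \<le> v"
    using emeasure_lborel_bounded_finite[OF \<Omega>(4)] by (cases "emeasure lborel \<Omega>") auto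
  text \<open>The normalisation keeps the constants \<open>a j\<close> away from zero.\<close>
  have one_le: "1 \<le> ennreal ?P * (?F j + ennreal (a j * v) + ennreal (t j))" for j
  proof -
    have "ennreal (N j) \<le> ennreal ?P * ((\<integral>\<^sup>+x\<in>\<Omega>. ennreal (\<bar>U j x\<bar> powr p) \<partial>lborel) + ennreal (\<eta> j * N j))"
      by (rule low)
    then have "ennreal (1 / N j) * ennreal (N j) \<le>
      ennreal (1 / N j) * (ennreal ?P * ((\<integral>\<^sup>+x\<in>\<Omega>. ennreal (\<bar>U j x\<bar> powr p) \<partial>lborel) + ennreal (\<eta> j * N j)))"
      by (rule mult_left_mono) auto
    also have "ennreal (1 / N j) * ennreal (N j) = 1" using N[of j] by (simp add: ennreal_mult[symmetric])
    also have "ennreal (1 / N j) * (ennreal ?P * ((\<integral>\<^sup>+x\<in>\<Omega>. ennreal (\<bar>U j x\<bar> powr p) \<partial>lborel) + ennreal (\<eta> j * N j))) =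
      ennreal ?P * (ennreal (1 / N j) * (\<integral>\<^sup>+x\<in>\<Omega>. ennreal (\<bar>U j x\<bar> powr p) \<partial>lborel) + ennreal (1 / N j) * ennreal (\<eta> j * N j))"
      by (simp add: distrib_left mult_ac)
    also have "ennreal (1 / N j) * (\<integral>\<^sup>+x\<in>\<Omega>. ennreal (\<bar>U j x\<bar> powr p) \<partial>lborel) = (\<integral>\<^sup>+x\<in>\<Omega>. ennreal \<bar>w j x - 0\<bar> \<partial>lborel)"
      using N[of j] by (subst nn_integral_cmult[symmetric]) (auto simp: w_def ennreal_mult[symmetric] mult.assoc[symmetric] abs_mult)
    also have "ennreal (1 / N j) * ennreal (\<eta> j * N j) = ennreal (\<eta> j)"
      using N[of j] \<eta>[of j] by (simp add: ennreal_mult[symmetric])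
    also have "(\<integral>\<^sup>+x\<in>\<Omega>. ennreal \<bar>w j x - 0\<bar> \<partial>lborel) \<le> ?F j + (\<integral>\<^sup>+x\<in>\<Omega>. ennreal \<bar>a j - 0\<bar> \<partial>lborel)"
      by (rule set_nn_integral_abs_triangle) auto
    also have "(\<integral>\<^sup>+x\<in>\<Omega>. ennreal \<bar>a j - 0\<bar> \<partial>lborel) = ennreal (a j * v)"
      using v by (subst nn_integral_cmult_indicator) (auto simp: a_def ennreal_mult)
    also have "ennreal (\<eta> j) \<le> ennreal (t j)" using \<eta>(3) by (rule ennreal_leI)
    finally show ?thesis by (simp add: add_left_mono add_right_mono mult_left_mono)
  qed
  \<comment> \<open>The solution for \<open>a j\<close> of
    \<open>1 = 1 / 2 + ?P * (a j * (v + 1))\<close>, once the error terms of \<open>one_le\<close>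
    are below 1 / 2. Replacing \<open>v\<close> by \<open>v + 1\<close> keeps the denominator
    positive, as only \<open>0 \<le> v\<close> is recorded.\<close>
  define a0 where "a0 = 1 / (2 * ?P * (v + 1))"
  have a0: "0 < a0" using v by (simp add: a0_def)
  have lim: "(\<lambda>j. ennreal ?P * (?F j + ennreal (t j))) \<longlonglongrightarrow> 0"
    by (intro ennreal_tendsto_0_cmult ennreal_tendsto_0_add F t0)
  define h :: real where "h = 1 / 2"
  have "0 < ennreal h" unfolding h_def ennreal_less_zero_iff by simp
  with lim have ev: "\<forall>\<^sub>F j in sequentially. ennreal ?P * (?F j + ennreal (t j)) < ennreal h"
    by (rule order_tendstoD(2))
  have h0: "0 \<le> h" by (simp add: h_def)
  from ev have a_ge: "\<forall>\<^sub>F j in sequentially. a0 \<le> a j"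
  proof (rule eventually_mono)
    fix j assume *: "ennreal ?P * (?F j + ennreal (t j)) < ennreal h"
    have "ennreal 1 \<le> ennreal ?P * (?F j + ennreal (t j)) + ennreal ?P * ennreal (a j * v)"
      using one_le[of j] by (simp add: distrib_left ac_simps)
    also have "\<dots> \<le> ennreal h + ennreal ?P * ennreal (a j * v)"
      using * by (intro add_right_mono less_imp_le)
    also have "\<dots> = ennreal (h + ?P * (a j * v))"
      using v h0 by (simp add: a_def ennreal_mult[symmetric] ennreal_plus[symmetric] del: ennreal_plus)
    finally have "1 \<le> h + ?P * (a j * v)"
      using v h0 by (subst (asm) ennreal_le_iff) (auto simp: a_def)
    also have "\<dots> \<le> h + ?P * (a j * (v + 1))"
      by (intro add_left_mono mult_left_mono) (auto simp: a_def)
    finally have "1 \<le> 2 * ?P * (v + 1) * a j" by (simp add: h_def mult_ac)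
    then show "a0 \<le> a j" using v by (simp add: a0_def pos_divide_le_eq mult_ac)
  qed
  have local_zero: "\<exists>\<rho>>0. AE x in ?S. x \<in> cball x0 \<rho> \<longrightarrow> \<sigma> x = 0" if x0: "x0 \<in> frontier \<Omega>" for x0
  proof -
    obtain \<rho> C K where \<rho>: "0 < \<rho>" and tr:
      "\<And>w G. C1_gradient w G \<Longrightarrow>
      (\<integral>\<^sup>+x\<in>frontier \<Omega> \<inter> cball x0 \<rho>. ennreal \<bar>w x\<bar> \<partial>?S) \<le> ennreal C *
        ((\<integral>\<^sup>+x\<in>\<Omega> \<inter> ball x0 1. ennreal \<bar>w x\<bar> \<partial>lborel) + ennreal K * (\<integral>\<^sup>+x\<in>\<Omega> \<inter> ball x0 1. ennreal (norm (G x)) \<partial>lborel))"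
      by (rule local_trace_inequality[OF dim \<Omega>(1) \<epsilon> x0 zero_less_one], rule that, assumption+)
    define A where "A = frontier \<Omega> \<inter> cball x0 \<rho>"
    have A[measurable]: "A \<in> sets ?S" by (auto simp: A_def intro!: sets_surface_measure)
    have wS[measurable]: "w j \<in> borel_measurable ?S" for j
      by (intro borel_measurable_surface_measure C1_gradientD(4)[OF w])
    let ?T = "\<lambda>j. \<integral>\<^sup>+x\<in>A. ennreal \<bar>w j x - a j\<bar> \<partial>?S"
    \<comment> \<open>The trace inequality is applied to \<open>w j - a j\<close>, which has the
      same gradient as \<open>w j\<close>.\<close>
    have T: "?T \<longlonglongrightarrow> 0"
    proof (rule ennreal_tendsto_0_squeeze)
      show "(\<lambda>j. ennreal C * (?F j + ennreal K * (\<integral>\<^sup>+x\<in>\<Omega>. ennreal (norm (H j x)) \<partial>lborel))) \<longlonglongrightarrow> 0"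
        by (intro ennreal_tendsto_0_cmult ennreal_tendsto_0_add F H_lim)
      show "?T j \<le> ennreal C * (?F j + ennreal K * (\<integral>\<^sup>+x\<in>\<Omega>. ennreal (norm (H j x)) \<partial>lborel))" for j
        unfolding A_def
        by (rule order_trans[OF tr[OF C1_gradient_diff_const[OF w]]])
          (intro mult_left_mono add_mono set_nn_integral_mono_set; simp)
    qed
    \<comment> \<open>Free of \<open>j\<close>, with \<open>a0\<close> in place of the varying
      constants: an integral bounded by quantities tending to 0 is 0, and on \<open>A\<close> the
      function vanishes only where \<sigma> does.\<close>
    define f where "f x = ennreal (a0 * \<sigma> x / (1 + \<sigma> x)) * indicator A x" for x
    have f_le: "(\<integral>\<^sup>+x. f x \<partial>?S) \<le> ennreal (2 * ?P) * ennreal (t j) + ?T j" if aj: "a0 \<le> a j" for j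
    proof -
      have "(\<integral>\<^sup>+x. f x \<partial>?S) \<le>
        (\<integral>\<^sup>+x. ennreal (?P / N j) * ennreal (\<bar>U j x - g j x\<bar> powr p) + ennreal (?P / N j) * ennreal (\<sigma> x * \<bar>g j x\<bar> powr p)
          + ennreal \<bar>w j x - a j\<bar> * indicator A x \<partial>?S)"
      proof (rule nn_integral_mono_AE, rule eventually_mono[OF \<sigma>0])
        fix x assume s: "0 \<le> \<sigma> x"
        let ?d = "\<bar>U j x - g j x\<bar> powr p" and ?b = "\<bar>g j x\<bar> powr p" and ?e = "\<bar>w j x - a j\<bar>"
        have q: "0 \<le> \<sigma> x / (1 + \<sigma> x)" "\<sigma> x / (1 + \<sigma> x) \<le> 1" "\<sigma> x / (1 + \<sigma> x) \<le> \<sigma> x"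
          using s by (auto simp: divide_simps distrib_left)
        \<comment> \<open>This feeds into \<open>a0 \<le> a j \<le> w j x + ?e\<close>: the constant
          is dominated by the approximation error of the trace, the trace itself and the distance of
          \<open>w j\<close> from \<open>a j\<close>.\<close>
        have "w j x \<le> (1 / N j) * (?P * (?d + ?b))"
          unfolding w_def using norm_powr_add_le[OF p, of "U j x" "g j x"] N[of j] by (intro mult_left_mono) auto
        then have "a0 \<le> ?P / N j * ?d + ?P / N j * ?b + ?e" using aj by (simp add: distrib_left)
        then have "a0 * (\<sigma> x / (1 + \<sigma> x)) \<le> (?P / N j * ?d + ?P / N j * ?b + ?e) * (\<sigma> x / (1 + \<sigma> x))"
          using q by (intro mult_right_mono)
        also have "\<dots> = ?P / N j * ?d * (\<sigma> x / (1 + \<sigma> x)) + ?P / N j * ?b * (\<sigma> x / (1 + \<sigma> x)) + ?e * (\<sigma> x / (1 + \<sigma> x))"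
          by (simp only: distrib_right)
        also have "\<dots> \<le> ?P / N j * ?d * 1 + ?P / N j * ?b * \<sigma> x + ?e * 1"
          using q N[of j] by (intro add_mono mult_left_mono) auto
        finally have "a0 * \<sigma> x / (1 + \<sigma> x) \<le> ?P / N j * ?d + ?P / N j * (\<sigma> x * ?b) + ?e" by (simp add: mult_ac)
        from ennreal_leI[OF this] show "f x \<le> ennreal (?P / N j) * ennreal ?d + ennreal (?P / N j) * ennreal (\<sigma> x * ?b)
          + ennreal ?e * indicator A x"
          using N[of j] s by (cases "x \<in> A") (simp_all add: f_def ennreal_mult[symmetric] ennreal_plus[symmetric] del: ennreal_plus)
      qed
      also have "\<dots> = ennreal (?P / N j) * (\<integral>\<^sup>+x. ennreal (\<bar>U j x - g j x\<bar> powr p) \<partial>?S)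
         + ennreal (?P / N j) * (\<integral>\<^sup>+x. ennreal (\<sigma> x * \<bar>g j x\<bar> powr p) \<partial>?S) + ?T j"
        by (simp add: nn_integral_add nn_integral_cmult)
      also have "\<dots> \<le> ennreal (?P / N j) * ennreal (\<eta> j * N j) + ennreal (?P / N j) * ennreal (\<eta> j * N j) + ?T j"
        by (intro add_mono mult_left_mono Ug \<sigma>g order_refl) auto
      also have "ennreal (?P / N j) * ennreal (\<eta> j * N j) + ennreal (?P / N j) * ennreal (\<eta> j * N j) = ennreal (2 * ?P * \<eta> j)"
        using N[of j] \<eta>[of j] by (simp add: ennreal_mult[symmetric] ennreal_plus[symmetric] del: ennreal_plus)
      also have "\<dots> \<le> ennreal (2 * ?P * t j)" using \<eta>(3)[of j] by (intro ennreal_leI mult_left_mono) auto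
      also have "\<dots> = ennreal (2 * ?P) * ennreal (t j)" using t[of j] by (intro ennreal_mult) auto
      finally show ?thesis by (simp add: add_right_mono)
    qed
    have "(\<lambda>j. ennreal (2 * ?P) * ennreal (t j) + ?T j) \<longlonglongrightarrow> 0"
      by (intro ennreal_tendsto_0_cmult ennreal_tendsto_0_add t0 T)
    then have "(\<integral>\<^sup>+x. f x \<partial>?S) \<le> 0"
      by (rule tendsto_lowerbound) (use f_le in \<open>auto intro: eventually_mono[OF a_ge]\<close>)
    moreover have [measurable]: "f \<in> borel_measurable ?S" unfolding f_def[abs_def] by measurable
    ultimately have "AE x in ?S. f x = 0" by (subst nn_integral_0_iff_AE[symmetric]) auto
    moreover have "AE x in ?S. x \<in> frontier \<Omega>" using AE_space[of ?S] by (simp add: space_surface_measure)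
    ultimately have "AE x in ?S. x \<in> cball x0 \<rho> \<longrightarrow> \<sigma> x = 0"
      using \<sigma>0
    proof eventually_elim
      case (elim x)
      show ?case
      proof
        assume "x \<in> cball x0 \<rho>"
        then have "x \<in> A" using elim by (simp add: A_def)
        then have "a0 * \<sigma> x / (1 + \<sigma> x) \<le> 0" using elim(1) by (simp add: f_def ennreal_eq_0_iff)
        then have "a0 * \<sigma> x \<le> 0" using elim(3) by (simp add: divide_le_0_iff)
        then show "\<sigma> x = 0" using a0 elim(3) by (simp add: mult_le_0_iff)
      qed
    qed
    then show ?thesis using \<rho> by blast
  qed
  from local_zero have "\<forall>x\<in>frontier \<Omega>. \<exists>\<rho>>0. AE y in ?S. y \<in> cball x \<rho> \<longrightarrow> \<sigma> y = 0" by blast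
  from bchoice[OF this] obtain \<rho> where \<rho>: "\<forall>x\<in>frontier \<Omega>. 0 < \<rho> x \<and> (AE y in ?S. y \<in> cball x (\<rho> x) \<longrightarrow> \<sigma> y = 0)"
    by (rule exE)
  have "compact (frontier \<Omega>)" using \<Omega>(4) by (rule compact_frontier_bounded)
  then obtain C where C: "C \<subseteq> frontier \<Omega>" "finite C" "frontier \<Omega> \<subseteq> (\<Union>x\<in>C. ball x (\<rho> x))"
    by (rule compactE_image[of _ "frontier \<Omega>" "\<lambda>x. ball x (\<rho> x)"]) (use \<rho> in \<open>auto intro!: centre_in_ball[THEN iffD2]\<close>)
  have "AE y in ?S. \<forall>x\<in>C. y \<in> cball x (\<rho> x) \<longrightarrow> \<sigma> y = 0"
    using C(1,2) \<rho> by (subst AE_ball_countable) (auto intro: countable_finite)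
  moreover have "AE x in ?S. x \<in> frontier \<Omega>" using AE_space[of ?S] by (simp add: space_surface_measure)
  ultimately have "AE x in ?S. \<sigma> x = 0"
  proof eventually_elim
    case (elim y)
    then obtain x where "x \<in> C" "y \<in> ball x (\<rho> x)" using C(3) by blast
    then show ?case using elim(1) ball_subset_cball by blast
  qed
  then have "(LINT x|?S. \<sigma> x) = 0" by (rule integral_eq_zero_AE)
  then show False using \<sigma>m m by simp
qed

theorem proposition4p1:
  fixes \<Omega> :: "'a::euclidean_space set" and p m \<epsilon> :: real
  assumes "DIM('a) \<ge> 2"
    and "open \<Omega>" and "connected \<Omega>" and "\<Omega> \<noteq> {}" and "bounded \<Omega>"
    and "0 < \<epsilon>" and "\<epsilon> \<le> 1" and "C1_Hoelder_boundary \<epsilon> \<Omega>"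
    and "1 < p" and "p \<le> real DIM('a)"
    and "0 < m"
  shows "optimal_eigenvalue p m \<Omega> = 0 \<and>
    (\<forall>\<sigma>\<in>Sigma_mass m \<Omega>. first_eigenvalue p \<sigma> \<Omega> \<noteq> optimal_eigenvalue p m \<Omega>)"
proof -
  have "optimal_eigenvalue p m \<Omega> = 0"
    using assms by (intro optimal_eigenvalue_eq_0) auto
  then show ?thesis
    using first_eigenvalue_neq_0[OF assms(1-6,8,9,11)] by simp
qed

end
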